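(* For $0<\varepsilon<1/\sqrt2$ let $a=\sqrt{1-\varepsilon^2}$ and $\Omega_\varepsilon=(0,a)\times(0,\varepsilon)\subset\mathbb R^2$, a rectangle of diameter one with $W(\Omega_\varepsilon)=\varepsilon$. Let $N_\varepsilon$ be the weighted interval associated with $\Omega_\varepsilon$ and its diameter segment joining $(0,0)$ to $(a,\varepsilon)$. Then for each fixed integer $k\ge1$, as $\varepsilon\downarrow0$, $$\mu_k(N_\varepsilon)-\mu_k(\Omega_\varepsilon)=k^2\pi^2\varepsilon^2+2k^2\pi^2\varepsilon^4+O_k(\varepsilon^6).$$ In particular, $$\lim_{\varepsilon\downarrow0}\frac{\mu_k(N_\varepsilon)-\mu_k(\Omega_\varepsilon)}{W(\Omega_\varepsilon)^2}=k^2\pi^2>0 .$$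
   Context: $W(\Omega)=\min_{e\in\mathbb S^{1}}\operatorname{diam}(\pi_{e^\perp}\Omega)$, where $\pi_{e^\perp}$ is orthogonal projection onto the line perpendicular to $e$ (the usual minimum width of a planar convex domain). The weighted interval $N_\varepsilon$ is $[0,1]$ with measure $h(x)\,dx$, where $x\in(0,1)$ is the arclength coordinate along the diagonal from $(0,0)$ to $(a,\varepsilon)$ and $h(x)$ is the length of the section of $\Omega_\varepsilon$ by the line perpendicular to that diagonal at coordinate $x$. The eigenvalues $0=\mu_0(N_\varepsilon)<\mu_1(N_\varepsilon)\le\cdots$ are those (with multiplicity) of the self-adjoint operator on $L^2((0,1),h\,dx)$ associated with the quadratic form $v\mapsto\int_0^1h|v'|^2\,dx$ on $\{v\in W^{1,2}_{\mathrm{loc}}(0,1):\int_0^1h(|v|^2+|v'|^2)\,dx<\infty\}$. The eigenvalues $0=\mu_0(\Omega_\varepsilon)<\mu_1(\Omega_\varepsilon)\le\cdots$ are the Neumann eigenvalues of $-\Delta$ on $\Omega_\varepsilon$, with multiplicity. $O_k$ means that the implied constant may depend on $k$ (for $\varepsilon$ sufficiently small depending on $k$). *)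

theory Defs
  imports "HOL-Analysis.Analysis" "HOL-Library.Landau_Symbols"
begin

section \<open>Weak gradients\<close>

text \<open>All functions are real valued and defined on the whole space; only their values on the open
  set \<open>S\<close> matter. Elements of \<open>L\<^sup>2\<close> are represented by Borel functions, and identified
  almost everywhere where this matters (multiplicities).\<close>

abbreviation partial_deriv :: "'a::euclidean_space \<Rightarrow> ('a \<Rightarrow> real) \<Rightarrow> 'a \<Rightarrow> real" where
  "partial_deriv i f \<equiv> (\<lambda>x. frechet_derivative f (at x) i)"

primrec C_k :: "nat \<Rightarrow> ('a::euclidean_space \<Rightarrow> real) \<Rightarrow> bool" where
  "C_k 0 f \<longleftrightarrow> continuous_on UNIV f"
| "C_k (Suc n) f \<longleftrightarrow>
     (\<forall>x. f differentiable (at x)) \<and> (\<forall>i\<in>Basis. C_k n (partial_deriv i f))"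

definition test_function :: "'a::euclidean_space set \<Rightarrow> ('a \<Rightarrow> real) \<Rightarrow> bool" where
  "test_function S \<phi> \<longleftrightarrow>
     (\<forall>n. C_k n \<phi>) \<and> (\<exists>K. compact K \<and> K \<subseteq> S \<and> (\<forall>x. x \<notin> K \<longrightarrow> \<phi> x = 0))"

definition L2_loc :: "'a::euclidean_space set \<Rightarrow> ('a \<Rightarrow> 'b::euclidean_space) \<Rightarrow> bool" where
  "L2_loc S f \<longleftrightarrow> f \<in> borel_measurable borel \<and>
     (\<forall>K. compact K \<and> K \<subseteq> S \<longrightarrow> set_integrable lborel K (\<lambda>x. (norm (f x))\<^sup>2))"

definition is_weak_gradient ::
    "'a::euclidean_space set \<Rightarrow> ('a \<Rightarrow> real) \<Rightarrow> ('a \<Rightarrow> 'a) \<Rightarrow> bool" where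
  "is_weak_gradient S v G \<longleftrightarrow>
     (\<forall>\<phi>. test_function S \<phi> \<longrightarrow> (\<forall>i\<in>Basis.
        (LINT x:S|lborel. v x * partial_deriv i \<phi> x) = - (LINT x:S|lborel. (G x \<bullet> i) * \<phi> x)))"

definition W12_loc :: "'a::euclidean_space set \<Rightarrow> ('a \<Rightarrow> real) set" where
  "W12_loc S = {v. L2_loc S v \<and> (\<exists>G. L2_loc S G \<and> is_weak_gradient S v G)}"

text \<open>For \<open>v \<in> W12_loc S\<close> the weak gradient is determined almost everywhere on \<open>S\<close>, so the
  choice below does not affect any of the integrals in which it is used.\<close>

definition weak_gradient :: "'a::euclidean_space set \<Rightarrow> ('a \<Rightarrow> real) \<Rightarrow> 'a \<Rightarrow> 'a" where
  "weak_gradient S v = (SOME G. L2_loc S G \<and> is_weak_gradient S v G)"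


section \<open>The weighted Neumann operator and its eigenvalues\<close>

definition weighted_measure ::
    "'a::euclidean_space set \<Rightarrow> ('a \<Rightarrow> real) \<Rightarrow> 'a measure" where
  "weighted_measure S w = density lborel (\<lambda>x. ennreal (w x) * indicator S x)"

definition L2_space :: "'a::euclidean_space measure \<Rightarrow> ('a \<Rightarrow> real) set" where
  "L2_space M = {f \<in> borel_measurable M. integrable M (\<lambda>x. (f x)\<^sup>2)}"

definition form_domain ::
    "'a::euclidean_space set \<Rightarrow> ('a \<Rightarrow> real) \<Rightarrow> ('a \<Rightarrow> real) set" where
  "form_domain S w = {v \<in> W12_loc S.
     integrable (weighted_measure S w) (\<lambda>x. (v x)\<^sup>2 + (norm (weak_gradient S v x))\<^sup>2)}"

definition energy ::
    "'a::euclidean_space set \<Rightarrow> ('a \<Rightarrow> real) \<Rightarrow> ('a \<Rightarrow> real) \<Rightarrow> ('a \<Rightarrow> real) \<Rightarrow> real" where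
  "energy S w u v = (LINT x|weighted_measure S w. weak_gradient S u x \<bullet> weak_gradient S v x)"

text \<open>The graph of the self-adjoint operator on \<open>L\<^sup>2(S, w dx)\<close> associated with the closed
  quadratic form \<open>energy S w\<close> on \<open>form_domain S w\<close> (first representation theorem).\<close>

definition neumann_operator ::
    "'a::euclidean_space set \<Rightarrow> ('a \<Rightarrow> real) \<Rightarrow> (('a \<Rightarrow> real) \<times> ('a \<Rightarrow> real)) set" where
  "neumann_operator S w = {(u, f). u \<in> form_domain S w \<and> f \<in> L2_space (weighted_measure S w) \<and>
     (\<forall>v\<in>form_domain S w. energy S w u v = (LINT x|weighted_measure S w. f x * v x))}"

definition eigenspace ::
    "'a::euclidean_space set \<Rightarrow> ('a \<Rightarrow> real) \<Rightarrow> real \<Rightarrow> ('a \<Rightarrow> real) set" where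
  "eigenspace S w \<mu> = {u. (u, \<lambda>x. \<mu> * u x) \<in> neumann_operator S w}"

text \<open>The linear space \<open>V\<close>, modulo equality almost everywhere, has a basis with \<open>n\<close> elements.\<close>

definition has_dim_AE :: "'a measure \<Rightarrow> ('a \<Rightarrow> real) set \<Rightarrow> nat \<Rightarrow> bool" where
  "has_dim_AE M V n \<longleftrightarrow> (\<exists>b :: nat \<Rightarrow> 'a \<Rightarrow> real.
     (\<forall>i<n. b i \<in> V) \<and>
     (\<forall>c :: nat \<Rightarrow> real. (AE x in M. (\<Sum>i<n. c i * b i x) = 0) \<longrightarrow> (\<forall>i<n. c i = 0)) \<and>
     (\<forall>u\<in>V. \<exists>c :: nat \<Rightarrow> real. AE x in M. u x = (\<Sum>i<n. c i * b i x)))"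

text \<open>\<open>s 0 \<le> s 1 \<le> \<dots>\<close> lists the eigenvalues, each as often as its multiplicity; the case of an
  empty fibre says that real numbers outside the range of \<open>s\<close> are not eigenvalues. At most one
  such sequence exists.\<close>

definition enumerates_eigenvalues ::
    "'a::euclidean_space set \<Rightarrow> ('a \<Rightarrow> real) \<Rightarrow> (nat \<Rightarrow> real) \<Rightarrow> bool" where
  "enumerates_eigenvalues S w s \<longleftrightarrow> mono s \<and>
     (\<forall>\<mu>. finite {k. s k = \<mu>} \<and>
          has_dim_AE (weighted_measure S w) (eigenspace S w \<mu>) (card {k. s k = \<mu>}))"

definition weighted_neumann_eigenvalue ::
    "'a::euclidean_space set \<Rightarrow> ('a \<Rightarrow> real) \<Rightarrow> nat \<Rightarrow> real" where
  "weighted_neumann_eigenvalue S w = (THE s. enumerates_eigenvalues S w s)"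

text \<open>For \<open>w = 1\<close> the form domain is \<open>W\<^sup>1\<^sup>,\<^sup>2(\<Omega>)\<close> and the operator is the Neumann
  realisation of \<open>-\<Delta>\<close>.\<close>

definition neumann_eigenvalue :: "'a::euclidean_space set \<Rightarrow> nat \<Rightarrow> real" where
  "neumann_eigenvalue \<Omega> = weighted_neumann_eigenvalue \<Omega> (\<lambda>_. 1)"


section \<open>Planar domains\<close>

definition proj_perp :: "'a::euclidean_space \<Rightarrow> 'a \<Rightarrow> 'a" where
  "proj_perp e x = x - (x \<bullet> e) *\<^sub>R e"

definition min_width :: "(real \<times> real) set \<Rightarrow> real" where
  "min_width \<Omega> = (INF e\<in>sphere 0 1. diameter (proj_perp e ` \<Omega>))"

definition rot90 :: "real \<times> real \<Rightarrow> real \<times> real" where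
  "rot90 z = (- snd z, fst z)"

text \<open>Length of the section of \<open>\<Omega>\<close> by the line perpendicular to the segment from \<open>p\<close> to \<open>q\<close>
  through the point of that segment at distance \<open>x\<close> from \<open>p\<close>; the line is parametrised by
  arclength \<open>t\<close>.\<close>

definition section_length ::
    "(real \<times> real) set \<Rightarrow> real \<times> real \<Rightarrow> real \<times> real \<Rightarrow> real \<Rightarrow> real" where
  "section_length \<Omega> p q x =
     (let e = sgn (q - p) in measure lborel {t. p + x *\<^sub>R e + t *\<^sub>R rot90 e \<in> \<Omega>})"

text \<open>Eigenvalues of the weighted interval of a domain of diameter one with diameter segment
  from \<open>p\<close> to \<open>q\<close>.\<close>

definition interval_eigenvalue ::
    "(real \<times> real) set \<Rightarrow> real \<times> real \<Rightarrow> real \<times> real \<Rightarrow> nat \<Rightarrow> real" where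
  "interval_eigenvalue \<Omega> p q = weighted_neumann_eigenvalue {0<..<1} (section_length \<Omega> p q)"

definition side :: "real \<Rightarrow> real" where
  "side \<epsilon> = sqrt (1 - \<epsilon>\<^sup>2)"

definition rectangle :: "real \<Rightarrow> (real \<times> real) set" where
  "rectangle \<epsilon> = {0<..<side \<epsilon>} \<times> {0<..<\<epsilon>}"

definition mu_N :: "nat \<Rightarrow> real \<Rightarrow> real" where
  "mu_N k \<epsilon> = interval_eigenvalue (rectangle \<epsilon>) (0, 0) (side \<epsilon>, \<epsilon>) k"

definition mu_Omega :: "nat \<Rightarrow> real \<Rightarrow> real" where
  "mu_Omega k \<epsilon> = neumann_eigenvalue (rectangle \<epsilon>) k"

end

theory Submission
  imports Defs "HOL-Real_Asymp.Real_Asymp"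
begin

text \<open>
  Both families of eigenvalues can be computed. The section of the rectangle perpendicular to the
  diagonal at arclength \<open>x\<close> has length \<open>\<kappa> * min x (min d (1 - x))\<close> with \<open>d = \<epsilon>\<^sup>2\<close> and
  \<open>\<kappa> = 1 / (a * \<epsilon>)\<close> (\<open>section_length_rectangle\<close>), so the weighted interval carries a trapezoidal
  weight.

  The rectangle. The eigenvalues are the numbers \<open>(m\<pi>/a)\<^sup>2 + (n\<pi>/\<epsilon>)\<^sup>2\<close>, with multiplicity. The products
  of cosines are eigenfunctions: their normal derivative vanishes on the boundary, so a cutoff of
  the gradient can be removed by dominated convergence, and no trace theorem is needed
  (\<open>rectangle_by_parts\<close>). They are complete by the Stone-Weierstrass theorem
  (\<open>cos_annihilator_AE_eq_0\<close>), hence there is no further spectrum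
  (\<open>has_dim_AE_eigenspace_complete\<close>). If \<open>k * \<epsilon> < a\<close>, the first \<open>k + 1\<close> eigenvalues come from the long
  side and \<open>\<mu>\<^sub>k(\<Omega>\<^sub>\<epsilon>) = k\<^sup>2\<pi>\<^sup>2 / (1 - \<epsilon>\<^sup>2)\<close> (\<open>rect_neumann_eigenvalue\<close>).

  The interval. Let \<open>h\<close> be the weight. An eigenfunction \<open>u\<close> for \<open>\<mu> = l\<^sup>2\<close>, together with its flux
  \<open>P = - h u'\<close>, solves the first order system \<open>u' = - P / h\<close>, \<open>P' = \<mu> h u\<close>, and the natural boundary
  condition says that the flux vanishes linearly at both ends (\<open>eigenfunction_regularity\<close>). At the
  left end there is only one such solution up to a factor, because the Wronskian of two of them is
  constant and tends to zero (\<open>left_solution_unique\<close>): the Bessel function \<open>J0 (l * x)\<close> for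
  \<open>x \<le> d\<close>, continued by a cosine. By reflection the same holds at the right end, and the two
  solutions fit together at the midpoint exactly if \<open>l * (1 - 2 * d) + 2 * \<theta> (l * d)\<close> is a multiple of
  \<open>\<pi>\<close>, where \<open>\<theta>\<close> is the polar angle of the curve \<open>(J0, J1)\<close>. This expression is strictly increasing
  in \<open>l\<close> (\<open>total_phase_growth\<close>), so for each \<open>k\<close> there is exactly one frequency \<open>l\<^sub>k\<close> with value
  \<open>k * \<pi>\<close>, and \<open>\<mu>\<^sub>k(N\<^sub>\<epsilon>) = l\<^sub>k\<^sup>2\<close> (\<open>interval_weighted_neumann_eigenvalue\<close>).

  The expansion. From \<open>\<theta> z = z / 2 + O(z\<^sup>3)\<close> one gets \<open>l\<^sub>k * (1 - d) = k * \<pi> + O(d\<^sup>3)\<close>, so the difference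
  of the two eigenvalues is \<open>k\<^sup>2\<pi>\<^sup>2 * (1 / (1 - d)\<^sup>2 - 1 / (1 - d)) + O(d\<^sup>3) = k\<^sup>2\<pi>\<^sup>2 * (d + 2 * d\<^sup>2) + O(d\<^sup>3)\<close>
  (\<open>frequency_asymptotics\<close>).
\<close>

section \<open>Smooth functions and smooth bumps\<close>

lemma C_k_Suc_imp: "C_k (Suc n) f \<Longrightarrow> C_k n f"
proof (induction n arbitrary: f)
  case 0
  then show ?case
    by (auto intro!: differentiable_imp_continuous_on simp: differentiable_on_def differentiable_at_withinI)
next
  case (Suc n)
  then show ?case by (metis C_k.simps(2))
qed

lemma C_k_imp_continuous: "C_k n f \<Longrightarrow> continuous_on UNIV f"
  by (induction n) (simp, use C_k_Suc_imp in blast)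

lemma C_k_const: "C_k n (\<lambda>x::'a::euclidean_space. c)"
  by (induction n arbitrary: c) (auto simp: frechet_derivative_const)

lemma partial_deriv_add:
  assumes "f differentiable (at x)" "g differentiable (at x)"
  shows "partial_deriv i (\<lambda>x. f x + g x) x = partial_deriv i f x + partial_deriv i g x"
  using frechet_derivative_at[OF has_derivative_add[OF assms[unfolded frechet_derivative_works]]]
  by metis

lemma partial_deriv_mult:
  fixes f g :: "'a::euclidean_space \<Rightarrow> real"
  assumes "f differentiable (at x)" "g differentiable (at x)"
  shows "partial_deriv i (\<lambda>x. f x * g x) x = f x * partial_deriv i g x + partial_deriv i f x * g x"
  using frechet_derivative_at[OF has_derivative_mult[OF assms[unfolded frechet_derivative_works]]]
  by metis

lemma C_k_add: "C_k n f \<Longrightarrow> C_k n g \<Longrightarrow> C_k n (\<lambda>x. f x + g x)"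
proof (induction n arbitrary: f g)
  case 0
  then show ?case by (auto intro: continuous_intros)
next
  case (Suc n)
  have "partial_deriv i (\<lambda>x. f x + g x) = (\<lambda>x. partial_deriv i f x + partial_deriv i g x)" for i
    using Suc.prems by (intro ext partial_deriv_add) auto
  with Suc show ?case by (auto intro: differentiable_add)
qed

lemma C_k_mult: "C_k n f \<Longrightarrow> C_k n g \<Longrightarrow> C_k n (\<lambda>x. f x * g x)"
proof (induction n arbitrary: f g)
  case 0
  then show ?case by (auto intro: continuous_intros)
next
  case (Suc n)
  have "partial_deriv i (\<lambda>x. f x * g x)
      = (\<lambda>x. f x * partial_deriv i g x + partial_deriv i f x * g x)" for i
    using Suc.prems by (intro ext partial_deriv_mult) auto
  moreover have "C_k n f" "C_k n g"
    using Suc.prems C_k_Suc_imp by blast+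
  ultimately show ?case
    using Suc by (auto intro!: C_k_add differentiable_mult)
qed

lemma C_k_prod:
  assumes "finite I" "\<And>i. i \<in> I \<Longrightarrow> C_k n (f i)"
  shows "C_k n (\<lambda>x. \<Prod>i\<in>I. f i x)"
  using assms by (induction I rule: finite_induct) (auto intro: C_k_const C_k_mult)

text \<open>A function on the real line is of class \<open>C_k\<close> for all \<open>k\<close> as soon as it belongs to a
  family that is stable under differentiation.\<close>

lemma C_k_real_family:
  assumes "f \<in> F" and "\<And>g. g \<in> F \<Longrightarrow> \<exists>g'\<in>F. \<forall>x. (g has_real_derivative g' x) (at x)"
  shows "C_k n f"
  using assms(1)
proof (induction n arbitrary: f)
  case 0
  then obtain f' where "\<forall>x. (f has_real_derivative f' x) (at x)" using assms(2) by blast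
  then show ?case
    by (auto intro!: continuous_at_imp_continuous_on DERIV_isCont)
next
  case (Suc n)
  then obtain f' where f': "f' \<in> F" "\<forall>x. (f has_real_derivative f' x) (at x)" using assms(2) by blast
  have "frechet_derivative f (at x) = (\<lambda>h. f' x * h)" for x
    using f'(2) frechet_derivative_at[of f "\<lambda>h. f' x * h" x] by (auto simp: has_field_derivative_def)
  then have "partial_deriv 1 f = f'" by auto
  then show ?case using Suc.IH[OF f'(1)] f'(2)
    by (auto simp: real_differentiable_def)
qed

lemma partial_deriv_real:
  assumes "(f has_real_derivative d) (at x)"
  shows "partial_deriv 1 f x = d" "f differentiable (at x)"
  using assms frechet_derivative_at[of f "\<lambda>h. d * h" x]
  by (auto simp: has_field_derivative_def real_differentiable_def fun_eq_iff dest: spec[of _ 1])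

lemma partial_deriv_inner:
  fixes j i :: "'a::euclidean_space"
  assumes "(f has_real_derivative d) (at (x \<bullet> j))"
  shows "((\<lambda>x. f (x \<bullet> j)) has_derivative (\<lambda>h. d * (h \<bullet> j))) (at x)"
    "partial_deriv i (\<lambda>x. f (x \<bullet> j)) x = d * (i \<bullet> j)"
proof -
  show *: "((\<lambda>x. f (x \<bullet> j)) has_derivative (\<lambda>h. d * (h \<bullet> j))) (at x)"
    using assms unfolding has_field_derivative_def
    by (rule has_derivative_compose[rotated]) (auto intro!: derivative_eq_intros)
  show "partial_deriv i (\<lambda>x. f (x \<bullet> j)) x = d * (i \<bullet> j)"
    using frechet_derivative_at[OF *] by metis
qed

lemma C_k_inner:
  fixes j :: "'a::euclidean_space"
  assumes "C_k n f"
  shows "C_k n (\<lambda>x. f (x \<bullet> j))"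
  using assms
proof (induction n arbitrary: f)
  case 0
  then show ?case by (auto intro!: continuous_on_compose2[of UNIV f] continuous_intros)
next
  case (Suc n)
  have d: "(f has_real_derivative partial_deriv 1 f x) (at x)" for x
    using Suc.prems real_differentiable_def[of f x] partial_deriv_real(1)[of f _ x] by auto
  have "partial_deriv i (\<lambda>x. f (x \<bullet> j)) = (\<lambda>x. partial_deriv 1 f (x \<bullet> j) * (i \<bullet> j))" for i
    using partial_deriv_inner(2)[OF d] by auto
  moreover have "(\<lambda>x. f (x \<bullet> j)) differentiable (at x)" for x
    using partial_deriv_inner(1)[OF d] by (auto simp: differentiable_def)
  ultimately show ?case
    using Suc by (auto intro!: C_k_mult C_k_const)
qed

text \<open>The function \<open>exp (- 1 / t)\<close> continued by zero to the left, the standard smooth function that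
  vanishes on a half line.\<close>

definition flat_exp :: "real \<Rightarrow> real" where
  "flat_exp t = (if t \<le> 0 then 0 else exp (- (1 / t)))"

lemma flat_exp_bounds: "0 \<le> flat_exp t" "flat_exp t \<le> 1"
  by (auto simp: flat_exp_def)

text \<open>The derivatives of \<open>flat_exp\<close> have the form \<open>p (1 / t) * exp (- 1 / t)\<close> with a polynomial \<open>p\<close>; this
  family is stable under differentiation, also after an affine change of variables.\<close>

lemma C_k_flat_exp_affine: "C_k n (\<lambda>t. flat_exp (b * t + c))"
proof -
  define F where "F = {\<lambda>t. if b * t + c \<le> 0 then 0 else poly p (1 / (b * t + c)) * exp (- (1 / (b * t + c))) | p. True}"
  show ?thesis
  proof (rule C_k_real_family[where F = F])
    show "(\<lambda>t. flat_exp (b * t + c)) \<in> F"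
      unfolding F_def flat_exp_def by (auto intro!: exI[of _ "1 :: real poly"])
  next
    fix g assume "g \<in> F"
    then obtain p where p: "g = (\<lambda>t. if b * t + c \<le> 0 then 0 else poly p (1 / (b * t + c)) * exp (- (1 / (b * t + c))))"
      by (auto simp: F_def)
    define q where "q = [:0,0,b:] * (p - pderiv p)"
    define g1 where "g1 = (\<lambda>s. if s \<le> 0 then 0 else poly p (1 / s) * exp (- (1 / s)))"
    define g1' where "g1' = (\<lambda>s. if s \<le> 0 then 0 else poly ([:0,0,1:] * (p - pderiv p)) (1 / s) * exp (- (1 / s)))"
    have lim: "((\<lambda>s::real. poly r (1 / s) * exp (- (1 / s))) \<longlongrightarrow> 0) (at_right 0)" for r :: "real poly"
    proof -
      have "((\<lambda>y::real. poly r y * exp (- y)) \<longlongrightarrow> 0) at_top"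
      proof -
        have "((\<lambda>y::real. \<Sum>i\<le>degree r. coeff r i * (y ^ i / exp y)) \<longlongrightarrow> (\<Sum>i\<le>degree r. coeff r i * 0)) at_top"
          by (intro tendsto_intros tendsto_power_div_exp_0)
        then show ?thesis
          by (simp add: poly_altdef sum_distrib_right exp_minus divide_inverse mult.assoc)
      qed
      then show ?thesis
        using filterlim_compose[of "\<lambda>y::real. poly r y * exp (- y)" "nhds 0" at_top "\<lambda>s. 1 / s" "at_right 0"]
          filterlim_inverse_at_top_right by (simp add: inverse_eq_divide)
    qed
    have "(g1 has_real_derivative g1' s) (at s)" for s
    proof -
      consider "s < 0" | "s = 0" | "s > 0" by linarith
      then show ?thesis
      proof cases
        case 1
        have "((\<lambda>_. 0) has_real_derivative g1' s) (at s)" using 1 by (simp add: g1'_def)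
        then show ?thesis
          by (rule has_field_derivative_transform_within_open[where S = "{..<0}"])
             (use 1 in \<open>auto simp: g1_def\<close>)
      next
        case 3
        have "((\<lambda>s. poly p (1 / s) * exp (- (1 / s))) has_real_derivative g1' s) (at s)"
          using 3 unfolding g1'_def
          by (auto intro!: derivative_eq_intros DERIV_chain2[OF poly_DERIV]
              simp: field_simps power2_eq_square)
        then show ?thesis
          by (rule has_field_derivative_transform_within_open[where S = "{0<..}"])
             (use 3 in \<open>auto simp: g1_def\<close>)
      next
        case 2
        have "((\<lambda>h. (g1 (0 + h) - g1 0) / h) \<longlongrightarrow> 0) (at 0)"
        proof (rule filterlim_split_at)
          show "((\<lambda>h. (g1 (0 + h) - g1 0) / h) \<longlongrightarrow> 0) (at_left 0)"
            by (rule tendsto_eventually) (auto simp: eventually_at_filter g1_def)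
          have "((\<lambda>s::real. poly (pCons 0 p) (1 / s) * exp (- (1 / s))) \<longlongrightarrow> 0) (at_right 0)" by (rule lim)
          moreover have "\<forall>\<^sub>F s in at_right 0. poly (pCons 0 p) (1 / s) * exp (- (1 / s)) = (g1 (0 + s) - g1 0) / s"
            by (auto simp: eventually_at_filter g1_def)
          ultimately show "((\<lambda>h. (g1 (0 + h) - g1 0) / h) \<longlongrightarrow> 0) (at_right 0)"
            by (rule Lim_transform_eventually)
        qed
        then show ?thesis using 2 by (simp add: DERIV_def g1'_def)
      qed
    qed
    then have "((\<lambda>t. g1 (b * t + c)) has_real_derivative g1' (b * x + c) * b) (at x)" for x
      by (rule DERIV_chain2) (auto intro!: derivative_eq_intros)
    moreover have "g = (\<lambda>t. g1 (b * t + c))" by (simp add: p g1_def)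
    moreover have "(\<lambda>x. g1' (b * x + c) * b) \<in> F"
      unfolding F_def g1'_def
      by (auto intro!: exI[of _ "[:0,0,b:] * (p - pderiv p)"] simp: fun_eq_iff field_simps)
    ultimately show "\<exists>g'\<in>F. \<forall>x. (g has_real_derivative g' x) (at x)"
      by (intro bexI[of _ "\<lambda>x. g1' (b * x + c) * b"]) auto
  qed
qed

text \<open>For \<open>n > 0\<close> a smooth function that is positive exactly on the box from \<open>c\<close> to \<open>d\<close>. Because
  \<open>flat_exp (n * t) = flat_exp t powr (1 / n)\<close>, these functions tend to the indicator function of the
  open box.\<close>

definition box_bump :: "nat \<Rightarrow> 'a::euclidean_space \<Rightarrow> 'a \<Rightarrow> 'a \<Rightarrow> real" where
  "box_bump n c d x = (\<Prod>i\<in>Basis. flat_exp (real n * (x \<bullet> i) - real n * (c \<bullet> i))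
      * flat_exp (real n * (d \<bullet> i) - real n * (x \<bullet> i)))"

lemma C_k_box_bump: "C_k k (box_bump n c d)"
proof -
  have "C_k k (\<lambda>x::'a. flat_exp (real n * (x \<bullet> i) + - real n * (c \<bullet> i)) * flat_exp (- real n * (x \<bullet> i) + real n * (d \<bullet> i)))" for i
    by (intro C_k_mult C_k_inner[where f = "\<lambda>t. flat_exp (_ * t + _)"] C_k_flat_exp_affine)
  then show ?thesis
    unfolding box_bump_def
    by (intro C_k_prod) (auto simp: algebra_simps)
qed

lemma box_bump_eq_0: "x \<notin> box c d \<Longrightarrow> box_bump n c d x = 0"
proof -
  assume "x \<notin> box c d"
  then obtain i where i: "i \<in> Basis" "x \<bullet> i \<le> c \<bullet> i \<or> d \<bullet> i \<le> x \<bullet> i"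
    by (auto simp: box_def not_less)
  then have "real n * (x \<bullet> i) - real n * (c \<bullet> i) \<le> 0 \<or> real n * (d \<bullet> i) - real n * (x \<bullet> i) \<le> 0"
    by (auto intro: mult_left_mono)
  then show ?thesis
    unfolding box_bump_def using i(1) by (intro prod_zero) (auto simp: flat_exp_def)
qed

lemma box_bump_bounds: "0 \<le> box_bump n c d x" "box_bump n c d x \<le> 1"
  unfolding box_bump_def
  by (auto intro!: prod_nonneg prod_le_1 mult_nonneg_nonneg mult_le_one flat_exp_bounds)

lemma test_function_box_bump:
  assumes "cbox c d \<subseteq> S"
  shows "test_function S (box_bump n c d)"
  unfolding test_function_def using assms box_subset_cbox[of c d]
  by (intro conjI allI exI[of _ "cbox c d"] impI C_k_box_bump box_bump_eq_0) auto

lemma box_bump_tendsto: "(\<lambda>n. box_bump n c d x) \<longlonglongrightarrow> indicator (box c d) x"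
proof (cases "x \<in> box c d")
  case False
  then show ?thesis by (simp add: box_bump_eq_0)
next
  case True
  have E: "(\<lambda>n. flat_exp (real n * t - real n * s)) \<longlonglongrightarrow> 1" if "s < t" for s t
  proof -
    have "(\<lambda>n. exp (- (inverse (real n) * inverse (t - s)))) \<longlonglongrightarrow> exp (- (0 * inverse (t - s)))"
      by (intro tendsto_intros lim_inverse_n)
    moreover have "\<forall>\<^sub>F n in sequentially. exp (- (inverse (real n) * inverse (t - s))) = flat_exp (real n * t - real n * s)"
      using eventually_gt_at_top[of 0] 
    proof eventually_elim
      case (elim n)
      have "real n * t - real n * s = real n * (t - s)" by (simp add: algebra_simps)
      then show ?case using elim that by (auto simp: flat_exp_def mult_le_0_iff field_simps)
    qed
    ultimately show ?thesis by (auto intro: Lim_transform_eventually)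
  qed
  have "(\<lambda>n. box_bump n c d x) \<longlonglongrightarrow> (\<Prod>i\<in>(Basis::'a set). 1 * 1)"
    unfolding box_bump_def using True by (intro tendsto_prod tendsto_mult E) (auto simp: box_def)
  then show ?thesis using True by simp
qed

section \<open>The fundamental lemma of the calculus of variations\<close>

text \<open>The boxes are an intersection stable generator of the Borel sets, so the positive and the
  negative part of \<open>f\<close> are densities of the same measure.\<close>

lemma AE_eq_0_if_box_integrals_eq_0:
  fixes f :: "'a::euclidean_space \<Rightarrow> real"
  assumes f: "integrable lborel f"
    and box: "\<And>c d. (\<integral>x. f x * indicator (box c d) x \<partial>lborel) = 0"
  shows "AE x in lborel. f x = 0"
proof -
  have [measurable]: "f \<in> borel_measurable borel" using f by auto
  define M where "M s = density lborel (\<lambda>x. ennreal (max 0 (s * f x)))" for s :: real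
  have em: "emeasure (M s) B = ennreal (\<integral>x. max 0 (s * f x) * indicator B x \<partial>lborel)" if "B \<in> sets borel" for s B
  proof -
    have "integrable lborel (\<lambda>x. max 0 (s * f x) * indicator B x)"
      using f that by (intro integrable_real_mult_indicator integrable_max) auto
    then have "(\<integral>\<^sup>+ x. ennreal (max 0 (s * f x) * indicator B x) \<partial>lborel) = ennreal (\<integral>x. max 0 (s * f x) * indicator B x \<partial>lborel)"
      by (intro nn_integral_eq_integral) auto
    then show ?thesis
      using that by (simp add: M_def emeasure_density ennreal_mult' ennreal_indicator)
  qed
  have "M 1 = M (-1)"
  proof (rule measure_eqI_generator_eq)
    let ?E = "range (\<lambda>(a, b). box a b :: 'a set)"
    let ?A = "\<lambda>n::nat. box (- (real n *\<^sub>R One)) (real n *\<^sub>R One) :: 'a set"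
    show "Int_stable ?E" by (auto simp: Int_stable_def box_Int_box)
    show "?E \<subseteq> Pow UNIV" "sets (M 1) = sigma_sets UNIV ?E" "sets (M (-1)) = sigma_sets UNIV ?E"
      by (simp_all add: borel_eq_box M_def)
    show "range ?A \<subseteq> ?E" "(\<Union>i. ?A i) = UNIV"
      unfolding UN_box_eq_UNIV by auto
    show "emeasure (M 1) (?A i) \<noteq> \<infinity>" for i by (simp add: em)
    fix X assume "X \<in> ?E"
    then obtain c d where X: "X = box c d" by auto
    have int: "integrable lborel (\<lambda>x. max 0 (s * f x) * indicator X x)" for s
      using f by (intro integrable_real_mult_indicator integrable_max) (auto simp: X)
    have "(\<integral>x. max 0 (1 * f x) * indicator X x \<partial>lborel) - (\<integral>x. max 0 (-1 * f x) * indicator X x \<partial>lborel)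
      = (\<integral>x. f x * indicator X x \<partial>lborel)"
      by (subst Bochner_Integration.integral_diff[symmetric, OF int int])
         (auto intro!: Bochner_Integration.integral_cong simp: max_def indicator_def)
    then show "emeasure (M 1) X = emeasure (M (-1)) X"
      using box[of c d] X by (simp add: em)
  qed
  then have "AE x in lborel. ennreal (max 0 (1 * f x)) = ennreal (max 0 (-1 * f x))"
    unfolding M_def by (subst (asm) sigma_finite_measure.density_unique_iff[OF sigma_finite_lborel]) auto
  then show ?thesis
    by eventually_elim (auto simp: max_def split: if_splits)
qed

lemma AE_eq_0_if_test_integrals_eq_0:
  fixes g :: "'a::euclidean_space \<Rightarrow> real"
  assumes S: "open S"
    and int: "\<And>K. compact K \<Longrightarrow> K \<subseteq> S \<Longrightarrow> set_integrable lborel K g"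
    and test: "\<And>\<phi>. test_function S \<phi> \<Longrightarrow> (LINT x:S|lborel. g x * \<phi> x) = 0"
  shows "AE x in lborel. x \<in> S \<longrightarrow> g x = 0"
proof -
  have on_box: "(\<integral>x. indicator (box c d) x * g x \<partial>lborel) = 0" if "cbox c d \<subseteq> S" for c d
  proof -
    have gK: "integrable lborel (\<lambda>x. indicator (cbox c d) x * g x)"
      using int[OF compact_cbox that] by (simp add: set_integrable_def)
    have eq: "indicator S x * (g x * box_bump n c d x) = box_bump n c d x * (indicator (cbox c d) x * g x)" for n x
    proof (cases "x \<in> box c d")
      case True
      then have "x \<in> cbox c d" using box_subset_cbox by blast
      then show ?thesis using that by (auto simp: indicator_def)
    qed (simp add: box_bump_eq_0)
    have meas: "box_bump n c d \<in> borel_measurable borel" for n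
      using C_k_imp_continuous[OF C_k_box_bump] by (rule borel_measurable_continuous_onI)
    have "(\<lambda>n. \<integral>x. box_bump n c d x * (indicator (cbox c d) x * g x) \<partial>lborel)
        \<longlonglongrightarrow> (\<integral>x. indicator (box c d) x * (indicator (cbox c d) x * g x) \<partial>lborel)"
    proof (rule integral_dominated_convergence[where w = "\<lambda>x. \<bar>indicator (cbox c d) x * g x\<bar>"])
      show "integrable lborel (\<lambda>x. \<bar>indicator (cbox c d) x * g x\<bar>)" using gK by (rule integrable_abs)
      show "(\<lambda>x. box_bump n c d x * (indicator (cbox c d) x * g x)) \<in> borel_measurable lborel" for n
        using borel_measurable_times[OF meas[of n], of "\<lambda>x. indicator (cbox c d) x * g x"]
          borel_measurable_integrable[OF gK] by simp
      show "AE x in lborel. norm (box_bump n c d x * (indicator (cbox c d) x * g x)) \<le> \<bar>indicator (cbox c d) x * g x\<bar>" for n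
        using box_bump_bounds[of n c d] by (auto simp: abs_mult intro!: mult_left_le_one_le)
    qed (use gK in \<open>auto intro!: tendsto_mult_right box_bump_tendsto\<close>)
    moreover have "(\<integral>x. box_bump n c d x * (indicator (cbox c d) x * g x) \<partial>lborel) = 0" for n
      using test[OF test_function_box_bump[OF that]] by (simp add: set_lebesgue_integral_def eq)
    moreover have "indicator (box c d) x * (indicator (cbox c d) x * g x) = indicator (box c d) x * g x" for x
      using box_subset_cbox[of c d] by (auto simp: indicator_def)
    ultimately show ?thesis by (simp add: LIMSEQ_const_iff)
  qed
  have cbox: "AE x in lborel. x \<in> cbox a b \<longrightarrow> g x = 0" if "cbox a b \<subseteq> S" for a b
  proof -
    have gK: "set_integrable lborel (cbox a b) g" using int[OF compact_cbox that] .
    have "AE x in lborel. indicator (box a b) x * g x = 0"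
    proof (rule AE_eq_0_if_box_integrals_eq_0)
      show "integrable lborel (\<lambda>x. indicator (box a b) x * g x)"
        using set_integrable_subset[OF gK, of "box a b"] box_subset_cbox by (auto simp: set_integrable_def)
      fix c d
      obtain c' d' where cd: "box a b \<inter> box c d = box c' d'" "cbox a b \<inter> cbox c d = cbox c' d'"
        using that[OF box_Int_box Int_interval] .
      have eq: "indicator (box a b) x * g x * indicator (box c d) x = indicator (box c' d') x * g x" for x
        unfolding cd(1)[symmetric] by (auto simp: indicator_def)
      show "(\<integral>x. indicator (box a b) x * g x * indicator (box c d) x \<partial>lborel) = 0"
        unfolding eq using on_box[of c' d'] cd(2) that by blast
    qed
    moreover have "AE x in lborel. x \<notin> cbox a b - box a b"
    proof (rule AE_not_in)
      have "emeasure lborel (cbox a b - box a b) = emeasure lborel (cbox a b) - emeasure lborel (box a b)"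
        using emeasure_lborel_box_finite[of a b] by (intro emeasure_Diff) (auto simp: box_subset_cbox)
      then show "cbox a b - box a b \<in> null_sets lborel"
        by (auto simp: null_sets_def emeasure_lborel_box_eq emeasure_lborel_cbox_eq)
    qed
    ultimately show ?thesis by eventually_elim (auto simp: indicator_def)
  qed
  obtain D where D: "countable D" "D \<subseteq> Pow S" "\<And>X. X \<in> D \<Longrightarrow> \<exists>a b. X = cbox a b" "\<Union>D = S"
    using open_countable_Union_open_cbox[OF S] by metis
  have "AE x in lborel. x \<in> X \<longrightarrow> g x = 0" if "X \<in> D" for X
    using D(2) D(3)[OF that] that cbox by auto
  then have "AE x in lborel. \<forall>X\<in>D. x \<in> X \<longrightarrow> g x = 0"
    unfolding AE_ball_countable[OF D(1)] by blast
  then show ?thesis unfolding D(4)[symmetric] by eventually_elim auto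
qed

section \<open>Weak gradients\<close>

lemma test_function_continuous: "test_function S \<phi> \<Longrightarrow> continuous_on UNIV \<phi>"
  unfolding test_function_def using C_k_imp_continuous by blast

lemma continuous_real_measurable: "continuous_on UNIV f \<Longrightarrow> f \<in> borel_measurable (borel :: 'a::topological_space measure)"
  by (rule borel_measurable_continuous_onI)

lemma test_function_partial_deriv:
  assumes "test_function S \<phi>" "i \<in> Basis"
  shows "test_function S (partial_deriv i \<phi>)"
proof -
  obtain K where K: "compact K" "K \<subseteq> S" "\<And>x. x \<notin> K \<Longrightarrow> \<phi> x = 0"
    using assms by (auto simp: test_function_def)
  have "partial_deriv i \<phi> x = 0" if "x \<notin> K" for x
  proof -
    have "((\<lambda>_. 0) has_derivative (\<lambda>_. 0)) (at x)" by simp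
    then have "(\<phi> has_derivative (\<lambda>_. 0)) (at x)"
      by (rule has_derivative_transform_within_open[of _ _ _ _ "- K"])
         (use K that in \<open>auto simp: compact_imp_closed open_Compl\<close>)
    then show ?thesis by (metis frechet_derivative_at)
  qed
  moreover have "C_k n (partial_deriv i \<phi>)" for n
    using assms C_k.simps(2)[of n \<phi>] unfolding test_function_def by blast
  ultimately show ?thesis using K(1,2) by (auto simp: test_function_def)
qed

lemma L2_loc_set_integrable:
  assumes "L2_loc S f" "compact K" "K \<subseteq> S"
  shows "set_integrable lborel K f"
proof (rule set_integrable_bound)
  have [measurable]: "f \<in> borel_measurable borel" using assms by (auto simp: L2_loc_def)
  have "set_integrable lborel K (\<lambda>x. (norm (f x))\<^sup>2)" using assms by (auto simp: L2_loc_def)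
  moreover have "set_integrable lborel K (\<lambda>x. 1::real)"
    using borel_integrable_compact[OF \<open>compact K\<close>, of "\<lambda>x. 1::real"] by (simp add: set_integrable_def)
  ultimately show "set_integrable lborel K (\<lambda>x. (norm (f x))\<^sup>2 + 1)" by (rule set_integral_add(1))
  show "set_borel_measurable lborel K f"
    using \<open>compact K\<close> unfolding set_borel_measurable_def
    by (auto intro!: borel_measurable_scaleR borel_compact borel_measurable_indicator)
  have "norm (f x) \<le> (norm (f x))\<^sup>2 + 1" for x
    using sum_squares_bound[of "norm (f x)" 1] norm_ge_zero[of "f x"] by (simp del: norm_ge_zero)
  then show "AE x in lborel. x \<in> K \<longrightarrow> norm (f x) \<le> norm ((norm (f x))\<^sup>2 + 1)"
    by auto
qed

lemma L2_loc_inner: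
  assumes "L2_loc S f"
  shows "L2_loc S (\<lambda>x. f x \<bullet> i)"
  unfolding L2_loc_def
proof (intro conjI allI impI)
  show [measurable]: "(\<lambda>x. f x \<bullet> i) \<in> borel_measurable borel" using assms by (auto simp: L2_loc_def)
  fix K assume K: "compact K \<and> K \<subseteq> S"
  then have "set_integrable lborel K (\<lambda>x. (norm i)\<^sup>2 * (norm (f x))\<^sup>2)"
    using assms unfolding L2_loc_def by (intro set_integrable_mult_right) auto
  then show "set_integrable lborel K (\<lambda>x. (norm (f x \<bullet> i))\<^sup>2)"
  proof (rule set_integrable_bound)
    show "set_borel_measurable lborel K (\<lambda>x. (norm (f x \<bullet> i))\<^sup>2)"
      using borel_compact[OF conjunct1[OF K]] unfolding set_borel_measurable_def by measurable
    have "(f x \<bullet> i)\<^sup>2 \<le> (norm i)\<^sup>2 * (norm (f x))\<^sup>2" for x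
      using power_mono[OF Cauchy_Schwarz_ineq2[of "f x" i] abs_ge_zero, of 2]
      by (simp add: power_mult_distrib mult.commute)
    then show "AE x in lborel. x \<in> K \<longrightarrow> norm ((norm (f x \<bullet> i))\<^sup>2) \<le> norm ((norm i)\<^sup>2 * (norm (f x))\<^sup>2)"
      by auto
  qed
qed

lemma set_integrable_mult_test_function:
  fixes f :: "'a::euclidean_space \<Rightarrow> real"
  assumes f: "f \<in> borel_measurable borel"
    and int: "\<And>K. compact K \<Longrightarrow> K \<subseteq> S \<Longrightarrow> set_integrable lborel K f"
    and \<phi>: "test_function S \<phi>"
  shows "set_integrable lborel S (\<lambda>x. f x * \<phi> x)"
proof -
  have [measurable]: "\<phi> \<in> borel_measurable borel"
    using test_function_continuous[OF \<phi>] by (rule continuous_real_measurable)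
  obtain K where K: "compact K" "K \<subseteq> S" "\<And>x. x \<notin> K \<Longrightarrow> \<phi> x = 0"
    using \<phi> by (auto simp: test_function_def)
  have "bounded (\<phi> ` K)"
    using K(1) test_function_continuous[OF \<phi>]
    by (meson compact_continuous_image compact_imp_bounded continuous_on_subset subset_UNIV)
  then obtain B where B: "\<And>x. x \<in> K \<Longrightarrow> \<bar>\<phi> x\<bar> \<le> B" by (auto simp: bounded_iff)
  have "set_integrable lborel K (\<lambda>x. f x * \<phi> x)"
  proof (rule set_integrable_bound)
    show "set_integrable lborel K (\<lambda>x. f x * B)" using int K by auto
    show "set_borel_measurable lborel K (\<lambda>x. f x * \<phi> x)"
      using borel_compact[OF K(1)] f unfolding set_borel_measurable_def by measurable
    show "AE x in lborel. x \<in> K \<longrightarrow> norm (f x * \<phi> x) \<le> norm (f x * B)"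
      using B by (fastforce simp: abs_mult intro!: mult_left_mono)
  qed
  moreover have "(\<lambda>x. indicator K x *\<^sub>R (f x * \<phi> x)) = (\<lambda>x. indicator S x *\<^sub>R (f x * \<phi> x))"
    using K by (auto simp: indicator_def fun_eq_iff)
  ultimately show ?thesis unfolding set_integrable_def by metis
qed

lemma weak_gradient_AE_unique:
  assumes S: "open S" and G: "L2_loc S G" "is_weak_gradient S v G"
    and H: "L2_loc S H" "is_weak_gradient S v H"
  shows "AE x in lborel. x \<in> S \<longrightarrow> G x = H x"
proof -
  have "AE x in lborel. x \<in> S \<longrightarrow> G x \<bullet> i - H x \<bullet> i = 0" if i: "i \<in> Basis" for i
  proof (rule AE_eq_0_if_test_integrals_eq_0[OF S])
    note loc = L2_loc_inner[OF G(1), of i] L2_loc_inner[OF H(1), of i]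
    show "set_integrable lborel K (\<lambda>x. G x \<bullet> i - H x \<bullet> i)" if "compact K" "K \<subseteq> S" for K
      using loc[THEN L2_loc_set_integrable] that by (intro set_integral_diff(1)) auto
    fix \<phi> assume \<phi>: "test_function S \<phi>"
    have "set_integrable lborel S (\<lambda>x. (G x \<bullet> i) * \<phi> x)" "set_integrable lborel S (\<lambda>x. (H x \<bullet> i) * \<phi> x)"
      using loc by (auto intro!: set_integrable_mult_test_function[OF _ _ \<phi>] L2_loc_set_integrable simp: L2_loc_def)
    then have "(LINT x:S|lborel. (G x \<bullet> i) * \<phi> x - (H x \<bullet> i) * \<phi> x) = 0"
      using G(2) H(2) \<phi> i unfolding is_weak_gradient_def by (subst set_integral_diff(2)) auto
    then show "(LINT x:S|lborel. (G x \<bullet> i - H x \<bullet> i) * \<phi> x) = 0"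
      by (simp add: left_diff_distrib)
  qed
  then have "AE x in lborel. \<forall>i\<in>Basis. x \<in> S \<longrightarrow> G x \<bullet> i - H x \<bullet> i = 0"
    by (subst AE_ball_countable) (auto intro: countable_finite)
  then show ?thesis
    by eventually_elim (auto intro: euclidean_eqI)
qed

lemma weak_gradient_works:
  assumes "v \<in> W12_loc S"
  shows "L2_loc S (weak_gradient S v)" "is_weak_gradient S v (weak_gradient S v)"
  using assms someI_ex[of "\<lambda>G. L2_loc S G \<and> is_weak_gradient S v G"]
  unfolding W12_loc_def weak_gradient_def by auto

lemma weak_gradient_AE_eq:
  assumes "open S" "v \<in> W12_loc S" "L2_loc S G" "is_weak_gradient S v G"
  shows "AE x in lborel. x \<in> S \<longrightarrow> weak_gradient S v x = G x"
  using weak_gradient_AE_unique[OF assms(1) weak_gradient_works[OF assms(2)] assms(3,4)] .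

text \<open>The integral of a derivative of a compactly supported function vanishes, because difference
  quotients have integral zero by translation invariance.\<close>

lemma integral_partial_deriv_eq_0:
  fixes F :: "'a::euclidean_space \<Rightarrow> real"
  assumes F: "C_k (Suc 0) F" and K: "compact K" "\<And>x. x \<notin> K \<Longrightarrow> F x = 0" and i: "i \<in> Basis"
  shows "(\<integral>x. partial_deriv i F x \<partial>lborel) = 0"
proof -
  let ?D = "partial_deriv i F"
  have contF: "continuous_on UNIV F" using F by (rule C_k_imp_continuous)
  have contD: "continuous_on UNIV ?D" using F i by auto
  have [measurable]: "F \<in> borel_measurable borel" "?D \<in> borel_measurable borel"
    using contF contD by (auto intro: continuous_real_measurable)
  define K' where "K' = (\<lambda>z. fst z + snd z) ` (K \<times> cball 0 1)"
  have K': "compact K'" unfolding K'_def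
    by (intro compact_continuous_image compact_Times K continuous_intros) auto
  have intF: "integrable lborel F"
  proof -
    have "integrable lborel (\<lambda>x. indicator K x *\<^sub>R F x)"
      using K contF by (intro borel_integrable_compact) (auto intro: continuous_on_subset)
    moreover have "(\<lambda>x. indicator K x *\<^sub>R F x) = F" using K(2) by (auto simp: indicator_def fun_eq_iff)
    ultimately show ?thesis by metis
  qed
  define t where "t n = 1 / real (Suc n)" for n
  have t: "0 < t n" "t n \<le> 1" for n by (auto simp: t_def)
  have t0: "t \<longlonglongrightarrow> 0" unfolding t_def by (rule LIMSEQ_ignore_initial_segment[of _ 0 1, simplified, OF lim_1_over_n])
  define q where "q n x = (F (x + t n *\<^sub>R i) - F x) / t n" for n x
  have deriv: "((\<lambda>s. F (x + s *\<^sub>R i)) has_real_derivative ?D (x + s *\<^sub>R i)) (at s)" for x s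
  proof -
    have "(F has_derivative frechet_derivative F (at (x + s *\<^sub>R i))) (at (x + s *\<^sub>R i))"
      using F frechet_derivative_works by auto
    then have "((\<lambda>s. F (x + s *\<^sub>R i)) has_derivative (\<lambda>h. frechet_derivative F (at (x + s *\<^sub>R i)) (h *\<^sub>R i))) (at s)"
      by (rule has_derivative_compose[rotated]) (auto intro!: derivative_eq_intros)
    moreover have "frechet_derivative F (at (x + s *\<^sub>R i)) (h *\<^sub>R i) = ?D (x + s *\<^sub>R i) * h" for h
      using F frechet_derivative_works linear_frechet_derivative[of F] by (auto simp: linear_cmul)
    ultimately show ?thesis by (simp add: has_field_derivative_def)
  qed
  have "bounded (?D ` K')"
    using K' contD by (meson compact_continuous_image compact_imp_bounded continuous_on_subset subset_UNIV)
  then obtain B where B: "\<And>x. x \<in> K' \<Longrightarrow> \<bar>?D x\<bar> \<le> B" by (auto simp: bounded_iff)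
  have KK': "x \<in> K'" if "x + s *\<^sub>R i \<in> K" "\<bar>s\<bar> \<le> 1" for x s
    unfolding K'_def using that i
    by (intro image_eqI[of _ _ "(x + s *\<^sub>R i, - s *\<^sub>R i)"]) auto
  have D0: "?D x = 0" if "x \<notin> K" for x
  proof -
    have "((\<lambda>_. 0) has_derivative (\<lambda>_. 0)) (at x)" by simp
    then have "(F has_derivative (\<lambda>_. 0)) (at x)"
      by (rule has_derivative_transform_within_open[of _ _ _ _ "- K"])
         (use K that in \<open>auto simp: compact_imp_closed open_Compl\<close>)
    then show ?thesis by (metis frechet_derivative_at)
  qed
  have bound: "\<bar>q n x\<bar> \<le> B * indicator K' x" for n x
  proof (cases "x \<in> K'")
    case False
    then have "x \<notin> K" "x + t n *\<^sub>R i \<notin> K" using KK'[of x 0] KK'[of x "t n"] t[of n] by auto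
    then show ?thesis using False K(2) by (simp add: q_def)
  next
    case True
    obtain s where s: "0 < s" "s < t n" "F (x + t n *\<^sub>R i) - F (x + 0 *\<^sub>R i) = (t n - 0) * ?D (x + s *\<^sub>R i)"
      using MVT2[OF t(1)[of n], of "\<lambda>s. F (x + s *\<^sub>R i)" "\<lambda>s. ?D (x + s *\<^sub>R i)"] deriv by blast
    then have "q n x = ?D (x + s *\<^sub>R i)" using t[of n] by (simp add: q_def)
    moreover have "\<bar>?D (x + s *\<^sub>R i)\<bar> \<le> B"
    proof (cases "x + s *\<^sub>R i \<in> K")
      case True
      then show ?thesis using B KK'[of "x + s *\<^sub>R i" 0] by simp
    next
      case False
      then show ?thesis using D0 B[OF \<open>x \<in> K'\<close>] by simp
    qed
    ultimately show ?thesis using True by simp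
  qed
  have "(\<lambda>n. \<integral>x. q n x \<partial>lborel) \<longlonglongrightarrow> (\<integral>x. ?D x \<partial>lborel)"
  proof (rule integral_dominated_convergence[where w = "\<lambda>x. B * indicator K' x"])
    show "integrable lborel (\<lambda>x. B * indicator K' x)"
      using borel_integrable_compact[OF K', of "\<lambda>_. B"] by (simp add: mult.commute)
    show "AE x in lborel. (\<lambda>n. q n x) \<longlonglongrightarrow> ?D x"
    proof (rule AE_I2)
      fix x
      have "((\<lambda>h. (F (x + h *\<^sub>R i) - F x) / h) \<longlongrightarrow> ?D x) (at 0)"
        using deriv[of x 0] by (simp add: DERIV_def)
      moreover have "filterlim t (at 0) sequentially"
        unfolding filterlim_at using t0 by (simp add: t_def)
      ultimately show "(\<lambda>n. q n x) \<longlonglongrightarrow> ?D x"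
        unfolding q_def by (rule filterlim_compose)
    qed
    show "AE x in lborel. norm (q n x) \<le> B * indicator K' x" for n using bound by auto
  qed (auto simp: q_def)
  moreover have "(\<integral>x. q n x \<partial>lborel) = 0" for n
  proof -
    have "(\<integral>x. F x \<partial>lborel) = (\<integral>x. F x \<partial>distr lborel borel ((+) (t n *\<^sub>R i)))"
      by (simp add: lborel_distr_plus)
    also have "\<dots> = (\<integral>x. F (x + t n *\<^sub>R i) \<partial>lborel)"
      by (subst integral_distr) (auto simp: add.commute)
    finally have eq: "(\<integral>x. F (x + t n *\<^sub>R i) \<partial>lborel) = (\<integral>x. F x \<partial>lborel)" ..
    have "integrable (distr lborel borel ((+) (t n *\<^sub>R i))) F"
      using intF by (simp add: lborel_distr_plus)
    then have "integrable lborel (\<lambda>x. F (x + t n *\<^sub>R i))"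
      by (subst (asm) integrable_distr_eq) (auto simp: add.commute)
    then show ?thesis using intF eq by (simp add: q_def)
  qed
  ultimately show ?thesis by (simp add: LIMSEQ_const_iff)
qed

text \<open>A function that is continuously differentiable on the whole space has its classical gradient
  as weak gradient on every open set.\<close>

lemma classical_gradient:
  fixes v :: "'a::euclidean_space \<Rightarrow> real"
  assumes S: "open S" and v: "C_k (Suc 0) v"
    and G: "\<And>x i. i \<in> Basis \<Longrightarrow> G x \<bullet> i = partial_deriv i v x"
  shows "is_weak_gradient S v G" "L2_loc S G" "L2_loc S v" "v \<in> W12_loc S"
    "AE x in lborel. x \<in> S \<longrightarrow> weak_gradient S v x = G x"
proof -
  have contv: "continuous_on UNIV v" using v by (rule C_k_imp_continuous)
  have L2: "L2_loc S f" if "continuous_on UNIV f" for f :: "'a \<Rightarrow> 'b::euclidean_space"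
    unfolding L2_loc_def set_integrable_def
  proof (intro conjI allI impI)
    show "f \<in> borel_measurable borel" using that by (rule borel_measurable_continuous_onI)
    fix K assume "compact K \<and> K \<subseteq> S"
    then show "integrable lborel (\<lambda>x. indicator K x *\<^sub>R (norm (f x))\<^sup>2)"
      using continuous_on_subset[OF that subset_UNIV]
      by (intro borel_integrable_compact continuous_intros) auto
  qed
  have "continuous_on UNIV (\<lambda>x. \<Sum>i\<in>Basis. partial_deriv i v x *\<^sub>R i)"
    using v by (intro continuous_intros) auto
  moreover have "(\<lambda>x. \<Sum>i\<in>Basis. partial_deriv i v x *\<^sub>R i) = G"
    by (rule ext, rule euclidean_eqI) (simp add: G inner_sum_left inner_Basis if_distrib cong: if_cong)
  ultimately show L2G: "L2_loc S G" using L2 by metis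
  show L2v: "L2_loc S v" by (rule L2[OF contv])
  show wg: "is_weak_gradient S v G"
    unfolding is_weak_gradient_def
  proof (intro allI impI ballI)
    fix \<phi> and i :: 'a assume \<phi>: "test_function S \<phi>" and i: "i \<in> Basis"
    obtain K where K: "compact K" "K \<subseteq> S" "\<And>x. x \<notin> K \<Longrightarrow> \<phi> x = 0" using \<phi> by (auto simp: test_function_def)
    have \<phi>1: "C_k (Suc 0) \<phi>" using \<phi> unfolding test_function_def by blast
    have "(\<integral>x. partial_deriv i (\<lambda>x. v x * \<phi> x) x \<partial>lborel) = 0"
      by (rule integral_partial_deriv_eq_0[OF C_k_mult[OF v \<phi>1] K(1) _ i]) (simp add: K(3))
    moreover have "partial_deriv i (\<lambda>x. v x * \<phi> x) x = v x * partial_deriv i \<phi> x + (G x \<bullet> i) * \<phi> x" for x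
      using v \<phi>1 i by (subst partial_deriv_mult) (auto simp: G)
    moreover have "indicator S x *\<^sub>R (v x * partial_deriv i \<phi> x + (G x \<bullet> i) * \<phi> x) = (v x * partial_deriv i \<phi> x + (G x \<bullet> i) * \<phi> x)" for x
    proof (cases "x \<in> S")
      case False
      then show ?thesis using K(2,3) test_function_partial_deriv[OF \<phi> i] unfolding test_function_def by fastforce
    qed auto
    ultimately have "(LINT x:S|lborel. v x * partial_deriv i \<phi> x + (G x \<bullet> i) * \<phi> x) = 0"
      unfolding set_lebesgue_integral_def by (simp only:)
    moreover have "set_integrable lborel S (\<lambda>x. v x * partial_deriv i \<phi> x)"
      using L2v by (intro set_integrable_mult_test_function test_function_partial_deriv \<phi> i)
        (auto simp: L2_loc_def intro: L2_loc_set_integrable)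
    moreover have "set_integrable lborel S (\<lambda>x. (G x \<bullet> i) * \<phi> x)"
      using L2_loc_inner[OF L2G, of i] by (intro set_integrable_mult_test_function \<phi>)
        (auto simp: L2_loc_def intro: L2_loc_set_integrable)
    ultimately show "(LINT x:S|lborel. v x * partial_deriv i \<phi> x) = - (LINT x:S|lborel. (G x \<bullet> i) * \<phi> x)"
      by simp
  qed
  show W: "v \<in> W12_loc S" using wg L2G L2v by (auto simp: W12_loc_def)
  show "AE x in lborel. x \<in> S \<longrightarrow> weak_gradient S v x = G x"
    by (rule weak_gradient_AE_eq[OF S W L2G wg])
qed

section \<open>Weakly differentiable functions of one variable\<close>

text \<open>Integration by parts against the indefinite integral of an integrable function, by Fubini.\<close>

lemma integral_by_parts_indefinite:
  fixes G q q' :: "real \<Rightarrow> real"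
  assumes ab: "a \<le> b" and G: "set_integrable lborel {a..b} G"
    and q: "\<And>x. a \<le> x \<Longrightarrow> x \<le> b \<Longrightarrow> (q has_real_derivative q' x) (at x within {a..b})"
    and q': "continuous_on {a..b} q'"
  shows "(LINT x:{a..b}|lborel. (LINT t:{a..x}|lborel. G t) * q' x)
    = q b * (LINT t:{a..b}|lborel. G t) - (LINT t:{a..b}|lborel. G t * q t)"
proof -
  define A where "A x = indicator {a..b} x * q' x" for x
  define B where "B t = indicator {a..b} t * G t" for t
  have intA: "integrable lborel A"
    using borel_integrable_compact[OF compact_Icc q'] by (simp add: A_def[abs_def])
  have intB: "integrable lborel B" using G by (simp add: B_def[abs_def] set_integrable_def)
  have [measurable]: "A \<in> borel_measurable borel" "B \<in> borel_measurable borel"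
    using intA intB by auto
  have AB: "integrable (lborel \<Otimes>\<^sub>M lborel) (\<lambda>(x, t). A x * B t)"
  proof (rule lborel_pair.Fubini_integrable)
    show "integrable lborel (\<lambda>x. \<integral>y. norm (case (x, y) of (x, t) \<Rightarrow> A x * B t) \<partial>lborel)"
      using intA by (simp add: abs_mult)
    show "AE x in lborel. integrable lborel (\<lambda>y. case (x, y) of (x, t) \<Rightarrow> A x * B t)"
      using intB by simp
  qed measurable
  have meas_le: "{z::real\<times>real. snd z \<le> fst z} \<in> sets (borel \<Otimes>\<^sub>M borel)"
    unfolding borel_prod by (intro borel_closed closed_Collect_le continuous_intros)
  define f where "f x t = indicator {z. snd z \<le> fst z} (x, t) * (A x * B t)" for x t
  have "integrable (lborel \<Otimes>\<^sub>M lborel) (\<lambda>z. indicator {z::real\<times>real. snd z \<le> fst z} z *\<^sub>R (case z of (x, t) \<Rightarrow> A x * B t))"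
    by (intro integrable_mult_indicator AB)
       (use meas_le in auto)
  then have "integrable (lborel \<Otimes>\<^sub>M lborel) (\<lambda>(x, t). f x t)"
    by (simp add: f_def split_def)
  then have fub: "(\<integral>t. (\<integral>x. f x t \<partial>lborel) \<partial>lborel) = (\<integral>x. (\<integral>t. f x t \<partial>lborel) \<partial>lborel)"
    by (rule lborel_pair.Fubini_integral)
  have inner1: "(\<integral>t. f x t \<partial>lborel) = indicator {a..b} x *\<^sub>R ((LINT t:{a..x}|lborel. G t) * q' x)" for x
  proof (cases "x \<in> {a..b}")
    case True
    then have "f x t = q' x * (indicator {a..x} t *\<^sub>R G t)" for t
      by (auto simp: f_def A_def B_def indicator_def)
    then show ?thesis using True by (simp add: set_lebesgue_integral_def)
  qed (simp add: f_def A_def)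
  have inner2: "(\<integral>x. f x t \<partial>lborel) = B t * (q b - q t)" for t
  proof (cases "t \<in> {a..b}")
    case True
    then have "f x t = B t * (indicator {t..b} x *\<^sub>R q' x)" for x
      by (auto simp: f_def A_def indicator_def)
    moreover have "(\<integral>x. indicator {t..b} x *\<^sub>R q' x \<partial>lborel) = q b - q t"
    proof (rule integral_FTC_Icc)
      fix x assume "t \<le> x" "x \<le> b"
      then show "(q has_vector_derivative q' x) (at x within {t..b})"
        using q[of x] True unfolding has_real_derivative_iff_has_vector_derivative
        by (auto intro: has_vector_derivative_within_subset)
    qed (use True q' in \<open>auto intro: continuous_on_subset\<close>)
    ultimately show ?thesis by simp
  qed (simp add: f_def B_def)
  have "continuous_on {a..b} q"
    using q by (meson DERIV_continuous continuous_on_eq_continuous_within atLeastAtMost_iff)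
  then have "bounded (q ` {a..b})" by (intro compact_imp_bounded compact_continuous_image) auto
  then obtain C where C: "\<And>x. x \<in> {a..b} \<Longrightarrow> \<bar>q x\<bar> \<le> C" unfolding bounded_iff by force
  have intBq: "integrable lborel (\<lambda>t. B t * q t)"
  proof (rule Bochner_Integration.integrable_bound)
    show "integrable lborel (\<lambda>t. B t * C)" using intB by simp
    have "(\<lambda>t. indicator {a..b} t *\<^sub>R q t) \<in> borel_measurable borel"
      using \<open>continuous_on {a..b} q\<close> by (intro borel_measurable_continuous_on_indicator) auto
    then have "(\<lambda>t. B t * (indicator {a..b} t *\<^sub>R q t)) \<in> borel_measurable lborel" by simp
    moreover have "(\<lambda>t. B t * (indicator {a..b} t *\<^sub>R q t)) = (\<lambda>t. B t * q t)"
      by (auto simp: B_def indicator_def)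
    ultimately show "(\<lambda>t. B t * q t) \<in> borel_measurable lborel" by metis
    show "AE t in lborel. norm (B t * q t) \<le> norm (B t * C)"
    proof (rule AE_I2)
      fix t show "norm (B t * q t) \<le> norm (B t * C)"
        using C[of t] by (cases "t \<in> {a..b}") (auto simp: abs_mult B_def intro!: mult_left_mono)
    qed
  qed
  have "(\<integral>t. B t * (q b - q t) \<partial>lborel) = q b * (\<integral>t. B t \<partial>lborel) - (\<integral>t. B t * q t \<partial>lborel)"
    using intB intBq by (simp add: right_diff_distrib)
  then show ?thesis
    using fub unfolding inner1 inner2
    by (simp add: set_lebesgue_integral_def B_def mult.assoc)
qed

lemma test_function_support_interval:
  fixes \<psi> :: "real \<Rightarrow> real"
  assumes "test_function {a<..<b} \<psi>" "a < b"
  obtains c d where "a < c" "c < d" "d < b" "\<And>x. x \<notin> {c<..<d} \<Longrightarrow> \<psi> x = 0"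
proof -
  obtain K where K: "compact K" "K \<subseteq> {a<..<b}" "\<And>x. x \<notin> K \<Longrightarrow> \<psi> x = 0"
    using assms by (auto simp: test_function_def)
  show ?thesis
  proof (cases "K = {}")
    case True
    have "a < (2*a+b)/3" "(2*a+b)/3 < (a+2*b)/3" "(a+2*b)/3 < b" using \<open>a < b\<close> by auto
    then show ?thesis using that K(3) True by blast
  next
    case False
    obtain c where c: "c \<in> K" "\<And>x. x \<in> K \<Longrightarrow> c \<le> x" using compact_attains_inf[OF K(1) False] by auto
    obtain d where d: "d \<in> K" "\<And>x. x \<in> K \<Longrightarrow> x \<le> d" using compact_attains_sup[OF K(1) False] by auto
    have "c \<in> {a<..<b}" "d \<in> {a<..<b}" using c(1) d(1) K(2) by blast+
    then have "a < c" "d < b" "c \<le> d" using c(2)[OF d(1)] by simp_all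
    then have "a < (a+c)/2" "(a+c)/2 < (d+b)/2" "(d+b)/2 < b" "(a+c)/2 < c" "d < (d+b)/2" by auto
    moreover have "\<psi> x = 0" if "x \<notin> {(a+c)/2<..<(d+b)/2}" for x
    proof -
      have "x < c \<or> d < x" using that \<open>(a+c)/2 < c\<close> \<open>d < (d+b)/2\<close> by auto
      then show ?thesis using K(3)[of x] c(2)[of x] d(2)[of x] by linarith
    qed
    ultimately show ?thesis using that by blast
  qed
qed

text \<open>A smooth function with compact support in an interval and integral zero is the derivative
  of a function of the same kind.\<close>

lemma test_function_antiderivative:
  fixes \<psi> :: "real \<Rightarrow> real"
  assumes \<psi>: "test_function {a<..<b} \<psi>" and ab: "a < b" and int0: "(\<integral>x. \<psi> x \<partial>lborel) = 0"
  obtains \<phi> where "test_function {a<..<b} \<phi>" "\<And>x. (\<phi> has_real_derivative \<psi> x) (at x)"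
proof -
  obtain c d where cd: "a < c" "c < d" "d < b" and out: "\<And>x. x \<notin> {c<..<d} \<Longrightarrow> \<psi> x = 0"
    using test_function_support_interval[OF \<psi> ab] by metis
  have cont: "continuous_on UNIV \<psi>" using \<psi> by (rule test_function_continuous)
  obtain \<Phi> where \<Phi>: "\<And>x. (\<Phi> has_vector_derivative \<psi> x) (at x)"
    using einterval_antiderivative[of "-\<infinity>" "\<infinity>" \<psi>] cont
    by (auto simp: continuous_on_eq_continuous_at)
  define \<phi> where "\<phi> x = \<Phi> x - \<Phi> c" for x
  have D: "(\<phi> has_real_derivative \<psi> x) (at x)" for x
    using \<Phi>[of x] unfolding \<phi>_def has_real_derivative_iff_has_vector_derivative[symmetric]
    by (auto intro!: derivative_eq_intros)
  have left: "\<phi> x = 0" if "x \<le> c" for x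
  proof (cases "x = c")
    case False
    then have "x < c" using that by simp
    then obtain z where "x < z" "z < c" "\<phi> c - \<phi> x = (c - x) * \<psi> z"
      using MVT2[of x c \<phi> \<psi>] D by blast
    moreover have "\<psi> z = 0" using out[of z] \<open>z < c\<close> by simp
    ultimately show ?thesis by (simp add: \<phi>_def)
  qed (simp add: \<phi>_def)
  have "(\<integral>x. indicator {c..d} x *\<^sub>R \<psi> x \<partial>lborel) = \<phi> d - \<phi> c"
    using D cd cont by (intro integral_FTC_Icc)
      (auto simp: has_real_derivative_iff_has_vector_derivative intro: has_vector_derivative_at_within continuous_on_subset)
  moreover have "(\<lambda>x. indicator {c..d} x *\<^sub>R \<psi> x) = \<psi>"
  proof
    show "indicator {c..d} x *\<^sub>R \<psi> x = \<psi> x" for x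
      using out[of x] by (cases "x \<in> {c<..<d}") auto
  qed
  ultimately have "(\<integral>x. \<psi> x \<partial>lborel) = \<phi> d - \<phi> c" by metis
  then have \<phi>d: "\<phi> d = 0" using int0 left[of c] by simp
  have right: "\<phi> x = 0" if "x \<ge> d" for x
  proof (cases "x = d")
    case False
    then have "d < x" using that by simp
    then obtain z where "d < z" "z < x" "\<phi> x - \<phi> d = (x - d) * \<psi> z"
      using MVT2[of d x \<phi> \<psi>] D by blast
    moreover have "\<psi> z = 0" using out[of z] \<open>d < z\<close> by simp
    ultimately show ?thesis using \<phi>d by simp
  qed (use \<phi>d in simp)
  have pd: "partial_deriv 1 \<phi> = \<psi>" using partial_deriv_real(1)[OF D] by auto
  have Suc: "C_k (Suc n) \<phi>" for n
    using \<psi> partial_deriv_real(2)[OF D] by (auto simp: pd test_function_def)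
  have "test_function {a<..<b} \<phi>"
    unfolding test_function_def
  proof (intro conjI allI exI[of _ "{c..d}"] impI)
    show "C_k n \<phi>" for n using Suc[of n] by (rule C_k_Suc_imp)
    show "\<phi> x = 0" if "x \<notin> {c..d}" for x using left right that by force
  qed (use cd in auto)
  then show ?thesis using that D by blast
qed

text \<open>The lemma of du Bois-Reymond. The difference \<open>v - W\<close>, with \<open>W\<close> an indefinite integral of \<open>G\<close>, is
  orthogonal to all derivatives of test functions, that is, to all test functions with integral
  zero, and therefore constant.\<close>

lemma weak_gradient_real_indefinite_integral:
  fixes v G :: "real \<Rightarrow> real"
  assumes ab: "a < b" and v: "L2_loc {a<..<b} v" and G: "L2_loc {a<..<b} G"
    and wg: "is_weak_gradient {a<..<b} v G"
  obtains V where "continuous_on {a<..<b} V"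
    and "AE x in lborel. x \<in> {a<..<b} \<longrightarrow> v x = V x"
    and "\<And>x y. a < x \<Longrightarrow> x \<le> y \<Longrightarrow> y < b \<Longrightarrow> V y - V x = (LINT t:{x..y}|lborel. G t)"
proof -
  let ?S = "{a<..<b}"
  define m where "m = (a + b) / 2"
  have m: "a < m" "m < b" using ab by (auto simp: m_def)
  have intG: "set_integrable lborel {x..y} G" if "a < x" "y < b" for x y
    using that by (intro L2_loc_set_integrable[OF G]) auto
  define W :: "real \<Rightarrow> real" where "W x = (LBINT t=m..x. G t)" for x
  have W: "W y - W x = (LINT t:{x..y}|lborel. G t)" if "a < x" "x \<le> y" "y < b" for x y
  proof -
    have "set_integrable lborel {min m x<..<max m y} G"
      using m that by (intro set_integrable_subset[OF intG[of "min m x" "max m y"]]) auto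
    then have "(LBINT t=m..x. G t) + (LBINT t=x..y. G t) = (LBINT t=m..y. G t)"
      using that by (intro interval_integral_sum)
        (auto simp: interval_lebesgue_integrable_def einterval_iff min_def max_def)
    then show ?thesis using that by (simp add: W_def interval_integral_Icc)
  qed
  have contW: "continuous_on ?S W"
    unfolding continuous_on_eq_continuous_at[OF open_greaterThanLessThan]
  proof
    fix x assume "x \<in> ?S"
    then obtain c d where cd: "a < c" "c < x" "x < d" "d < b"
      using dense[of a x] dense[of x b] by auto
    have "G integrable_on {c..d}"
      using set_borel_integral_eq_integral(1)[OF intG[of c d]] cd by auto
    then have "continuous_on {c..d} (\<lambda>y. W c + integral {c..y} G)"
      by (intro continuous_intros indefinite_integral_continuous_1)
    moreover have "W c + integral {c..y} G = W y" if "y \<in> {c..d}" for y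
      using W[of c y] set_borel_integral_eq_integral(2)[OF intG[of c y]] cd that by auto
    ultimately have "continuous_on {c..d} W" by (metis (no_types, lifting) continuous_on_cong)
    then show "isCont W x"
      using cd by (intro continuous_on_interior[of "{c..d}"]) auto
  qed
  have intW: "set_integrable lborel K W" if "compact K" "K \<subseteq> ?S" for K
    using borel_integrable_compact[OF that(1) continuous_on_subset[OF contW that(2)]]
    by (simp add: set_integrable_def)
  have intv: "set_integrable lborel K v" if "compact K" "K \<subseteq> ?S" for K
    using L2_loc_set_integrable[OF v that] .
  have int_diff: "set_integrable lborel K (\<lambda>x. v x - W x)" if "compact K" "K \<subseteq> ?S" for K
    using intv[OF that] intW[OF that] by (rule set_integral_diff)
  have orth: "(LINT x:?S|lborel. (v x - W x) * \<phi>' x) = 0"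
    if \<phi>: "test_function ?S \<phi>" and \<phi>': "\<And>x. (\<phi> has_real_derivative \<phi>' x) (at x)" for \<phi> \<phi>'
  proof -
    obtain c d where cd: "a < c" "c < d" "d < b" and out: "\<And>x. x \<notin> {c<..<d} \<Longrightarrow> \<phi> x = 0"
      using test_function_support_interval[OF \<phi> ab] by metis
    have pd: "partial_deriv 1 \<phi> = \<phi>'" using partial_deriv_real(1)[OF \<phi>'] by auto
    have \<phi>'t: "test_function ?S \<phi>'" using test_function_partial_deriv[OF \<phi>, of 1] by (simp add: pd)
    have cont: "continuous_on UNIV \<phi>'" using \<phi>'t by (rule test_function_continuous)
    have "\<phi>' x = 0" if "x \<notin> {c..d}" for x
    proof -
      have "((\<lambda>_. 0) has_real_derivative 0) (at x)" by simp
      then have "(\<phi> has_real_derivative 0) (at x)"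
        by (rule has_field_derivative_transform_within_open[where S = "- {c..d}"])
           (use that out in \<open>auto simp: open_Compl\<close>)
      then show ?thesis using \<phi>'[of x] DERIV_unique by blast
    qed
    then have S_cd: "(LINT x:?S|lborel. f x * \<phi>' x) = (LINT x:{c..d}|lborel. f x * \<phi>' x)" for f
      unfolding set_lebesgue_integral_def using cd
      by (intro Bochner_Integration.integral_cong) (auto simp: indicator_def)
    have S_cd': "(LINT x:?S|lborel. f x * \<phi> x) = (LINT x:{c..d}|lborel. f x * \<phi> x)" for f
      unfolding set_lebesgue_integral_def using cd out
      by (intro Bochner_Integration.integral_cong) (auto simp: indicator_def)
    have sub: "compact {c..d}" "{c..d} \<subseteq> ?S" using cd by auto
    have int1: "set_integrable lborel {c..d} (\<lambda>x. (LINT t:{c..x}|lborel. G t) * \<phi>' x)"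
    proof -
      have "continuous_on {c..d} (\<lambda>x. (W x - W c) * \<phi>' x)"
        using cont contW sub(2) by (intro continuous_intros) (auto intro: continuous_on_subset)
      then have "set_integrable lborel {c..d} (\<lambda>x. (W x - W c) * \<phi>' x)"
        unfolding set_integrable_def by (intro borel_integrable_compact) auto
      then show ?thesis
        by (rule set_integrable_cong[THEN iffD1, rotated 3]) (use W[of c] cd in auto)
    qed
    have int2: "set_integrable lborel {c..d} (\<lambda>x. W c * \<phi>' x)"
      unfolding set_integrable_def using cont
      by (intro borel_integrable_compact continuous_intros) (auto intro: continuous_on_subset)
    have Wc: "(LINT t:{c..x}|lborel. G t) = W x - W c" if "x \<in> {c..d}" for x
      using W[of c x] cd that by simp
    have FTC: "(LINT x:{c..d}|lborel. \<phi>' x) = \<phi> d - \<phi> c"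
      unfolding set_lebesgue_integral_def using \<phi>' cd cont
      by (intro integral_FTC_Icc)
        (auto simp: has_real_derivative_iff_has_vector_derivative intro: has_vector_derivative_at_within continuous_on_subset)
    have "(LINT x:{c..d}|lborel. W x * \<phi>' x)
        = (LINT x:{c..d}|lborel. W c * \<phi>' x + (LINT t:{c..x}|lborel. G t) * \<phi>' x)"
      by (rule set_lebesgue_integral_cong) (simp_all add: Wc algebra_simps)
    also have "\<dots> = W c * (\<phi> d - \<phi> c) + (LINT x:{c..d}|lborel. (LINT t:{c..x}|lborel. G t) * \<phi>' x)"
      using int1 int2 by (simp add: FTC)
    also have "(LINT x:{c..d}|lborel. (LINT t:{c..x}|lborel. G t) * \<phi>' x)
        = \<phi> d * (LINT t:{c..d}|lborel. G t) - (LINT t:{c..d}|lborel. G t * \<phi> t)"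
      using cd \<phi>' cont intG[of c d]
      by (intro integral_by_parts_indefinite) (auto intro: has_field_derivative_at_within continuous_on_subset)
    finally have "(LINT x:{c..d}|lborel. W x * \<phi>' x) = - (LINT t:{c..d}|lborel. G t * \<phi> t)"
      using out[of c] out[of d] by simp
    moreover have "(LINT x:?S|lborel. v x * \<phi>' x) = - (LINT x:?S|lborel. G x * \<phi> x)"
      using wg \<phi> unfolding is_weak_gradient_def by (auto simp: partial_deriv_real(1)[OF \<phi>'])
    ultimately have "(LINT x:?S|lborel. v x * \<phi>' x) = (LINT x:?S|lborel. W x * \<phi>' x)"
      by (simp add: S_cd S_cd')
    moreover have "set_integrable lborel {c..d} (\<lambda>x. W x * \<phi>' x)"
      unfolding set_integrable_def using cont contW sub(2)
      by (intro borel_integrable_compact continuous_intros) (auto intro: continuous_on_subset)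
    moreover have "set_integrable lborel {c..d} (\<lambda>x. v x * \<phi>' x)"
    proof -
      have "set_integrable lborel ?S (\<lambda>x. v x * \<phi>' x)"
        using v intv by (intro set_integrable_mult_test_function \<phi>'t) (auto simp: L2_loc_def)
      then show ?thesis by (rule set_integrable_subset) (use sub in auto)
    qed
    ultimately show ?thesis
      using S_cd[of v] S_cd[of W]
      unfolding S_cd[of "\<lambda>x. v x - W x"] by (simp add: left_diff_distrib)
  qed
  \<comment> \<open>a fixed test function with nonzero integral, used to correct the integral of the others to zero\<close>
  define \<eta> where "\<eta> = (box_bump 1 ((2*a+b)/3) ((a+2*b)/3) :: real \<Rightarrow> real)"
  have \<eta>: "test_function ?S \<eta>" unfolding \<eta>_def using ab by (intro test_function_box_bump) auto
  have int_test: "integrable lborel \<psi>" if \<psi>: "test_function ?S \<psi>" for \<psi>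
  proof -
    have "set_integrable lborel ?S (\<lambda>x. 1 * \<psi> x)"
      by (intro set_integrable_mult_test_function \<psi>)
        (auto simp: set_integrable_def borel_integrable_compact[where f = "\<lambda>_. 1::real", simplified])
    moreover have "(\<lambda>x. indicator ?S x *\<^sub>R (1 * \<psi> x)) = \<psi>"
      using \<psi> by (force simp: test_function_def indicator_def fun_eq_iff)
    ultimately show ?thesis unfolding set_integrable_def by metis
  qed
  define I where "I = (\<integral>x. \<eta> x \<partial>lborel)"
  have "I \<noteq> 0"
  proof
    assume "I = 0"
    have "0 \<le> \<eta> x" for x using box_bump_bounds(1) by (simp add: \<eta>_def)
    then have "AE x in lborel. \<eta> x = 0"
      using integral_nonneg_eq_0_iff_AE[OF int_test[OF \<eta>]] \<open>I = 0\<close> by (simp add: I_def)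
    then have "AE x in lborel. x \<notin> {(2*a+b)/3<..<(a+2*b)/3}"
      by eventually_elim (auto simp: \<eta>_def box_bump_def flat_exp_def)
    then have "{(2*a+b)/3<..<(a+2*b)/3} \<in> null_sets lborel"
      by (subst AE_iff_null_sets) auto
    then show False using ab by (simp add: null_sets_def)
  qed
  define C where "C = (LINT x:?S|lborel. (v x - W x) * \<eta> x) / I"
  have "AE x in lborel. x \<in> ?S \<longrightarrow> v x - W x - C = 0"
  proof (rule AE_eq_0_if_test_integrals_eq_0)
    show "set_integrable lborel K (\<lambda>x. v x - W x - C)" if "compact K" "K \<subseteq> ?S" for K
    proof (rule set_integral_diff(1)[OF int_diff[OF that]])
      show "set_integrable lborel K (\<lambda>_. C)"
        unfolding set_integrable_def using that by (intro borel_integrable_compact) auto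
    qed
    fix \<psi> assume \<psi>: "test_function ?S \<psi>"
    define J where "J = (\<integral>x. \<psi> x \<partial>lborel)"
    define \<psi>0 where "\<psi>0 x = \<psi> x + (- J / I) * \<eta> x" for x
    have \<psi>0: "test_function ?S \<psi>0"
      unfolding test_function_def
    proof (intro conjI allI)
      show "C_k n \<psi>0" for n
        unfolding \<psi>0_def using \<psi> \<eta> by (intro C_k_add C_k_mult C_k_const) (auto simp: test_function_def)
      obtain K L where "compact K" "K \<subseteq> ?S" "\<forall>x. x \<notin> K \<longrightarrow> \<psi> x = 0" "compact L" "L \<subseteq> ?S" "\<forall>x. x \<notin> L \<longrightarrow> \<eta> x = 0"
        using \<psi> \<eta> by (auto simp: test_function_def)
      then show "\<exists>K. compact K \<and> K \<subseteq> ?S \<and> (\<forall>x. x \<notin> K \<longrightarrow> \<psi>0 x = 0)"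
        by (intro exI[of _ "K \<union> L"]) (auto simp: \<psi>0_def)
    qed
    have "(\<integral>x. \<psi>0 x \<partial>lborel) = 0"
      using int_test[OF \<psi>] int_test[OF \<eta>] \<open>I \<noteq> 0\<close> by (simp add: \<psi>0_def J_def[symmetric] I_def[symmetric])
    then obtain \<phi> where "test_function ?S \<phi>" "\<And>x. (\<phi> has_real_derivative \<psi>0 x) (at x)"
      using test_function_antiderivative[OF \<psi>0 ab] by metis
    then have "(LINT x:?S|lborel. (v x - W x) * \<psi>0 x) = 0" by (rule orth)
    moreover have int: "set_integrable lborel ?S (\<lambda>x. (v x - W x) * \<psi> x)" if \<psi>: "test_function ?S \<psi>" for \<psi>
    proof -
      have "set_integrable lborel ?S (\<lambda>x. v x * \<psi> x)"
        using v intv by (intro set_integrable_mult_test_function \<psi>) (auto simp: L2_loc_def)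
      moreover have "set_integrable lborel ?S (\<lambda>x. (indicator ?S x * W x) * \<psi> x)"
      proof (rule set_integrable_mult_test_function[OF _ _ \<psi>])
        show "(\<lambda>x. indicator ?S x * W x) \<in> borel_measurable borel"
          using borel_measurable_continuous_on_indicator[OF _ contW] by simp
        fix K :: "real set" assume K: "compact K" "K \<subseteq> ?S"
        show "set_integrable lborel K (\<lambda>x. indicator ?S x * W x)"
          by (rule set_integrable_cong[THEN iffD1, OF _ _ _ intW[OF K]]) (use K in \<open>auto simp: indicator_def\<close>)
      qed
      ultimately have "set_integrable lborel ?S (\<lambda>x. v x * \<psi> x - (indicator ?S x * W x) * \<psi> x)"
        by (rule set_integral_diff)
      then show ?thesis
        by (rule set_integrable_cong[THEN iffD1, rotated 3]) (auto simp: algebra_simps)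
    qed
    moreover have "(LINT x:?S|lborel. (v x - W x) * \<psi>0 x)
        = (LINT x:?S|lborel. (v x - W x) * \<psi> x + (- J / I) * ((v x - W x) * \<eta> x))"
      by (rule set_lebesgue_integral_cong) (auto simp: \<psi>0_def algebra_simps diff_divide_distrib)
    moreover have "\<dots> = (LINT x:?S|lborel. (v x - W x) * \<psi> x) + (- J / I) * (LINT x:?S|lborel. (v x - W x) * \<eta> x)"
      using int[OF \<psi>] set_integrable_mult_right[OF int[OF \<eta>], of "- J / I"]
      by (subst set_integral_add(2)) (simp_all only: set_integral_mult_right)
    ultimately have "(LINT x:?S|lborel. (v x - W x) * \<psi> x) = C * J"
      using \<open>I \<noteq> 0\<close> by (simp add: C_def field_simps)
    moreover have "J = (LINT x:?S|lborel. \<psi> x)"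
      unfolding J_def set_lebesgue_integral_def using \<psi>
      by (intro Bochner_Integration.integral_cong) (force simp: test_function_def indicator_def)+
    moreover have "set_integrable lborel ?S \<psi>"
      using int_test[OF \<psi>] unfolding set_integrable_def by (intro integrable_mult_indicator) auto
    ultimately show "(LINT x:?S|lborel. (v x - W x - C) * \<psi> x) = 0"
      using int[OF \<psi>] by (simp add: left_diff_distrib[of _ C])
  qed simp
  then have "AE x in lborel. x \<in> ?S \<longrightarrow> v x = W x + C" by eventually_elim auto
  moreover have "continuous_on ?S (\<lambda>x. W x + C)" using contW by (intro continuous_intros)
  ultimately show ?thesis using that[of "\<lambda>x. W x + C"] W by simp
qed

section \<open>Multiplicities and the enumeration of eigenvalues\<close>

lemma underdetermined_system:
  fixes A :: "'i \<Rightarrow> nat \<Rightarrow> real"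
  assumes "finite I" "m < card I"
  shows "\<exists>c. (\<exists>i\<in>I. c i \<noteq> 0) \<and> (\<forall>j<m. (\<Sum>i\<in>I. c i * A i j) = 0)"
  using assms
proof (induction m arbitrary: I A)
  case 0
  then have "I \<noteq> {}" by auto
  then show ?case by (intro exI[of _ "\<lambda>_. 1"]) auto
next
  case (Suc m)
  show ?case
  proof (cases "\<forall>i\<in>I. A i m = 0")
    case True
    obtain c where "\<exists>i\<in>I. c i \<noteq> 0" "\<forall>j<m. (\<Sum>i\<in>I. c i * A i j) = 0"
      using Suc.IH[of I A] Suc.prems by auto
    then show ?thesis using True by (intro exI[of _ c]) (auto simp: less_Suc_eq)
  next
    case False
    then obtain p where p: "p \<in> I" "A p m \<noteq> 0" by auto
    define I' where "I' = I - {p}"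
    have I': "finite I'" "m < card I'" "p \<notin> I'" "I = insert p I'"
      using Suc.prems p by (auto simp: I'_def)
    define r where "r i = A i m / A p m" for i
    obtain c where c: "\<exists>i\<in>I'. c i \<noteq> 0" "\<forall>j<m. (\<Sum>i\<in>I'. c i * (A i j - r i * A p j)) = 0"
      using Suc.IH[of I' "\<lambda>i j. A i j - r i * A p j"] I' by auto
    define c' where "c' i = (if i = p then - (\<Sum>i\<in>I'. c i * r i) else c i)" for i
    have sum: "(\<Sum>i\<in>I. c' i * A i j) = (\<Sum>i\<in>I'. c i * (A i j - r i * A p j))" for j
    proof -
      have "(\<Sum>i\<in>I. c' i * A i j) = c' p * A p j + (\<Sum>i\<in>I'. c' i * A i j)"
        using I' by simp
      also have "(\<Sum>i\<in>I'. c' i * A i j) = (\<Sum>i\<in>I'. c i * A i j)"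
        using I'(3) by (intro sum.cong) (auto simp: c'_def)
      finally show ?thesis
        by (simp add: c'_def right_diff_distrib sum_subtractf sum_distrib_right mult.assoc)
    qed
    have "(\<Sum>i\<in>I. c' i * A i j) = 0" if "j < Suc m" for j
    proof (cases "j = m")
      case True
      then show ?thesis unfolding sum using p by (simp add: r_def)
    next
      case False
      then show ?thesis unfolding sum using c(2) that by simp
    qed
    moreover have "\<exists>i\<in>I. c' i \<noteq> 0" using c(1) I' by (auto simp: c'_def)
    ultimately show ?thesis by blast
  qed
qed

lemma has_dim_AE_le:
  assumes "has_dim_AE M V n" "has_dim_AE M V m"
  shows "n \<le> m"
proof (rule ccontr)
  assume "\<not> n \<le> m"
  obtain b where b: "\<And>i. i < n \<Longrightarrow> b i \<in> V"
    "\<And>c. (AE x in M. (\<Sum>i<n. c i * b i x) = 0) \<Longrightarrow> \<forall>i<n. c i = 0"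
    using assms(1) unfolding has_dim_AE_def by blast
  obtain b' where b': "\<And>u. u \<in> V \<Longrightarrow> \<exists>c. AE x in M. u x = (\<Sum>j<m. c j * b' j x)"
    using assms(2) unfolding has_dim_AE_def by blast
  have "\<forall>i. \<exists>c. i < n \<longrightarrow> (AE x in M. b i x = (\<Sum>j<m. c j * b' j x))"
    using b(1) b' by blast
  then obtain A where A: "\<And>i. i < n \<Longrightarrow> AE x in M. b i x = (\<Sum>j<m. A i j * b' j x)"
    by metis
  obtain c where c: "\<exists>i\<in>{..<n}. c i \<noteq> 0" "\<forall>j<m. (\<Sum>i<n. c i * A i j) = 0"
    using underdetermined_system[of "{..<n}" m A] \<open>\<not> n \<le> m\<close> by auto
  have "AE x in M. \<forall>i\<in>{..<n}. b i x = (\<Sum>j<m. A i j * b' j x)"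
    using A by (intro AE_finite_allI) auto
  then have "AE x in M. (\<Sum>i<n. c i * b i x) = 0"
  proof eventually_elim
    case (elim x)
    have "(\<Sum>i<n. c i * b i x) = (\<Sum>i<n. \<Sum>j<m. c i * A i j * b' j x)"
      using elim by (intro sum.cong) (auto simp: sum_distrib_left mult.assoc)
    also have "\<dots> = (\<Sum>j<m. (\<Sum>i<n. c i * A i j) * b' j x)"
      by (subst sum.swap) (simp add: sum_distrib_right)
    also have "\<dots> = 0" using c(2) by simp
    finally show ?case .
  qed
  then show False using b(2) c(1) by blast
qed

text \<open>No lower bound and no divergence to infinity is needed here: if \<open>s n < s' n\<close>, the at least \<open>n + 1\<close>
  indices in the fibres over \<open>s ` {..n}\<close> would have to be matched by indices of \<open>s'\<close> below \<open>n\<close>.\<close>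

lemma mono_eq_of_card_fibres:
  fixes s s' :: "nat \<Rightarrow> real"
  assumes s: "mono s" "mono s'" and fin: "\<And>\<mu>. finite {k. s k = \<mu>}" "\<And>\<mu>. finite {k. s' k = \<mu>}"
    and card: "\<And>\<mu>. card {k. s k = \<mu>} = card {k. s' k = \<mu>}"
  shows "s = s'"
proof -
  have not_less: "\<not> s n < s' n" if s: "mono s" "mono s'" and fin: "\<And>\<mu>. finite {k. s k = \<mu>}" "\<And>\<mu>. finite {k. s' k = \<mu>}"
    and card: "\<And>\<mu>. card {k. s k = \<mu>} = card {k. s' k = \<mu>}" for s s' :: "nat \<Rightarrow> real" and n
  proof
    assume less: "s n < s' n"
    define Y where "Y = s ` {..n}"
    have Y: "finite Y" by (simp add: Y_def)
    have card_pre: "card {k. t k \<in> Y} = (\<Sum>\<mu>\<in>Y. card {k. t k = \<mu>})" if "\<And>\<mu>. finite {k. t k = \<mu>}" for t :: "nat \<Rightarrow> real"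
    proof -
      have "{k. t k \<in> Y} = (\<Union>\<mu>\<in>Y. {k. t k = \<mu>})" by auto
      then show ?thesis using that Y by simp (subst card_UN_disjoint, auto)
    qed
    have finY: "finite {k. s k \<in> Y}"
    proof -
      have "{k. s k \<in> Y} = (\<Union>\<mu>\<in>Y. {k. s k = \<mu>})" by auto
      then show ?thesis using fin(1) Y by simp
    qed
    have "{..n} \<subseteq> {k. s k \<in> Y}" by (auto simp: Y_def)
    then have "card {..n} \<le> card {k. s k \<in> Y}" by (rule card_mono[OF finY])
    then have "Suc n \<le> card {k. s k \<in> Y}" by simp
    also have "\<dots> = card {k. s' k \<in> Y}" by (simp add: card_pre fin card)
    also have "\<dots> \<le> card {..<n}"
    proof (rule card_mono)
      show "{k. s' k \<in> Y} \<subseteq> {..<n}"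
      proof safe
        fix k assume "s' k \<in> Y"
        then have "s' k \<le> s n" using monoD[OF s(1)] by (auto simp: Y_def)
        then have "\<not> n \<le> k" using less monoD[OF s(2), of n k] by auto
        then show "k < n" by simp
      qed
    qed simp
    finally show False by simp
  qed
  have "\<not> s n < s' n" for n by (rule not_less[OF s fin card])
  moreover have "\<not> s' n < s n" for n by (rule not_less[OF s(2,1) fin(2,1) card[symmetric]])
  ultimately show ?thesis by (intro ext) (metis linorder_neqE_linordered_idom)
qed

lemma enumerates_eigenvalues_unique:
  assumes "enumerates_eigenvalues S w s" "enumerates_eigenvalues S w s'"
  shows "s = s'"
proof (rule mono_eq_of_card_fibres)
  have dim: "has_dim_AE (weighted_measure S w) (eigenspace S w \<mu>) (card {k. t k = \<mu>})"
    if "enumerates_eigenvalues S w t" for t \<mu>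
    using that unfolding enumerates_eigenvalues_def by blast
  show "card {k. s k = \<mu>} = card {k. s' k = \<mu>}" for \<mu>
    by (rule order.antisym) (rule has_dim_AE_le; rule dim; rule assms)+
  show "mono s" "mono s'" "finite {k. s k = \<mu>}" "finite {k. s' k = \<mu>}" for \<mu>
    using assms unfolding enumerates_eigenvalues_def by blast+
qed

text \<open>The eigenvalues are known as soon as the eigenspaces have the dimensions prescribed by a family
  \<open>\<nu>\<close> on an index set \<open>I\<close>, and \<open>\<beta>\<close> enumerates \<open>I\<close> in such a way that \<open>\<nu>\<close> increases.\<close>

lemma weighted_neumann_eigenvalue_eqI:
  assumes \<beta>: "bij_betw \<beta> UNIV I" and mono: "mono (\<lambda>k. \<nu> (\<beta> k))"
    and fin: "\<And>\<mu>. finite {i \<in> I. \<nu> i = \<mu>}"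
    and dim: "\<And>\<mu>. has_dim_AE (weighted_measure S w) (eigenspace S w \<mu>) (card {i \<in> I. \<nu> i = \<mu>})"
  shows "weighted_neumann_eigenvalue S w k = \<nu> (\<beta> k)"
proof -
  have "bij_betw \<beta> {k. \<nu> (\<beta> k) = \<mu>} {i \<in> I. \<nu> i = \<mu>}" for \<mu>
    unfolding bij_betw_def
  proof
    show "inj_on \<beta> {k. \<nu> (\<beta> k) = \<mu>}"
      using bij_betw_imp_inj_on[OF \<beta>] by (rule inj_on_subset) simp
    show "\<beta> ` {k. \<nu> (\<beta> k) = \<mu>} = {i \<in> I. \<nu> i = \<mu>}"
      unfolding bij_betw_imp_surj_on[OF \<beta>, symmetric] by auto
  qed
  then have "card {k. \<nu> (\<beta> k) = \<mu>} = card {i \<in> I. \<nu> i = \<mu>}" "finite {k. \<nu> (\<beta> k) = \<mu>}" for \<mu>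
    using bij_betw_same_card bij_betw_finite fin by blast+
  then have "enumerates_eigenvalues S w (\<lambda>k. \<nu> (\<beta> k))"
    using mono dim by (simp add: enumerates_eigenvalues_def)
  then have "weighted_neumann_eigenvalue S w = (\<lambda>k. \<nu> (\<beta> k))"
    unfolding weighted_neumann_eigenvalue_def
    using enumerates_eigenvalues_unique by (intro the_equality) blast+
  then show ?thesis by simp
qed

text \<open>The enumeration picks, again and again, an index with the least value among those not yet used.\<close>

lemma ex_increasing_enumeration:
  fixes \<nu> :: "'i \<Rightarrow> real"
  assumes inf: "infinite I" and fin: "\<And>c. finite {i \<in> I. \<nu> i \<le> c}"
  obtains \<beta> where "bij_betw \<beta> (UNIV :: nat set) I" "mono (\<lambda>k. \<nu> (\<beta> k))"
proof -
  define pick where "pick X = (SOME i. i \<in> I - X \<and> (\<forall>j\<in>I - X. \<nu> i \<le> \<nu> j))" for X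
  have pick: "pick X \<in> I - X" "\<And>j. j \<in> I - X \<Longrightarrow> \<nu> (pick X) \<le> \<nu> j" if "finite X" for X
  proof -
    have "infinite (I - X)" using that inf by (rule Diff_infinite_finite)
    then have "I - X \<noteq> {}" by (rule infinite_imp_nonempty)
    then obtain j where j: "j \<in> I - X" by blast
    define Y where "Y = {i \<in> I. \<nu> i \<le> \<nu> j} - X"
    have Y: "finite Y" "j \<in> Y" using fin j by (auto simp: Y_def)
    obtain i where i: "i \<in> Y" "\<forall>k\<in>Y. \<nu> i \<le> \<nu> k"
    proof -
      have "Min (\<nu> ` Y) \<in> \<nu> ` Y" using Y by (intro Min_in) auto
      then obtain i where "i \<in> Y" "\<nu> i = Min (\<nu> ` Y)" by auto
      then show ?thesis using that Y(1) by simp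
    qed
    have ij: "\<nu> i \<le> \<nu> j" using i(1) by (simp add: Y_def)
    have "\<nu> i \<le> \<nu> k" if "k \<in> I - X" for k
    proof (cases "\<nu> k \<le> \<nu> j")
      case True
      then have "k \<in> Y" using that by (simp add: Y_def)
      then show ?thesis using i(2) by blast
    qed (use ij in linarith)
    then have "\<exists>i. i \<in> I - X \<and> (\<forall>j\<in>I - X. \<nu> i \<le> \<nu> j)" using i(1) by (auto simp: Y_def)
    from someI_ex[OF this] show "pick X \<in> I - X" "\<And>j. j \<in> I - X \<Longrightarrow> \<nu> (pick X) \<le> \<nu> j"
      unfolding pick_def by auto
  qed
  define X where "X n = ((\<lambda>X. insert (pick X) X) ^^ n) {}" for n
  define \<beta> where "\<beta> n = pick (X n)" for n
  have XSuc: "X (Suc n) = insert (\<beta> n) (X n)" for n by (simp add: X_def \<beta>_def)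
  have X: "X n = \<beta> ` {..<n}" for n
  proof (induction n)
    case 0
    then show ?case by (simp add: X_def)
  next
    case (Suc n)
    then show ?case by (simp add: XSuc lessThan_Suc)
  qed
  have finX: "finite (X n)" for n by (simp add: X)
  have \<beta>I: "\<beta> n \<in> I - \<beta> ` {..<n}" for n
    unfolding X[symmetric] unfolding \<beta>_def by (rule pick(1)[OF finX])
  have \<beta>min: "\<nu> (\<beta> n) \<le> \<nu> j" if "j \<in> I - \<beta> ` {..<n}" for n j
    using that unfolding X[symmetric] unfolding \<beta>_def by (rule pick(2)[OF finX])
  have "inj \<beta>"
  proof (rule linorder_injI)
    fix m n :: nat assume "m < n"
    then have "\<beta> m \<in> \<beta> ` {..<n}" by simp
    then show "\<beta> m \<noteq> \<beta> n" using \<beta>I[of n] by (metis DiffD2)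
  qed
  have mono: "mono (\<lambda>k. \<nu> (\<beta> k))"
  proof (rule mono_iff_le_Suc[THEN iffD2], rule allI)
    fix n
    have "\<beta> (Suc n) \<in> I - \<beta> ` {..<n}" using \<beta>I[of "Suc n"] by auto
    then show "\<nu> (\<beta> n) \<le> \<nu> (\<beta> (Suc n))" by (rule \<beta>min)
  qed
  moreover have "range \<beta> = I"
  proof (rule antisym)
    show "range \<beta> \<subseteq> I" using \<beta>I by auto
    show "I \<subseteq> range \<beta>"
    proof (rule ccontr)
      assume "\<not> I \<subseteq> range \<beta>"
      then obtain j where j: "j \<in> I" "j \<notin> range \<beta>" by auto
      then have "\<nu> (\<beta> n) \<le> \<nu> j" for n by (intro \<beta>min) auto
      then have "range \<beta> \<subseteq> {i \<in> I. \<nu> i \<le> \<nu> j}" using \<beta>I by auto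
      then have "finite (range \<beta>)" using fin finite_subset by blast
      then show False using \<open>inj \<beta>\<close> finite_imageD by blast
    qed
  qed
  ultimately show ?thesis using that \<open>inj \<beta>\<close> by (auto simp: bij_betw_def)
qed

lemma L2_spaceD:
  assumes "f \<in> L2_space M" shows "f \<in> borel_measurable M" "integrable M (\<lambda>x. (f x)\<^sup>2)"
  using assms by (auto simp: L2_space_def)

lemma L2_space_mult_integrable:
  assumes "f \<in> L2_space M" "g \<in> L2_space M"
  shows "integrable M (\<lambda>x. f x * g x)"
proof (rule Bochner_Integration.integrable_bound)
  show "integrable M (\<lambda>x. (f x)\<^sup>2 + (g x)\<^sup>2)" using assms[THEN L2_spaceD(2)] by simp
  show "(\<lambda>x. f x * g x) \<in> borel_measurable M" using assms[THEN L2_spaceD(1)] by simp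
  have "\<bar>a * b\<bar> \<le> a\<^sup>2 + b\<^sup>2" for a b :: real
  proof -
    have "2 * (\<bar>a\<bar> * \<bar>b\<bar>) \<le> a\<^sup>2 + b\<^sup>2"
      using sum_squares_bound[of "\<bar>a\<bar>" "\<bar>b\<bar>"] by (simp add: mult.assoc)
    moreover have "0 \<le> \<bar>a\<bar> * \<bar>b\<bar>" by simp
    ultimately show ?thesis unfolding abs_mult by linarith
  qed
  then show "AE x in M. norm (f x * g x) \<le> norm ((f x)\<^sup>2 + (g x)\<^sup>2)" by simp
qed

lemma L2_space_add:
  assumes "f \<in> L2_space M" "g \<in> L2_space M"
  shows "(\<lambda>x. f x + g x) \<in> L2_space M"
proof -
  have "integrable M (\<lambda>x. (f x)\<^sup>2 + (g x)\<^sup>2 + 2 * (f x * g x))"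
    using assms[THEN L2_spaceD(2)] L2_space_mult_integrable[OF assms] by simp
  moreover have "(f x)\<^sup>2 + (g x)\<^sup>2 + 2 * (f x * g x) = (f x + g x)\<^sup>2" for x by (simp add: power2_sum)
  ultimately show ?thesis using assms[THEN L2_spaceD(1)] by (simp add: L2_space_def)
qed

lemma L2_space_cmult:
  assumes "f \<in> L2_space M" shows "(\<lambda>x. c * f x) \<in> L2_space M"
  using assms by (auto simp: L2_space_def power_mult_distrib)

lemma L2_space_sum:
  assumes "finite I" "\<And>i. i \<in> I \<Longrightarrow> f i \<in> L2_space M"
  shows "(\<lambda>x. \<Sum>i\<in>I. f i x) \<in> L2_space M"
  using assms
proof (induction I rule: finite_induct)
  case empty
  then show ?case by (simp add: L2_space_def)
next
  case (insert i I)
  then have "(\<lambda>x. f i x + (\<Sum>i\<in>I. f i x)) \<in> L2_space M" by (intro L2_space_add) auto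
  then show ?case using insert by simp
qed

lemma sets_weighted_measure [measurable_cong, simp]: "sets (weighted_measure S w) = sets borel"
  by (simp add: weighted_measure_def)

lemma space_weighted_measure [simp]: "space (weighted_measure S w) = UNIV"
  by (simp add: weighted_measure_def)

lemma form_domain_L2_space:
  assumes "v \<in> form_domain S w"
  shows "v \<in> L2_space (weighted_measure S w)"
proof -
  have [measurable]: "v \<in> borel_measurable borel" using assms by (auto simp: form_domain_def W12_loc_def L2_loc_def)
  have "integrable (weighted_measure S w) (\<lambda>x. (v x)\<^sup>2 + (norm (weak_gradient S v x))\<^sup>2)"
    using assms by (simp add: form_domain_def)
  then have "integrable (weighted_measure S w) (\<lambda>x. (v x)\<^sup>2)"
    by (rule Bochner_Integration.integrable_bound) auto
  then show ?thesis by (simp add: L2_space_def)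
qed

lemma energy_commute: "energy S w u v = energy S w v u"
  by (simp add: energy_def inner_commute)

text \<open>A complete orthogonal family of eigenfunctions determines all eigenspaces: an eigenfunction is
  orthogonal to the members of the family with another eigenvalue, and what remains after
  subtraction of its projection is orthogonal to the whole family.\<close>

lemma has_dim_AE_eigenspace_complete:
  fixes \<phi> :: "'i \<Rightarrow> 'a::euclidean_space \<Rightarrow> real"
  assumes M_def: "M = weighted_measure S w"
    and dom: "\<And>i. i \<in> I \<Longrightarrow> \<phi> i \<in> form_domain S w"
    and weak: "\<And>i v. i \<in> I \<Longrightarrow> v \<in> form_domain S w \<Longrightarrow> energy S w (\<phi> i) v = \<nu> i * (LINT x|M. \<phi> i x * v x)"
    and orth: "\<And>i j. i \<in> I \<Longrightarrow> j \<in> I \<Longrightarrow> i \<noteq> j \<Longrightarrow> (LINT x|M. \<phi> i x * \<phi> j x) = 0"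
    and nz: "\<And>i. i \<in> I \<Longrightarrow> (LINT x|M. \<phi> i x * \<phi> i x) \<noteq> 0"
    and complete: "\<And>f. f \<in> L2_space M \<Longrightarrow> (\<And>i. i \<in> I \<Longrightarrow> (LINT x|M. f x * \<phi> i x) = 0) \<Longrightarrow> AE x in M. f x = 0"
    and fin: "finite {i \<in> I. \<nu> i = \<mu>}"
  shows "has_dim_AE M (eigenspace S w \<mu>) (card {i \<in> I. \<nu> i = \<mu>})"
proof -
  let ?J = "{i \<in> I. \<nu> i = \<mu>}" and ?n = "card {i \<in> I. \<nu> i = \<mu>}"
  obtain e where e: "bij_betw e {0..<?n} ?J" using ex_bij_betw_nat_finite[OF fin] by blast
  have eI: "e i \<in> I" "\<nu> (e i) = \<mu>" if "i < ?n" for i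
    using bij_betwE[OF e] that by auto
  have sum_e: "(\<Sum>i<?n. g (e i)) = (\<Sum>j\<in>?J. g j)" for g :: "'i \<Rightarrow> real"
    using sum.reindex_bij_betw[OF e, of g] by (simp add: lessThan_atLeast0)
  have L2: "\<phi> i \<in> L2_space M" if "i \<in> I" for i
    using form_domain_L2_space[OF dom[OF that]] by (simp add: M_def)
  have proj: "(LINT x|M. (\<Sum>i\<in>?J. c i * \<phi> i x) * \<phi> j x) = (if j \<in> ?J then c j * (LINT x|M. \<phi> j x * \<phi> j x) else 0)"
    if j: "j \<in> I" for c j
  proof -
    have "(LINT x|M. (\<Sum>i\<in>?J. c i * \<phi> i x) * \<phi> j x) = (\<Sum>i\<in>?J. c i * (LINT x|M. \<phi> i x * \<phi> j x))"
      unfolding sum_distrib_right mult.assoc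
      by (subst Bochner_Integration.integral_sum) (auto intro!: L2_space_mult_integrable L2 j)
    also have "\<dots> = (\<Sum>i\<in>?J. if i = j then c j * (LINT x|M. \<phi> j x * \<phi> j x) else 0)"
      by (intro sum.cong) (use orth j in auto)
    finally show ?thesis using fin by (simp add: sum.delta')
  qed
  show ?thesis
    unfolding has_dim_AE_def
  proof (intro exI[of _ "\<lambda>i. \<phi> (e i)"] conjI allI impI ballI)
    fix i assume "i < ?n"
    then show "\<phi> (e i) \<in> eigenspace S w \<mu>"
      using eI[of i] dom L2 weak L2_space_cmult[OF L2, of "e i" \<mu>]
      by (auto simp: eigenspace_def neumann_operator_def M_def mult.assoc)
  next
    fix c :: "nat \<Rightarrow> real" and i assume ae: "AE x in M. (\<Sum>i<?n. c i * \<phi> (e i) x) = 0" and i: "i < ?n"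
    define c' where "c' j = c (inv_into {0..<?n} e j)" for j
    have c': "c' (e i) = c i" if "i < ?n" for i
      using e that by (simp add: c'_def bij_betw_def)
    have "(\<Sum>i<?n. c i * \<phi> (e i) x) = (\<Sum>j\<in>?J. c' j * \<phi> j x)" for x
      using sum_e[of "\<lambda>j. c' j * \<phi> j x"] by (simp add: c')
    then have "AE x in M. (\<Sum>j\<in>?J. c' j * \<phi> j x) = 0" using ae by simp
    then have "AE x in M. (\<Sum>j\<in>?J. c' j * \<phi> j x) * \<phi> (e i) x = 0" by eventually_elim simp
    then have "(LINT x|M. (\<Sum>j\<in>?J. c' j * \<phi> j x) * \<phi> (e i) x) = 0"
      by (rule integral_eq_zero_AE)
    then show "c i = 0" using proj[OF eI(1)[OF i], of c'] nz[OF eI(1)[OF i]] eI[OF i] c'[OF i] by simp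
  next
    fix u assume u: "u \<in> eigenspace S w \<mu>"
    then have ud: "u \<in> form_domain S w"
      and ue: "\<And>v. v \<in> form_domain S w \<Longrightarrow> energy S w u v = (LINT x|M. \<mu> * u x * v x)"
      by (auto simp: eigenspace_def neumann_operator_def M_def)
    have uL2: "u \<in> L2_space M" using form_domain_L2_space[OF ud] by (simp add: M_def)
    have ort: "(LINT x|M. u x * \<phi> i x) = 0" if "i \<in> I" "\<nu> i \<noteq> \<mu>" for i
    proof -
      have "energy S w u (\<phi> i) = \<mu> * (LINT x|M. u x * \<phi> i x)"
        unfolding ue[OF dom[OF that(1)]] by (simp add: mult.assoc)
      moreover have "energy S w u (\<phi> i) = \<nu> i * (LINT x|M. u x * \<phi> i x)"
        unfolding energy_commute[of S w u] weak[OF that(1) ud] by (simp add: mult.commute)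
      ultimately have "\<mu> * (LINT x|M. u x * \<phi> i x) = \<nu> i * (LINT x|M. u x * \<phi> i x)" by linarith
      then have "(\<mu> - \<nu> i) * (LINT x|M. u x * \<phi> i x) = 0" by (simp add: left_diff_distrib)
      then show ?thesis using that(2) by simp
    qed
    define c where "c i = (LINT x|M. u x * \<phi> i x) / (LINT x|M. \<phi> i x * \<phi> i x)" for i
    define s where "s x = (\<Sum>i\<in>?J. c i * \<phi> i x)" for x
    have sL2: "s \<in> L2_space M"
      unfolding s_def[abs_def] by (intro L2_space_sum L2_space_cmult L2) (use fin in auto)
    have wL2: "(\<lambda>x. u x + (-1) * s x) \<in> L2_space M"
      by (intro L2_space_add L2_space_cmult uL2 sL2)
    have "AE x in M. u x + (-1) * s x = 0"
    proof (rule complete[OF wL2])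
      fix j assume j: "j \<in> I"
      have "(LINT x|M. (u x + (-1) * s x) * \<phi> j x) = (LINT x|M. u x * \<phi> j x) - (LINT x|M. s x * \<phi> j x)"
        using L2_space_mult_integrable[OF uL2 L2[OF j]] L2_space_mult_integrable[OF sL2 L2[OF j]]
        by (simp add: left_diff_distrib)
      also have "(LINT x|M. s x * \<phi> j x) = (if j \<in> ?J then c j * (LINT x|M. \<phi> j x * \<phi> j x) else 0)"
        unfolding s_def by (rule proj[OF j])
      finally show "(LINT x|M. (u x + (-1) * s x) * \<phi> j x) = 0"
        using j nz[OF j] ort[OF j] by (auto simp: c_def)
    qed
    then have "AE x in M. u x = (\<Sum>i<?n. c (e i) * \<phi> (e i) x)"
      by eventually_elim (simp add: sum_e[of "\<lambda>j. c j * \<phi> j _"] s_def)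
    then show "\<exists>c. AE x in M. u x = (\<Sum>i<?n. c i * \<phi> (e i) x)" by (intro exI[of _ "\<lambda>i. c (e i)"])
  qed
qed

section \<open>Integrals over weighted domains\<close>

context
  fixes S :: "'a::euclidean_space set" and w :: "'a \<Rightarrow> real"
  assumes w: "\<And>x. x \<in> S \<Longrightarrow> 0 \<le> w x" "(\<lambda>x. indicator S x * w x) \<in> borel_measurable borel"
begin

lemma weight_nonneg: "0 \<le> indicator S x * w x"
  using w(1) by (auto simp: indicator_def)

lemma weighted_measure_eq_density:
  "weighted_measure S w = density lborel (\<lambda>x. ennreal (indicator S x * w x))"
  unfolding weighted_measure_def using w(1)
  by (intro arg_cong[of _ _ "density lborel"] ext) (auto simp: indicator_def)

lemma integrable_weighted_measure:
  assumes f: "f \<in> borel_measurable borel"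
  shows "integrable (weighted_measure S w) f \<longleftrightarrow> set_integrable lborel S (\<lambda>x. w x * f x :: real)"
  unfolding weighted_measure_eq_density set_integrable_def
  using w(2) f weight_nonneg by (subst integrable_density) (auto simp: mult.assoc)

lemma integral_weighted_measure:
  assumes f: "f \<in> borel_measurable borel"
  shows "(LINT x|weighted_measure S w. f x) = (LINT x:S|lborel. w x * f x :: real)"
  unfolding weighted_measure_eq_density set_lebesgue_integral_def
  using w(2) f weight_nonneg by (subst integral_density) (auto simp: mult.assoc)

lemma AE_weighted_measure:
  assumes "\<And>x. x \<in> S \<Longrightarrow> 0 < w x"
  shows "(AE x in weighted_measure S w. P x) \<longleftrightarrow> (AE x in lborel. x \<in> S \<longrightarrow> P x)"
proof -
  have "indicator S x * w x > 0 \<longleftrightarrow> x \<in> S" for x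
    using assms by (auto simp: indicator_def)
  then show ?thesis
    unfolding weighted_measure_eq_density using w(2) by (subst AE_density) auto
qed

end

lemma weighted_measure_cong:
  assumes "\<And>x. x \<in> S \<Longrightarrow> w x = w' x"
  shows "weighted_measure S w = weighted_measure S w'"
  unfolding weighted_measure_def using assms
  by (intro arg_cong[of _ _ "density lborel"] ext) (auto simp: indicator_def)

text \<open>Dominated convergence with an integrable factor \<open>f\<close> and uniformly bounded factors \<open>u n\<close>.\<close>

lemma set_integral_mult_tendsto:
  fixes f :: "'a::euclidean_space \<Rightarrow> real"
  assumes S: "S \<in> sets borel" and f: "set_integrable lborel S f"
    and u: "\<And>n. u n \<in> borel_measurable borel"
    and bound: "\<And>n x. x \<in> S \<Longrightarrow> \<bar>u n x\<bar> \<le> C"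
    and lim: "\<And>x. x \<in> S \<Longrightarrow> (\<lambda>n. u n x) \<longlonglongrightarrow> U x"
  shows "(\<lambda>n. LINT x:S|lborel. f x * u n x) \<longlonglongrightarrow> (LINT x:S|lborel. f x * U x)"
  unfolding set_lebesgue_integral_def
proof (rule integral_dominated_convergence[where w = "\<lambda>x. C * \<bar>indicator S x *\<^sub>R f x\<bar>"])
  have F: "integrable lborel (\<lambda>x. indicator S x *\<^sub>R f x)" using f by (simp add: set_integrable_def)
  then show "integrable lborel (\<lambda>x. C * \<bar>indicator S x *\<^sub>R f x\<bar>)" by simp
  have Fm: "(\<lambda>x. indicator S x *\<^sub>R f x) \<in> borel_measurable borel"
    using borel_measurable_integrable[OF F] by simp
  have eq: "indicator S x *\<^sub>R (f x * u n x) = (indicator S x *\<^sub>R f x) * u n x" for n x by simp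
  show "(\<lambda>x. indicator S x *\<^sub>R (f x * u n x)) \<in> borel_measurable lborel" for n
    unfolding eq using borel_measurable_times[OF Fm u[of n]] by simp
  show lim': "AE x in lborel. (\<lambda>n. indicator S x *\<^sub>R (f x * u n x)) \<longlonglongrightarrow> indicator S x *\<^sub>R (f x * U x)"
  proof (rule AE_I2)
    fix x show "(\<lambda>n. indicator S x *\<^sub>R (f x * u n x)) \<longlonglongrightarrow> indicator S x *\<^sub>R (f x * U x)"
      by (cases "x \<in> S") (auto intro!: tendsto_intros lim)
  qed
  show "(\<lambda>x. indicator S x *\<^sub>R (f x * U x)) \<in> borel_measurable lborel"
  proof (rule borel_measurable_LIMSEQ_metric)
    show "(\<lambda>x. indicator S x *\<^sub>R (f x * u n x)) \<in> borel_measurable lborel" for n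
      unfolding eq using borel_measurable_times[OF Fm u[of n]] by simp
    fix x show "(\<lambda>n. indicator S x *\<^sub>R (f x * u n x)) \<longlonglongrightarrow> indicator S x *\<^sub>R (f x * U x)"
      by (cases "x \<in> S") (auto intro!: tendsto_intros lim)
  qed
  show "AE x in lborel. norm (indicator S x *\<^sub>R (f x * u n x)) \<le> C * \<bar>indicator S x *\<^sub>R f x\<bar>" for n
  proof (rule AE_I2)
    fix x show "norm (indicator S x *\<^sub>R (f x * u n x)) \<le> C * \<bar>indicator S x *\<^sub>R f x\<bar>"
      using mult_right_mono[OF bound[of x n], of "\<bar>f x\<bar>"] by (cases "x \<in> S") (auto simp: abs_mult mult.commute)
  qed
qed

section \<open>Cutoff functions\<close>

text \<open>The derivative of \<open>flat_exp\<close>.\<close>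

definition flat_exp_deriv :: "real \<Rightarrow> real" where
  "flat_exp_deriv s = (if s \<le> 0 then 0 else exp (- (1 / s)) / s\<^sup>2)"

lemma flat_exp_has_deriv: "(flat_exp has_real_derivative flat_exp_deriv s) (at s)"
proof -
  consider "s < 0" | "s = 0" | "s > 0" by linarith
  then show ?thesis
  proof cases
    case 1
    have "((\<lambda>_. 0) has_real_derivative flat_exp_deriv s) (at s)" using 1 by (simp add: flat_exp_deriv_def)
    then show ?thesis
      by (rule has_field_derivative_transform_within_open[where S = "{..<0}"])
         (use 1 in \<open>auto simp: flat_exp_def\<close>)
  next
    case 2
    have "C_k (Suc 0) (\<lambda>t. flat_exp (1 * t + 0))" by (rule C_k_flat_exp_affine)
    then have "flat_exp differentiable (at 0)" by auto
    then obtain D where D: "(flat_exp has_real_derivative D) (at 0)" by (auto simp: real_differentiable_def)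
    have "D = 0"
      by (rule DERIV_local_min[OF D, of 1]) (auto simp: flat_exp_def)
    then show ?thesis using D 2 by (simp add: flat_exp_deriv_def)
  next
    case 3
    have "((\<lambda>s. exp (- (1 / s))) has_real_derivative flat_exp_deriv s) (at s)"
      using 3 unfolding flat_exp_deriv_def
      by (auto intro!: derivative_eq_intros simp: field_simps power2_eq_square)
    then show ?thesis
      by (rule has_field_derivative_transform_within_open[where S = "{0<..}"])
         (use 3 in \<open>auto simp: flat_exp_def\<close>)
  qed
qed

lemma flat_exp_deriv_nonneg: "0 \<le> flat_exp_deriv s"
  by (simp add: flat_exp_deriv_def)

lemma flat_exp_deriv_bound:
  "(s + 1) * flat_exp_deriv s \<le> 3" "s > 0 \<Longrightarrow> (s + 1) * flat_exp_deriv s \<le> 1 / s + (1 / s)\<^sup>2"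
proof -
  have "(s + 1) * flat_exp_deriv s \<le> 3 \<and> (s + 1) * flat_exp_deriv s \<le> 1 / s + (1 / s)\<^sup>2" if "s > 0"
  proof -
    define r where "r = 1 / s"
    have r: "r > 0" using that by (simp add: r_def)
    have eq: "(s + 1) * flat_exp_deriv s = (r + r\<^sup>2) * exp (- r)"
      using that by (simp add: flat_exp_deriv_def r_def field_simps power2_eq_square)
    have "r + r\<^sup>2 \<le> 3 * exp r"
      using exp_lower_Taylor_quadratic[of r] r zero_le_power2[of r] by linarith
    then have "(r + r\<^sup>2) * exp (- r) \<le> 3"
      by (simp add: exp_minus field_simps)
    moreover have "(r + r\<^sup>2) * exp (- r) \<le> (r + r\<^sup>2) * 1"
      using r by (intro mult_left_mono) auto
    ultimately show ?thesis by (simp add: eq r_def)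
  qed
  then show "(s + 1) * flat_exp_deriv s \<le> 3" "s > 0 \<Longrightarrow> (s + 1) * flat_exp_deriv s \<le> 1 / s + (1 / s)\<^sup>2"
    by (cases "s > 0"; simp add: flat_exp_deriv_def)+
qed

lemma flat_exp_tendsto_1:
  assumes "x > 0" shows "(\<lambda>n. flat_exp (real n * x - 1)) \<longlonglongrightarrow> 1"
proof -
  have lim: "filterlim (\<lambda>n. real n * x - 1) at_top sequentially" using assms by real_asymp
  have "((\<lambda>s. exp (- (1 / s))) \<longlongrightarrow> (1::real)) at_top" by real_asymp
  moreover have "\<forall>\<^sub>F s in at_top. exp (- (1 / s)) = flat_exp s"
    using eventually_gt_at_top[of 0] by eventually_elim (simp add: flat_exp_def)
  ultimately have "(flat_exp \<longlongrightarrow> 1) at_top" by (rule Lim_transform_eventually)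
  then show ?thesis using lim by (rule filterlim_compose)
qed

lemma flat_exp_deriv_tendsto_0:
  assumes "x > 0" shows "(\<lambda>n. real n * flat_exp_deriv (real n * x - 1)) \<longlonglongrightarrow> 0"
proof -
  have lim: "filterlim (\<lambda>n. real n * x - 1) at_top sequentially" using assms by real_asymp
  have "((\<lambda>s. (s + 1) / x * (exp (- (1 / s)) / s\<^sup>2)) \<longlongrightarrow> (0::real)) at_top" using assms by real_asymp
  moreover have "\<forall>\<^sub>F s in at_top. (s + 1) / x * (exp (- (1 / s)) / s\<^sup>2) = (s + 1) / x * flat_exp_deriv s"
    using eventually_gt_at_top[of 0] by eventually_elim (simp add: flat_exp_deriv_def)
  ultimately have "((\<lambda>s. (s + 1) / x * flat_exp_deriv s) \<longlongrightarrow> 0) at_top" by (rule Lim_transform_eventually)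
  from filterlim_compose[OF this lim] show ?thesis using assms by simp
qed

text \<open>Smooth cutoff functions on \<open>(0, a)\<close>: \<open>cutoff a n\<close> vanishes outside \<open>[1 / n, a - 1 / n]\<close> and tends
  to one inside, while its derivative, multiplied by the distance to the boundary, stays bounded
  (\<open>cutoff_deriv_bound\<close>).\<close>

definition cutoff :: "real \<Rightarrow> nat \<Rightarrow> real \<Rightarrow> real" where
  "cutoff a n x = flat_exp (real n * x - 1) * flat_exp (real n * (a - x) - 1)"

text \<open>The derivative of \<open>cutoff a n\<close>.\<close>

definition cutoff_deriv :: "real \<Rightarrow> nat \<Rightarrow> real \<Rightarrow> real" where
  "cutoff_deriv a n x = real n * flat_exp_deriv (real n * x - 1) * flat_exp (real n * (a - x) - 1)
    - flat_exp (real n * x - 1) * (real n * flat_exp_deriv (real n * (a - x) - 1))"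

lemma cutoff_has_deriv: "(cutoff a n has_real_derivative cutoff_deriv a n x) (at x)"
  unfolding cutoff_def[abs_def] cutoff_deriv_def
  by (rule derivative_eq_intros DERIV_chain2[OF flat_exp_has_deriv] refl)+ (simp add: algebra_simps)

lemma C_k_cutoff: "C_k k (cutoff a n)"
proof -
  have "C_k k (\<lambda>x. flat_exp (real n * x + (-1)) * flat_exp (- real n * x + (real n * a - 1)))"
    by (intro C_k_mult C_k_flat_exp_affine)
  then show ?thesis by (simp add: cutoff_def[abs_def] algebra_simps)
qed

lemma cutoff_bounds: "0 \<le> cutoff a n x" "cutoff a n x \<le> 1"
  using flat_exp_bounds by (auto simp: cutoff_def intro!: mult_le_one)

lemma cutoff_eq_0:
  assumes "x \<notin> {1 / real n..a - 1 / real n}" "n > 0" shows "cutoff a n x = 0"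
proof -
  have "real n * x - 1 \<le> 0 \<or> real n * (a - x) - 1 \<le> 0"
    using assms by (auto simp: field_simps)
  then show ?thesis by (auto simp: cutoff_def flat_exp_def)
qed

lemma cutoff_tendsto: "0 < x \<Longrightarrow> x < a \<Longrightarrow> (\<lambda>n. cutoff a n x) \<longlonglongrightarrow> 1"
  using tendsto_mult[OF flat_exp_tendsto_1[of x] flat_exp_tendsto_1[of "a - x"]] by (simp add: cutoff_def)

lemma cutoff_deriv_tendsto: "0 < x \<Longrightarrow> x < a \<Longrightarrow> (\<lambda>n. cutoff_deriv a n x) \<longlonglongrightarrow> 0"
  using tendsto_diff[OF tendsto_mult[OF flat_exp_deriv_tendsto_0[of x] flat_exp_tendsto_1[of "a - x"]]
    tendsto_mult[OF flat_exp_tendsto_1[of x] flat_exp_deriv_tendsto_0[of "a - x"]]]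
  by (simp add: cutoff_deriv_def)

lemma cutoff_deriv_bound:
  assumes p: "\<bar>p\<bar> \<le> L * x" "\<bar>p\<bar> \<le> L * (a - x)" and L: "L \<ge> 0"
  shows "\<bar>cutoff_deriv a n x * p\<bar> \<le> 6 * L"
proof -
  have *: "\<bar>real n * flat_exp_deriv (real n * y - 1) * e * p\<bar> \<le> 3 * L" if "\<bar>p\<bar> \<le> L * y" "0 \<le> e" "e \<le> 1" for y e
  proof -
    have "\<bar>real n * flat_exp_deriv (real n * y - 1) * e * p\<bar> = (real n * flat_exp_deriv (real n * y - 1)) * \<bar>p\<bar> * e"
      using that flat_exp_deriv_nonneg by (simp add: abs_mult)
    also have "\<dots> \<le> (real n * flat_exp_deriv (real n * y - 1)) * \<bar>p\<bar> * 1"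
      using that flat_exp_deriv_nonneg by (intro mult_left_mono) auto
    also have "\<dots> \<le> (real n * flat_exp_deriv (real n * y - 1)) * (L * y) * 1"
      using that flat_exp_deriv_nonneg by (intro mult_left_mono mult_right_mono) auto
    also have "\<dots> = L * ((real n * y - 1 + 1) * flat_exp_deriv (real n * y - 1))" by simp
    also have "\<dots> \<le> L * 3" using L by (intro mult_left_mono flat_exp_deriv_bound)
    finally show ?thesis by simp
  qed
  have "cutoff_deriv a n x * p = real n * flat_exp_deriv (real n * x - 1) * flat_exp (real n * (a - x) - 1) * p
      - real n * flat_exp_deriv (real n * (a - x) - 1) * flat_exp (real n * x - 1) * p"
    by (simp add: cutoff_deriv_def algebra_simps)
  then show ?thesis
    using *[OF p(1), of "flat_exp (real n * (a - x) - 1)"] *[OF p(2), of "flat_exp (real n * x - 1)"] flat_exp_bounds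
    by (simp add: abs_le_iff)
qed

section \<open>The Neumann eigenvalues of a rectangle\<close>

lemma C_k_sin_cos: "C_k n (\<lambda>x. c * sin (\<omega> * x) + d * cos (\<omega> * x :: real))"
proof (rule C_k_real_family)
  let ?F = "{\<lambda>x. c * sin (\<omega> * x) + d * cos (\<omega> * x) | c d :: real. True}"
  show "(\<lambda>x. c * sin (\<omega> * x) + d * cos (\<omega> * x)) \<in> ?F" by blast
  fix g assume "g \<in> ?F"
  then obtain c d where g: "g = (\<lambda>x. c * sin (\<omega> * x) + d * cos (\<omega> * x))" by blast
  have "(g has_real_derivative (- d * \<omega>) * sin (\<omega> * x) + (c * \<omega>) * cos (\<omega> * x)) (at x)" for x
    unfolding g by (auto intro!: derivative_eq_intros simp: algebra_simps)
  moreover have "(\<lambda>x. (- d * \<omega>) * sin (\<omega> * x) + (c * \<omega>) * cos (\<omega> * x)) \<in> ?F" by blast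
  ultimately show "\<exists>g'\<in>?F. \<forall>x. (g has_real_derivative g' x) (at x)"
    by (intro bexI[of _ "\<lambda>x. (- d * \<omega>) * sin (\<omega> * x) + (c * \<omega>) * cos (\<omega> * x)"]) blast+
qed

lemma C_k_cos: "C_k n (\<lambda>x. cos (\<omega> * x))" and C_k_sin: "C_k n (\<lambda>x. c * sin (\<omega> * x))"
  using C_k_sin_cos[of n 0 \<omega> 1] C_k_sin_cos[of n c \<omega> 0] by simp_all

lemma deriv_bound_on_interval:
  fixes p :: "real \<Rightarrow> real"
  assumes p: "\<And>x. (p has_real_derivative p' x) (at x)" "continuous_on UNIV p'" and 0: "p 0 = 0" "p A = 0" and "A > 0"
  obtains L where "L \<ge> 0" "\<And>x. 0 \<le> x \<Longrightarrow> x \<le> A \<Longrightarrow> \<bar>p' x\<bar> \<le> L"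
    "\<And>x. 0 \<le> x \<Longrightarrow> x \<le> A \<Longrightarrow> \<bar>p x\<bar> \<le> L * x" "\<And>x. 0 \<le> x \<Longrightarrow> x \<le> A \<Longrightarrow> \<bar>p x\<bar> \<le> L * (A - x)"
proof -
  have "bounded (p' ` {0..A})"
    using p(2) by (intro compact_imp_bounded compact_continuous_image) (auto intro: continuous_on_subset)
  then obtain L where L: "\<forall>x\<in>{0..A}. \<bar>p' x\<bar> \<le> L" by (auto simp: bounded_iff)
  then have "L \<ge> 0" using \<open>A > 0\<close> by (force intro: order.trans[OF abs_ge_zero])
  have lip: "\<bar>p y - p x\<bar> \<le> L * (y - x)" if "0 \<le> x" "x \<le> y" "y \<le> A" for x y
  proof (cases "x = y")
    case False
    then have "x < y" using that by simp
    from MVT2[OF this p(1)] obtain z where z: "x < z" "z < y" "p y - p x = (y - x) * p' z" by blast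
    then show ?thesis using L that by (simp add: abs_mult mult.commute mult_left_mono)
  qed simp
  show ?thesis
    using that[OF \<open>L \<ge> 0\<close>] L lip[of 0] lip[of _ A] 0 \<open>A > 0\<close> by auto
qed

text \<open>Integration by parts without boundary term, for a function with merely a weak derivative \<open>H\<close> in
  direction \<open>i\<close>. The factor \<open>p\<close> vanishes at both ends, so it compensates the growth of the
  derivative of the cutoff. The hypothesis on \<open>(i, j)\<close> covers both coordinate directions.\<close>

lemma rectangle_by_parts:
  fixes i j :: "real \<times> real"
  assumes ij: "(i, j) = ((1, 0), (0, 1)) \<or> (i, j) = ((0, 1), (1, 0))"
    and S_def: "S = {z. 0 < z \<bullet> i \<and> z \<bullet> i < A \<and> 0 < z \<bullet> j \<and> z \<bullet> j < B}" and AB: "A > 0" "B > 0"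
    and p: "\<And>n. C_k n p" "\<And>x. (p has_real_derivative p' x) (at x)" "continuous_on UNIV p'" "p 0 = 0" "p A = 0"
    and q: "\<And>n. C_k n q"
    and v: "set_integrable lborel S v" and H: "set_integrable lborel S H"
    and weak: "\<And>\<phi>. test_function S \<phi> \<Longrightarrow> (LINT z:S|lborel. v z * partial_deriv i \<phi> z) = - (LINT z:S|lborel. H z * \<phi> z)"
  shows "(LINT z:S|lborel. v z * (p' (z \<bullet> i) * q (z \<bullet> j))) = - (LINT z:S|lborel. H z * (p (z \<bullet> i) * q (z \<bullet> j)))"
proof -
  have i: "i \<bullet> i = 1" "i \<bullet> j = 0" using ij by auto
  have S: "S \<in> sets borel"
    unfolding S_def by (intro borel_open open_Collect_conj open_Collect_less continuous_intros)
  obtain L where L: "L \<ge> 0" "\<And>x. 0 \<le> x \<Longrightarrow> x \<le> A \<Longrightarrow> \<bar>p' x\<bar> \<le> L"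
    "\<And>x. 0 \<le> x \<Longrightarrow> x \<le> A \<Longrightarrow> \<bar>p x\<bar> \<le> L * x" "\<And>x. 0 \<le> x \<Longrightarrow> x \<le> A \<Longrightarrow> \<bar>p x\<bar> \<le> L * (A - x)"
    using deriv_bound_on_interval[OF p(2-5) AB(1)] by blast
  have cq: "continuous_on UNIV q" using q[of 0] by simp
  then have "bounded (q ` {0..B})"
    by (intro compact_imp_bounded compact_continuous_image) (auto intro: continuous_on_subset)
  then obtain Q where Q: "\<forall>x\<in>{0..B}. \<bar>q x\<bar> \<le> Q" by (auto simp: bounded_iff)
  then have "Q \<ge> 0" using AB by (force intro: order.trans[OF abs_ge_zero])
  have cp: "continuous_on UNIV p" using p(1)[of 0] by simp
  define P where "P n x = cutoff A (Suc n) x * p x" for n x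
  define P' where "P' n x = cutoff_deriv A (Suc n) x * p x + cutoff A (Suc n) x * p' x" for n x
  define R where "R n x = cutoff B (Suc n) x * q x" for n x
  have CP: "C_k k (P n)" "C_k k (R n)" for k n
    unfolding P_def[abs_def] R_def[abs_def] by (intro C_k_mult C_k_cutoff p q)+
  have dP: "(P n has_real_derivative P' n x) (at x)" for n x
    unfolding P_def[abs_def] P'_def
    by (rule derivative_eq_intros cutoff_has_deriv p(2) refl)+ (simp add: algebra_simps)
  have dR: "(R n has_real_derivative partial_deriv 1 (R n) x) (at x)" for n x
  proof -
    have "R n differentiable (at x)" using CP(2)[of "Suc 0" n] by simp
    then obtain D where "(R n has_real_derivative D) (at x)" by (auto simp: real_differentiable_def)
    then show ?thesis using partial_deriv_real(1) by metis
  qed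
  define \<phi> where "\<phi> n z = P n (z \<bullet> i) * R n (z \<bullet> j)" for n z
  have "C_k k (\<phi> n)" for k n
    unfolding \<phi>_def[abs_def] by (intro C_k_mult C_k_inner CP)
  moreover have "\<exists>K. compact K \<and> K \<subseteq> S \<and> (\<forall>z. z \<notin> K \<longrightarrow> \<phi> n z = 0)" for n
  proof -
    define r where "r = 1 / real (Suc n)"
    have r: "r > 0" by (simp add: r_def)
    define K where "K = {z. r \<le> z \<bullet> i \<and> z \<bullet> i \<le> A - r \<and> r \<le> z \<bullet> j \<and> z \<bullet> j \<le> B - r}"
    have "K = {r..A - r} \<times> {r..B - r} \<or> K = {r..B - r} \<times> {r..A - r}"
      using ij unfolding K_def by (auto simp: inner_prod_def)
    then have "compact K" by (auto intro!: compact_Times)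
    moreover have "K \<subseteq> S" using r by (auto simp: K_def S_def)
    moreover have "\<phi> n z = 0" if "z \<notin> K" for z
    proof -
      have "z \<bullet> i \<notin> {r..A - r} \<or> z \<bullet> j \<notin> {r..B - r}" using that by (auto simp: K_def)
      then show ?thesis
        using cutoff_eq_0[of "z \<bullet> i" "Suc n" A] cutoff_eq_0[of "z \<bullet> j" "Suc n" B]
        by (auto simp: \<phi>_def P_def R_def r_def)
    qed
    ultimately show ?thesis by blast
  qed
  ultimately have test: "test_function S (\<phi> n)" for n by (auto simp: test_function_def)
  have pd: "partial_deriv i (\<phi> n) z = P' n (z \<bullet> i) * R n (z \<bullet> j)" for n z
  proof -
    have d1: "(\<lambda>z. P n (z \<bullet> i)) differentiable (at z)" "(\<lambda>z. R n (z \<bullet> j)) differentiable (at z)"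
      by (rule differentiableI partial_deriv_inner(1) dP dR)+
    show ?thesis
      unfolding \<phi>_def[abs_def] partial_deriv_mult[OF d1]
      using partial_deriv_inner(2)[where i = i, OF dP[of n "z \<bullet> i"]] partial_deriv_inner(2)[where i = i, OF dR[of n "z \<bullet> j"]] i
      by simp
  qed
  have cont_inner: "continuous_on UNIV (\<lambda>z. f (z \<bullet> k))" if "continuous_on UNIV f" for f :: "real \<Rightarrow> real" and k :: "real \<times> real"
    using that by (intro continuous_on_compose2[OF that]) (auto intro!: continuous_intros)
  have contP: "continuous_on UNIV (P n)" "continuous_on UNIV (R n)" for n
    using CP(1)[of 0] CP(2)[of 0] by auto
  have contP': "continuous_on UNIV (P' n)" for n
  proof -
    have "partial_deriv 1 (P n) = P' n" using partial_deriv_real(1)[OF dP] by auto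
    then show ?thesis using CP(1)[of "Suc 0" n] by auto
  qed
  have lim1: "(\<lambda>n. LINT z:S|lborel. v z * (P' n (z \<bullet> i) * R n (z \<bullet> j)))
    \<longlonglongrightarrow> (LINT z:S|lborel. v z * (p' (z \<bullet> i) * q (z \<bullet> j)))"
  proof (rule set_integral_mult_tendsto[OF S v, where C = "7 * L * Q"])
    show "(\<lambda>z. P' n (z \<bullet> i) * R n (z \<bullet> j)) \<in> borel_measurable borel" for n
      using cont_inner[OF contP'[of n]] cont_inner[OF contP(2)[of n]]
      by (intro borel_measurable_times continuous_real_measurable)
    fix z assume z: "z \<in> S"
    have b1: "\<bar>P' n (z \<bullet> i)\<bar> \<le> 7 * L" for n
    proof -
      have "\<bar>cutoff_deriv A (Suc n) (z \<bullet> i) * p (z \<bullet> i)\<bar> \<le> 6 * L"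
        using z L by (intro cutoff_deriv_bound) (auto simp: S_def)
      moreover have "\<bar>cutoff A (Suc n) (z \<bullet> i) * p' (z \<bullet> i)\<bar> \<le> 1 * L"
        unfolding abs_mult using z L cutoff_bounds by (intro mult_mono) (auto simp: S_def)
      ultimately show ?thesis unfolding P'_def by linarith
    qed
    have b2: "\<bar>R n (z \<bullet> j)\<bar> \<le> 1 * Q" for n
      unfolding R_def abs_mult using z Q cutoff_bounds by (intro mult_mono) (auto simp: S_def)
    show "\<bar>P' n (z \<bullet> i) * R n (z \<bullet> j)\<bar> \<le> 7 * L * Q" for n
      unfolding abs_mult using b1[of n] b2[of n] L(1) by (intro mult_mono) auto
    have "(\<lambda>n. P' n (z \<bullet> i)) \<longlonglongrightarrow> 0 * p (z \<bullet> i) + 1 * p' (z \<bullet> i)"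
      unfolding P'_def using z
      by (intro tendsto_intros LIMSEQ_Suc[OF cutoff_tendsto] LIMSEQ_Suc[OF cutoff_deriv_tendsto]) (auto simp: S_def)
    moreover have "(\<lambda>n. R n (z \<bullet> j)) \<longlonglongrightarrow> 1 * q (z \<bullet> j)"
      unfolding R_def using z by (intro tendsto_intros LIMSEQ_Suc[OF cutoff_tendsto]) (auto simp: S_def)
    ultimately show "(\<lambda>n. P' n (z \<bullet> i) * R n (z \<bullet> j)) \<longlonglongrightarrow> p' (z \<bullet> i) * q (z \<bullet> j)"
      by (intro tendsto_mult) auto
  qed
  have lim2: "(\<lambda>n. LINT z:S|lborel. H z * (P n (z \<bullet> i) * R n (z \<bullet> j)))
    \<longlonglongrightarrow> (LINT z:S|lborel. H z * (p (z \<bullet> i) * q (z \<bullet> j)))"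
  proof (rule set_integral_mult_tendsto[OF S H, where C = "L * A * Q"])
    show "(\<lambda>z. P n (z \<bullet> i) * R n (z \<bullet> j)) \<in> borel_measurable borel" for n
      using cont_inner[OF contP(1)[of n]] cont_inner[OF contP(2)[of n]]
      by (intro borel_measurable_times continuous_real_measurable)
    fix z assume z: "z \<in> S"
    have b1: "\<bar>P n (z \<bullet> i)\<bar> \<le> 1 * (L * A)" for n
    proof -
      have "\<bar>p (z \<bullet> i)\<bar> \<le> L * (z \<bullet> i)" using z L by (auto simp: S_def)
      also have "\<dots> \<le> L * A" using z L(1) by (intro mult_left_mono) (auto simp: S_def)
      finally show ?thesis
        unfolding P_def abs_mult using cutoff_bounds by (intro mult_mono) auto
    qed
    have b2: "\<bar>R n (z \<bullet> j)\<bar> \<le> 1 * Q" for n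
      unfolding R_def abs_mult using z Q cutoff_bounds by (intro mult_mono) (auto simp: S_def)
    show "\<bar>P n (z \<bullet> i) * R n (z \<bullet> j)\<bar> \<le> L * A * Q" for n
      unfolding abs_mult using b1[of n] b2[of n] L(1) AB by (intro mult_mono) auto
    have "(\<lambda>n. P n (z \<bullet> i)) \<longlonglongrightarrow> 1 * p (z \<bullet> i)"
      unfolding P_def using z by (intro tendsto_intros LIMSEQ_Suc[OF cutoff_tendsto]) (auto simp: S_def)
    moreover have "(\<lambda>n. R n (z \<bullet> j)) \<longlonglongrightarrow> 1 * q (z \<bullet> j)"
      unfolding R_def using z by (intro tendsto_intros LIMSEQ_Suc[OF cutoff_tendsto]) (auto simp: S_def)
    ultimately show "(\<lambda>n. P n (z \<bullet> i) * R n (z \<bullet> j)) \<longlonglongrightarrow> p (z \<bullet> i) * q (z \<bullet> j)"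
      by (intro tendsto_mult) auto
  qed
  have "(LINT z:S|lborel. v z * (P' n (z \<bullet> i) * R n (z \<bullet> j))) = - (LINT z:S|lborel. H z * (P n (z \<bullet> i) * R n (z \<bullet> j)))" for n
    using weak[OF test[of n]] unfolding pd by (simp add: \<phi>_def)
  then have "(\<lambda>n. - (LINT z:S|lborel. H z * (P n (z \<bullet> i) * R n (z \<bullet> j)))) \<longlonglongrightarrow> (LINT z:S|lborel. v z * (p' (z \<bullet> i) * q (z \<bullet> j)))"
    using lim1 by simp
  then show ?thesis using tendsto_minus[OF lim2] LIMSEQ_unique by blast
qed

lemma weak_gradient_measurable:
  assumes "v \<in> form_domain S w"
  shows "v \<in> borel_measurable borel" "weak_gradient S v \<in> borel_measurable borel"
    "L2_loc S v" "L2_loc S (weak_gradient S v)" "is_weak_gradient S v (weak_gradient S v)"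
proof -
  have v: "v \<in> W12_loc S" using assms by (simp add: form_domain_def)
  then show L: "L2_loc S v" by (simp add: W12_loc_def)
  show G: "L2_loc S (weak_gradient S v)" "is_weak_gradient S v (weak_gradient S v)"
    using weak_gradient_works[OF v] by auto
  show "v \<in> borel_measurable borel" "weak_gradient S v \<in> borel_measurable borel"
    using L G(1) by (auto simp: L2_loc_def)
qed

context
  fixes A B :: real and S :: "(real \<times> real) set"
  assumes AB: "A > 0" "B > 0" and S_def: "S = {0<..<A} \<times> {0<..<B}"
begin

lemma rect_open: "open S" and rect_borel: "S \<in> sets borel"
  by (auto simp: S_def open_Times intro!: borel_open)

lemma rect_eq:
  "S = {z. 0 < z \<bullet> (1, 0) \<and> z \<bullet> (1, 0) < A \<and> 0 < z \<bullet> (0, 1) \<and> z \<bullet> (0, 1) < B}"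
  "S = {z. 0 < z \<bullet> (0, 1) \<and> z \<bullet> (0, 1) < B \<and> 0 < z \<bullet> (1, 0) \<and> z \<bullet> (1, 0) < A}"
  by (auto simp: S_def inner_prod_def)

lemma rect_set_integrable_cont:
  assumes "continuous_on UNIV f"
  shows "set_integrable lborel S (f :: real \<times> real \<Rightarrow> real)"
proof -
  have "set_integrable lborel ({0..A} \<times> {0..B}) f"
    unfolding set_integrable_def using assms
    by (intro borel_integrable_compact compact_Times) (auto intro: continuous_on_subset)
  then show ?thesis
    by (rule set_integrable_subset) (use rect_borel in \<open>auto simp: S_def\<close>)
qed

abbreviation "rect_measure \<equiv> weighted_measure S (\<lambda>_. 1)"

lemma rect_weight: "0 \<le> (1::real)" "(\<lambda>x. indicator S x * 1 :: real) \<in> borel_measurable borel"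
  using rect_borel by auto

lemma rect_integrable: "f \<in> borel_measurable borel \<Longrightarrow> integrable rect_measure f \<longleftrightarrow> set_integrable lborel S (f :: _ \<Rightarrow> real)"
  using integrable_weighted_measure[of S "\<lambda>_. 1" f] rect_weight by simp

lemma rect_integral: "f \<in> borel_measurable borel \<Longrightarrow> (LINT x|rect_measure. f x) = (LINT x:S|lborel. f x :: real)"
  using integral_weighted_measure[of S "\<lambda>_. 1" f] rect_weight by simp

lemma rect_AE: "(AE x in rect_measure. P x) \<longleftrightarrow> (AE x in lborel. x \<in> S \<longrightarrow> P x)"
  using AE_weighted_measure[of S "\<lambda>_. 1" P] rect_weight by simp

lemma rect_form_domain_integrable:
  assumes v: "v \<in> form_domain S (\<lambda>_. 1)"
  shows "set_integrable lborel S v" "set_integrable lborel S (\<lambda>z. weak_gradient S v z \<bullet> i)"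
proof -
  note [measurable] = weak_gradient_measurable(1,2)[OF v] rect_borel
  have "integrable rect_measure (\<lambda>x. (v x)\<^sup>2 + (norm (weak_gradient S v x))\<^sup>2)" using v by (simp add: form_domain_def)
  then have "set_integrable lborel S (\<lambda>x. (v x)\<^sup>2 + (norm (weak_gradient S v x))\<^sup>2)"
    by (subst (asm) rect_integrable) auto
  then have int: "set_integrable lborel S (\<lambda>x. (v x)\<^sup>2 + (norm (weak_gradient S v x))\<^sup>2 + (1 + (norm i)\<^sup>2))"
    by (rule set_integral_add(1)) (intro rect_set_integrable_cont continuous_intros)
  show "set_integrable lborel S v"
  proof (rule set_integrable_bound[OF int])
    have "\<bar>a\<bar> \<le> a\<^sup>2 + 1" for a :: real
      using sum_squares_bound[of "\<bar>a\<bar>" 1] abs_ge_zero[of a] by (simp del: abs_ge_zero)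
    then have "\<bar>v x\<bar> \<le> (v x)\<^sup>2 + (norm (weak_gradient S v x))\<^sup>2 + (1 + (norm i)\<^sup>2)" for x
      by (smt (verit) zero_le_power2)
    then show "AE x in lborel. x \<in> S \<longrightarrow> norm (v x) \<le> norm ((v x)\<^sup>2 + (norm (weak_gradient S v x))\<^sup>2 + (1 + (norm i)\<^sup>2))"
      by auto
  qed (simp add: set_borel_measurable_def)
  show "set_integrable lborel S (\<lambda>z. weak_gradient S v z \<bullet> i)"
  proof (rule set_integrable_bound[OF int])
    have "\<bar>weak_gradient S v x \<bullet> i\<bar> \<le> (v x)\<^sup>2 + (norm (weak_gradient S v x))\<^sup>2 + (1 + (norm i)\<^sup>2)" for x
      using Cauchy_Schwarz_ineq2[of "weak_gradient S v x" i] sum_squares_bound[of "norm (weak_gradient S v x)" "norm i"]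
        mult_nonneg_nonneg[OF norm_ge_zero[of "weak_gradient S v x"] norm_ge_zero[of i]] zero_le_power2[of "v x"]
      by linarith
    then show "AE x in lborel. x \<in> S \<longrightarrow> norm (weak_gradient S v x \<bullet> i) \<le> norm ((v x)\<^sup>2 + (norm (weak_gradient S v x))\<^sup>2 + (1 + (norm i)\<^sup>2))"
      by auto
  qed (simp add: set_borel_measurable_def)
qed

text \<open>The Neumann eigenfunctions of the rectangle; the index pair gives the numbers of half waves in
  the two directions.\<close>

definition cosprod :: "nat \<times> nat \<Rightarrow> real \<times> real \<Rightarrow> real" where
  "cosprod k z = cos (real (fst k) * pi / A * (z \<bullet> (1, 0))) * cos (real (snd k) * pi / B * (z \<bullet> (0, 1)))"

text \<open>The classical gradient of \<open>cosprod k\<close>.\<close>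

definition cosprod_grad :: "nat \<times> nat \<Rightarrow> real \<times> real \<Rightarrow> real \<times> real" where
  "cosprod_grad k z =
    (- (real (fst k) * pi / A) * sin (real (fst k) * pi / A * (z \<bullet> (1, 0))) * cos (real (snd k) * pi / B * (z \<bullet> (0, 1))),
     - (real (snd k) * pi / B) * sin (real (snd k) * pi / B * (z \<bullet> (0, 1))) * cos (real (fst k) * pi / A * (z \<bullet> (1, 0))))"

text \<open>The eigenvalue that belongs to \<open>cosprod k\<close>.\<close>

definition rect_eigenvalue :: "nat \<times> nat \<Rightarrow> real" where
  "rect_eigenvalue k = (real (fst k) * pi / A)\<^sup>2 + (real (snd k) * pi / B)\<^sup>2"

lemma C_k_cosprod: "C_k n (cosprod k)"
  unfolding cosprod_def[abs_def] by (intro C_k_mult C_k_inner[where f = "\<lambda>x. cos (_ * x)"] C_k_cos)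

lemma cosprod_continuous: "continuous_on UNIV (cosprod k)"
  using C_k_cosprod by (rule C_k_imp_continuous)

lemma cosprod_grad_continuous: "continuous_on UNIV (cosprod_grad k)"
  unfolding cosprod_grad_def by (intro continuous_intros) 

lemma cosprod_measurable [measurable]: "cosprod k \<in> borel_measurable borel" "cosprod_grad k \<in> borel_measurable borel"
  by (rule borel_measurable_continuous_onI, rule cosprod_continuous cosprod_grad_continuous)+

lemma cosprod_partial: "i \<in> Basis \<Longrightarrow> cosprod_grad k z \<bullet> i = partial_deriv i (cosprod k) z"
proof -
  assume i: "i \<in> Basis"
  have "(cosprod k has_derivative (\<lambda>h. cosprod_grad k z \<bullet> h)) (at z)"
    unfolding cosprod_def[abs_def] cosprod_grad_def using AB
    by (auto intro!: derivative_eq_intros simp: inner_prod_def algebra_simps)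
  from frechet_derivative_at[OF this] show ?thesis by metis
qed

lemma cosprod_weak_gradient:
  "cosprod k \<in> W12_loc S" "AE x in lborel. x \<in> S \<longrightarrow> weak_gradient S (cosprod k) x = cosprod_grad k x"
  using classical_gradient[OF rect_open C_k_cosprod cosprod_partial] by blast+

lemma cosprod_form_domain: "cosprod k \<in> form_domain S (\<lambda>_. 1)"
proof -
  have [measurable]: "weak_gradient S (cosprod k) \<in> borel_measurable borel"
    using weak_gradient_works(1)[OF cosprod_weak_gradient(1)] by (auto simp: L2_loc_def)
  have "set_integrable lborel S (\<lambda>x. (cosprod k x)\<^sup>2 + (norm (cosprod_grad k x))\<^sup>2)"
    by (intro rect_set_integrable_cont continuous_intros cosprod_continuous cosprod_grad_continuous)
  moreover have "set_integrable lborel S (\<lambda>x. (cosprod k x)\<^sup>2 + (norm (weak_gradient S (cosprod k) x))\<^sup>2)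
      = set_integrable lborel S (\<lambda>x. (cosprod k x)\<^sup>2 + (norm (cosprod_grad k x))\<^sup>2)"
  proof (rule set_integrable_cong_AE)
    show "AE x\<in>S in lborel. (cosprod k x)\<^sup>2 + (norm (weak_gradient S (cosprod k) x))\<^sup>2
      = (cosprod k x)\<^sup>2 + (norm (cosprod_grad k x))\<^sup>2"
      using cosprod_weak_gradient(2)[of k] by eventually_elim simp
  qed (use rect_borel in auto)
  ultimately have "set_integrable lborel S (\<lambda>x. (cosprod k x)\<^sup>2 + (norm (weak_gradient S (cosprod k) x))\<^sup>2)"
    by simp
  then show ?thesis
    using cosprod_weak_gradient(1) by (simp add: form_domain_def rect_integrable)
qed

text \<open>Both directional energies of a product of cosines against an arbitrary function of the form
  domain.\<close>

lemma cosprod_directional: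
  assumes v: "set_integrable lborel S v" and H: "\<And>i. i \<in> Basis \<Longrightarrow> set_integrable lborel S (\<lambda>z. G z \<bullet> i)"
    and wg: "is_weak_gradient S v G"
  shows "(LINT z:S|lborel. (G z \<bullet> (1, 0)) * (cosprod_grad k z \<bullet> (1, 0))) = (real (fst k) * pi / A)\<^sup>2 * (LINT z:S|lborel. v z * cosprod k z)"
    "(LINT z:S|lborel. (G z \<bullet> (0, 1)) * (cosprod_grad k z \<bullet> (0, 1))) = (real (snd k) * pi / B)\<^sup>2 * (LINT z:S|lborel. v z * cosprod k z)"
proof -
  have basis: "(1, 0) \<in> (Basis :: (real \<times> real) set)" "(0, 1) \<in> (Basis :: (real \<times> real) set)"
    by (auto simp: Basis_prod_def)
  have weak: "(LINT z:S|lborel. v z * partial_deriv i \<phi> z) = - (LINT z:S|lborel. (G z \<bullet> i) * \<phi> z)"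
    if "i \<in> Basis" "test_function S \<phi>" for i \<phi>
    using wg that unfolding is_weak_gradient_def by blast
  have bp: "(LINT z:S|lborel. (G z \<bullet> i) * (- \<alpha> * sin (\<alpha> * (z \<bullet> i)) * cos (\<beta> * (z \<bullet> j))))
      = \<alpha>\<^sup>2 * (LINT z:S|lborel. v z * (cos (\<alpha> * (z \<bullet> i)) * cos (\<beta> * (z \<bullet> j))))"
    if ij: "(i, j) = ((1, 0), (0, 1)) \<or> (i, j) = ((0, 1), (1, 0))"
      and Seq: "S = {z. 0 < z \<bullet> i \<and> z \<bullet> i < A' \<and> 0 < z \<bullet> j \<and> z \<bullet> j < B'}" "A' > 0" "B' > 0"
      and \<alpha>: "sin (\<alpha> * A') = 0" for i j A' B' \<alpha> \<beta>
  proof -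
    have i: "i \<in> Basis" using ij basis by auto
    have "(LINT z:S|lborel. v z * ((- \<alpha>\<^sup>2 * cos (\<alpha> * (z \<bullet> i))) * cos (\<beta> * (z \<bullet> j))))
      = - (LINT z:S|lborel. (G z \<bullet> i) * ((- \<alpha> * sin (\<alpha> * (z \<bullet> i))) * cos (\<beta> * (z \<bullet> j))))"
    proof (rule rectangle_by_parts[OF ij Seq, where p' = "\<lambda>x. - \<alpha>\<^sup>2 * cos (\<alpha> * x)" and p = "\<lambda>x. - \<alpha> * sin (\<alpha> * x)" and q = "\<lambda>x. cos (\<beta> * x)"])
      show "((\<lambda>x. - \<alpha> * sin (\<alpha> * x)) has_real_derivative - \<alpha>\<^sup>2 * cos (\<alpha> * x)) (at x)" for x
        by (auto intro!: derivative_eq_intros simp: power2_eq_square)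
      show "C_k n (\<lambda>x. - \<alpha> * sin (\<alpha> * x))" for n by (rule C_k_sin)
      show "continuous_on UNIV (\<lambda>x. - \<alpha>\<^sup>2 * cos (\<alpha> * x))" by (intro continuous_intros)
    qed (use \<alpha> v H[OF i] weak[OF i] C_k_sin C_k_cos in auto)
    moreover have "(LINT z:S|lborel. v z * ((- \<alpha>\<^sup>2 * cos (\<alpha> * (z \<bullet> i))) * cos (\<beta> * (z \<bullet> j))))
      = - \<alpha>\<^sup>2 * (LINT z:S|lborel. v z * (cos (\<alpha> * (z \<bullet> i)) * cos (\<beta> * (z \<bullet> j))))"
      by (subst set_integral_mult_right[symmetric], rule set_lebesgue_integral_cong) (use rect_borel in auto)
    ultimately show ?thesis by simp
  qed
  have sin0: "sin (real n * pi / C * C) = 0" if "C > 0" for n C using that by simp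
  show "(LINT z:S|lborel. (G z \<bullet> (1, 0)) * (cosprod_grad k z \<bullet> (1, 0))) = (real (fst k) * pi / A)\<^sup>2 * (LINT z:S|lborel. v z * cosprod k z)"
    using bp[OF _ rect_eq(1) AB sin0[OF AB(1)], of "fst k" "real (snd k) * pi / B"]
    by (simp add: cosprod_grad_def cosprod_def)
  show "(LINT z:S|lborel. (G z \<bullet> (0, 1)) * (cosprod_grad k z \<bullet> (0, 1))) = (real (snd k) * pi / B)\<^sup>2 * (LINT z:S|lborel. v z * cosprod k z)"
    using bp[OF _ rect_eq(2) AB(2,1) sin0[OF AB(2)], of "snd k" "real (fst k) * pi / A"]
    by (simp add: cosprod_grad_def cosprod_def mult_ac)
qed

lemma cosprod_energy:
  assumes v: "v \<in> form_domain S (\<lambda>_. 1)"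
  shows "energy S (\<lambda>_. 1) (cosprod k) v = rect_eigenvalue k * (LINT x|rect_measure. cosprod k x * v x)"
proof -
  let ?G = "weak_gradient S v"
  note [measurable] = weak_gradient_measurable(1,2)[OF v] rect_borel
    weak_gradient_measurable(2)[OF cosprod_form_domain]
  note vi = rect_form_domain_integrable[OF v] and wg = weak_gradient_measurable(5)[OF v]
  have bounded: "set_integrable lborel S (\<lambda>z. (?G z \<bullet> i) * (cosprod_grad k z \<bullet> i))" for i
  proof (rule set_integrable_bound)
    define C where "C = (real (fst k) * pi / A) + (real (snd k) * pi / B)"
    have C: "C \<ge> 0" using AB by (simp add: C_def)
    show "set_integrable lborel S (\<lambda>z. (C * norm i) * (?G z \<bullet> i))" using vi(2)[of i] by simp
    have "norm (cosprod_grad k z) \<le> C" for z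
    proof -
      have "norm (cosprod_grad k z) \<le> norm (fst (cosprod_grad k z)) + norm (snd (cosprod_grad k z))"
        by (metis norm_Pair_le prod.collapse)
      also have "norm (fst (cosprod_grad k z)) \<le> (real (fst k) * pi / A) * 1 * 1"
        unfolding cosprod_grad_def fst_conv real_norm_def abs_mult using AB
        by (intro mult_mono) auto
      also have "norm (snd (cosprod_grad k z)) \<le> (real (snd k) * pi / B) * 1 * 1"
        unfolding cosprod_grad_def snd_conv real_norm_def abs_mult using AB
        by (intro mult_mono) auto
      finally show ?thesis by (simp add: C_def)
    qed
    then have bd: "\<bar>cosprod_grad k z \<bullet> i\<bar> \<le> C * norm i" for z
      using Cauchy_Schwarz_ineq2[of "cosprod_grad k z" i] mult_right_mono[of "norm (cosprod_grad k z)" C "norm i"] by fastforce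
    have "norm ((?G z \<bullet> i) * (cosprod_grad k z \<bullet> i)) \<le> norm ((C * norm i) * (?G z \<bullet> i))" for z
      using mult_left_mono[OF bd[of z] abs_ge_zero[of "?G z \<bullet> i"]] C by (simp add: abs_mult mult_ac)
    then show "AE z in lborel. z \<in> S \<longrightarrow> norm ((?G z \<bullet> i) * (cosprod_grad k z \<bullet> i)) \<le> norm ((C * norm i) * (?G z \<bullet> i))"
      by (intro AE_I2) blast
  qed (simp add: set_borel_measurable_def)
  have "energy S (\<lambda>_. 1) (cosprod k) v = (LINT z:S|lborel. weak_gradient S (cosprod k) z \<bullet> ?G z)"
    unfolding energy_def by (intro rect_integral) measurable
  also have "\<dots> = (LINT z:S|lborel. (?G z \<bullet> (1, 0)) * (cosprod_grad k z \<bullet> (1, 0)) + (?G z \<bullet> (0, 1)) * (cosprod_grad k z \<bullet> (0, 1)))"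
  proof (rule set_lebesgue_integral_cong_AE)
    have eq: "x \<bullet> y = (y \<bullet> (1, 0)) * (x \<bullet> (1, 0)) + (y \<bullet> (0, 1)) * (x \<bullet> (0, 1))" for x y :: "real \<times> real"
      by (simp add: inner_prod_def mult.commute)
    show "AE z\<in>S in lborel. weak_gradient S (cosprod k) z \<bullet> ?G z
        = (?G z \<bullet> (1, 0)) * (cosprod_grad k z \<bullet> (1, 0)) + (?G z \<bullet> (0, 1)) * (cosprod_grad k z \<bullet> (0, 1))"
      using cosprod_weak_gradient(2)[of k]
    proof eventually_elim
      case (elim z)
      show ?case
      proof
        assume "z \<in> S"
        with elim have g: "weak_gradient S (cosprod k) z = cosprod_grad k z" by blast
        show "weak_gradient S (cosprod k) z \<bullet> ?G z
          = (?G z \<bullet> (1, 0)) * (cosprod_grad k z \<bullet> (1, 0)) + (?G z \<bullet> (0, 1)) * (cosprod_grad k z \<bullet> (0, 1))"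
          unfolding g by (rule eq)
      qed
    qed
  qed measurable
  also have "\<dots> = rect_eigenvalue k * (LINT z:S|lborel. v z * cosprod k z)"
    unfolding set_integral_add(2)[OF bounded bounded] cosprod_directional[OF vi wg] rect_eigenvalue_def
    by (rule distrib_right[symmetric])
  also have "(LINT z:S|lborel. v z * cosprod k z) = (LINT x|rect_measure. cosprod k x * v x)"
    by (subst rect_integral) (auto simp: mult.commute)
  finally show ?thesis .
qed

text \<open>Two different products of cosines differ in one of the directions; there the directional energy,
  which is symmetric, gives two different multiples of the same inner product.\<close>

lemma cosprod_orthogonal:
  assumes "k \<noteq> l"
  shows "(LINT x|rect_measure. cosprod k x * cosprod l x) = 0"
proof -
  let ?I = "LINT z:S|lborel. cosprod k z * cosprod l z"
  have I': "?I = (LINT z:S|lborel. cosprod l z * cosprod k z)" by (simp add: mult.commute)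
  have wg: "is_weak_gradient S (cosprod k) (cosprod_grad k)" for k
    using classical_gradient(1)[OF rect_open C_k_cosprod cosprod_partial] .
  have int: "set_integrable lborel S (cosprod k)" for k
    by (rule rect_set_integrable_cont[OF cosprod_continuous])
  have intg: "set_integrable lborel S (\<lambda>z. cosprod_grad k z \<bullet> i)" for k i
    by (intro rect_set_integrable_cont continuous_intros cosprod_grad_continuous)
  have 1: "(real (fst k) * pi / A)\<^sup>2 * ?I = (real (fst l) * pi / A)\<^sup>2 * ?I"
  proof -
    have "(LINT z:S|lborel. (cosprod_grad k z \<bullet> (1, 0)) * (cosprod_grad l z \<bullet> (1, 0)))
        = (LINT z:S|lborel. (cosprod_grad l z \<bullet> (1, 0)) * (cosprod_grad k z \<bullet> (1, 0)))"
      by (rule set_lebesgue_integral_cong) (use rect_borel in \<open>auto simp: mult.commute\<close>)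
    then show ?thesis
      using cosprod_directional(1)[where v = "cosprod k" and G = "cosprod_grad k" and k = l, OF int intg wg]
        cosprod_directional(1)[where v = "cosprod l" and G = "cosprod_grad l" and k = k, OF int intg wg]
      unfolding I'[symmetric] by linarith
  qed
  have 2: "(real (snd k) * pi / B)\<^sup>2 * ?I = (real (snd l) * pi / B)\<^sup>2 * ?I"
  proof -
    have "(LINT z:S|lborel. (cosprod_grad k z \<bullet> (0, 1)) * (cosprod_grad l z \<bullet> (0, 1)))
        = (LINT z:S|lborel. (cosprod_grad l z \<bullet> (0, 1)) * (cosprod_grad k z \<bullet> (0, 1)))"
      by (rule set_lebesgue_integral_cong) (use rect_borel in \<open>auto simp: mult.commute\<close>)
    then show ?thesis
      using cosprod_directional(2)[where v = "cosprod k" and G = "cosprod_grad k" and k = l, OF int intg wg]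
        cosprod_directional(2)[where v = "cosprod l" and G = "cosprod_grad l" and k = k, OF int intg wg]
      unfolding I'[symmetric] by linarith
  qed
  have "?I = 0"
  proof (rule ccontr)
    assume "?I \<noteq> 0"
    with 1 2 have "(real (fst k) * pi / A)\<^sup>2 = (real (fst l) * pi / A)\<^sup>2" "(real (snd k) * pi / B)\<^sup>2 = (real (snd l) * pi / B)\<^sup>2"
      by auto
    then have "fst k = fst l" "snd k = snd l"
      using AB by (auto simp: power2_eq_iff_nonneg)
    then show False using assms by (simp add: prod_eq_iff)
  qed
  then show ?thesis by (subst rect_integral) auto
qed

lemma cosprod_norm_nonzero: "(LINT x|rect_measure. cosprod k x * cosprod k x) \<noteq> 0"
proof
  assume 0: "(LINT x|rect_measure. cosprod k x * cosprod k x) = 0"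
  have "integrable rect_measure (\<lambda>x. cosprod k x * cosprod k x)"
    by (subst rect_integrable) (auto intro!: rect_set_integrable_cont continuous_intros cosprod_continuous)
  then have "AE x in rect_measure. cosprod k x * cosprod k x = 0"
    using 0 by (subst (asm) integral_nonneg_eq_0_iff_AE) auto
  then have ae: "AE x in lborel. x \<in> S \<longrightarrow> cosprod k x = 0" by (simp add: rect_AE)
  define a b where "a = A / (2 * real (fst k) + 2)" and "b = B / (2 * real (snd k) + 2)"
  have ab: "0 < a" "a \<le> A" "0 < b" "b \<le> B" using AB by (auto simp: a_def b_def field_simps)
  have cos_pos: "cos (real n * pi / C * x) > 0" if "C > 0" "0 < x" "x < C / (2 * real n + 2)" for n C x
  proof (rule cos_gt_zero_pi)
    show "real n * pi / C * x < pi / 2"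
    proof -
      have "real n * pi / C * x \<le> real n * pi / C * (C / (2 * real n + 2))"
        using that by (intro mult_left_mono) auto
      also have "\<dots> = pi / 2 * (real n / (real n + 1))" using that(1) by (simp add: field_simps)
      also have "\<dots> < pi / 2 * 1" by (intro mult_strict_left_mono) auto
      finally show ?thesis by simp
    qed
    show "- (pi / 2) < real n * pi / C * x" 
    proof -
      have "0 \<le> real n * pi / C * x" using that by simp
      then show ?thesis using pi_gt_zero by linarith
    qed
  qed
  have pos: "cosprod k x \<noteq> 0" if "x \<in> box 0 (a, b)" for x
  proof -
    have "0 < x \<bullet> (1, 0)" "x \<bullet> (1, 0) < a" "0 < x \<bullet> (0, 1)" "x \<bullet> (0, 1) < b"
      using that by (auto simp: box_def Basis_prod_def zero_prod_def)
    then have "cosprod k x > 0"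
      unfolding cosprod_def a_def b_def using AB by (intro mult_pos_pos cos_pos) auto
    then show ?thesis by simp
  qed
  have "box 0 (a, b) \<subseteq> S" using ab by (auto simp: box_def Basis_prod_def zero_prod_def S_def)
  then have "AE x in lborel. x \<notin> box 0 (a, b)"
    using ae by (auto elim!: eventually_mono dest: pos)
  then have "box 0 (a, b) \<in> null_sets lborel" by (subst AE_iff_null_sets) auto
  then show False using ab by (auto simp: null_sets_def emeasure_lborel_box_eq Basis_prod_def zero_prod_def)
qed

lemma rect_mult_integrable:
  assumes g: "g \<in> borel_measurable borel" "set_integrable lborel S g" and h: "continuous_on UNIV h"
  shows "set_integrable lborel S (\<lambda>z. g z * h z :: real)"
proof -
  have "bounded (h ` ({0..A} \<times> {0..B}))"
    using h by (intro compact_imp_bounded compact_continuous_image compact_Times) (auto intro: continuous_on_subset)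
  then obtain C where C: "\<forall>z\<in>{0..A} \<times> {0..B}. \<bar>h z\<bar> \<le> C" by (auto simp: bounded_iff)
  have "S \<subseteq> {0..A} \<times> {0..B}" by (auto simp: S_def)
  then have "\<bar>g z * h z\<bar> \<le> \<bar>g z * C\<bar>" if "z \<in> S" for z
    unfolding abs_mult using C that by (intro mult_left_mono) force+
  then have le: "AE z in lborel. z \<in> S \<longrightarrow> norm (g z * h z) \<le> norm (g z * C)" by auto
  note [measurable] = g(1) continuous_real_measurable[OF h] rect_borel
  show ?thesis
  proof (rule set_integrable_bound[OF _ _ le])
    show "set_integrable lborel S (\<lambda>z. g z * C)" using g by simp
    show "set_borel_measurable lborel S (\<lambda>z. g z * h z)" by (simp add: set_borel_measurable_def)
  qed
qed

text \<open>The integrable functions that are orthogonal to all products of cosines. Multiplication by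
  \<open>cos (\<pi> x / A)\<close> or \<open>cos (\<pi> y / B)\<close> maps this set to itself, since a product of cosines is a half sum
  of cosines.\<close>

definition cos_annihilator :: "(real \<times> real \<Rightarrow> real) set" where
  "cos_annihilator = {g \<in> borel_measurable borel. set_integrable lborel S g \<and>
     (\<forall>k. (LINT z:S|lborel. g z * cosprod k z) = 0)}"

lemma cos_annihilator_add:
  assumes "g \<in> cos_annihilator" "h \<in> cos_annihilator"
  shows "(\<lambda>z. g z + h z) \<in> cos_annihilator"
proof -
  have *: "set_integrable lborel S (\<lambda>z. g z * cosprod k z)" "set_integrable lborel S (\<lambda>z. h z * cosprod k z)" for k
    using assms by (auto simp: cos_annihilator_def intro!: rect_mult_integrable cosprod_continuous)
  show ?thesis
    using assms set_integral_add(2)[OF *] by (auto simp: cos_annihilator_def distrib_right)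
qed

lemma cosprod_product:
  "cos (pi / A * (z \<bullet> (1, 0))) * cosprod k z
    = (cosprod (Suc (fst k), snd k) z + cosprod (if fst k = 0 then (1, snd k) else (fst k - 1, snd k)) z) / 2"
  "cos (pi / B * (z \<bullet> (0, 1))) * cosprod k z
    = (cosprod (fst k, Suc (snd k)) z + cosprod (if snd k = 0 then (fst k, 1) else (fst k, snd k - 1)) z) / 2"
proof -
  have *: "cos (pi / C * x) * cos (real m * pi / C * x)
      = (cos (real (Suc m) * pi / C * x) + cos (real (if m = 0 then 1 else m - 1) * pi / C * x)) / 2" for m C x
  proof (cases m)
    case (Suc n)
    have "cos (real m * pi / C * x) * cos (pi / C * x)
      = (cos (real m * pi / C * x - pi / C * x) + cos (real m * pi / C * x + pi / C * x)) / 2"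
      by (rule cos_times_cos)
    moreover have "real m * pi / C * x - pi / C * x = real n * pi / C * x" "real m * pi / C * x + pi / C * x = real (Suc m) * pi / C * x"
      by (simp_all add: Suc add_divide_distrib distrib_right)
    ultimately show ?thesis using Suc by (simp add: mult.commute)
  qed simp
  show "cos (pi / A * (z \<bullet> (1, 0))) * cosprod k z
    = (cosprod (Suc (fst k), snd k) z + cosprod (if fst k = 0 then (1, snd k) else (fst k - 1, snd k)) z) / 2"
  proof -
    have e: "cos (pi / A * (z \<bullet> (1, 0))) * cosprod k z
      = (cos (pi / A * (z \<bullet> (1, 0))) * cos (real (fst k) * pi / A * (z \<bullet> (1, 0)))) * cos (real (snd k) * pi / B * (z \<bullet> (0, 1)))"
      by (simp only: cosprod_def mult_ac)
    show ?thesis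
      unfolding e *[of A "z \<bullet> (1, 0)" "fst k"]
      by (cases "fst k = 0") (simp_all add: cosprod_def distrib_right distrib_left mult.commute)
  qed
  show "cos (pi / B * (z \<bullet> (0, 1))) * cosprod k z
    = (cosprod (fst k, Suc (snd k)) z + cosprod (if snd k = 0 then (fst k, 1) else (fst k, snd k - 1)) z) / 2"
  proof -
    have e: "cos (pi / B * (z \<bullet> (0, 1))) * cosprod k z
      = (cos (pi / B * (z \<bullet> (0, 1))) * cos (real (snd k) * pi / B * (z \<bullet> (0, 1)))) * cos (real (fst k) * pi / A * (z \<bullet> (1, 0)))"
      by (simp only: cosprod_def mult_ac)
    show ?thesis
      unfolding e *[of B "z \<bullet> (0, 1)" "snd k"]
      by (cases "snd k = 0") (simp_all add: cosprod_def distrib_right distrib_left mult.commute)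
  qed
qed

lemma cos_annihilator_cos:
  assumes g: "g \<in> cos_annihilator" and c: "continuous_on UNIV c"
    and prod: "\<And>k z. c z * cosprod k z = (cosprod (r k) z + cosprod (r' k) z) / 2"
  shows "(\<lambda>z. g z * c z) \<in> cos_annihilator"
proof -
  note [measurable] = continuous_real_measurable[OF c]
  have gm: "g \<in> borel_measurable borel" "set_integrable lborel S g" using g by (auto simp: cos_annihilator_def)
  have *: "set_integrable lborel S (\<lambda>z. (1/2) * (g z * cosprod k z))" for k
    using rect_mult_integrable[OF gm cosprod_continuous] by simp
  have "(LINT z:S|lborel. (g z * c z) * cosprod k z)
      = (LINT z:S|lborel. (1/2) * (g z * cosprod (r k) z) + (1/2) * (g z * cosprod (r' k) z))" for k
  proof (rule set_lebesgue_integral_cong)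
    have "(g z * c z) * cosprod k z = g z * (c z * cosprod k z)" for z by simp
    then show "\<forall>z. z \<in> S \<longrightarrow> (g z * c z) * cosprod k z = (1/2) * (g z * cosprod (r k) z) + (1/2) * (g z * cosprod (r' k) z)"
      unfolding prod by (auto simp: algebra_simps add_divide_distrib)
  qed (use rect_borel in simp)
  also have "\<dots> k = (1/2) * (LINT z:S|lborel. g z * cosprod (r k) z) + (1/2) * (LINT z:S|lborel. g z * cosprod (r' k) z)" for k
    unfolding set_integral_add(2)[OF * *] set_integral_mult_right ..
  also have "\<dots> k = 0" for k
  proof -
    have "(LINT z:S|lborel. g z * cosprod j z) = 0" for j using g unfolding cos_annihilator_def by blast
    then show ?thesis by simp
  qed
  finally show ?thesis
    using gm rect_mult_integrable[OF gm c] by (simp add: cos_annihilator_def)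
qed

text \<open>The continuous functions whose multiples of annihilating functions are again annihilating form a
  point-separating algebra, hence a uniformly dense one. So an annihilating function is orthogonal
  to all continuous functions, in particular to all test functions.\<close>

lemma cos_annihilator_AE_eq_0:
  assumes f: "f \<in> cos_annihilator"
  shows "AE z in lborel. z \<in> S \<longrightarrow> f z = 0"
proof (rule AE_eq_0_if_test_integrals_eq_0[OF rect_open])
  have fm: "f \<in> borel_measurable borel" "set_integrable lborel S f" using f by (auto simp: cos_annihilator_def)
  show "set_integrable lborel K f" if "compact K" "K \<subseteq> S" for K
    using fm(2) by (rule set_integrable_subset) (use that in \<open>auto intro: borel_compact\<close>)
  define R where "R = {h. continuous_on UNIV h \<and> (\<forall>g\<in>cos_annihilator. (\<lambda>z. g z * h z) \<in> cos_annihilator)}"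
  define K where "K = {0..A} \<times> {0..B}"
  have R1: "(\<lambda>z. cos (pi / A * (z \<bullet> (1, 0)))) \<in> R"
    unfolding R_def mem_Collect_eq
    by (intro conjI ballI cos_annihilator_cos[OF _ _ cosprod_product(1)] continuous_intros)
  have R2: "(\<lambda>z. cos (pi / B * (z \<bullet> (0, 1)))) \<in> R"
    unfolding R_def mem_Collect_eq
    by (intro conjI ballI cos_annihilator_cos[OF _ _ cosprod_product(2)] continuous_intros)
  have "function_ring_on R K"
  proof
    show "compact K" unfolding K_def by (intro compact_Times compact_Icc)
    show "continuous_on K h" if "h \<in> R" for h using that by (auto simp: R_def intro: continuous_on_subset)
    show "(\<lambda>z. g z + h z) \<in> R" if "g \<in> R" "h \<in> R" for g h
      using that by (auto simp: R_def distrib_left intro!: continuous_intros cos_annihilator_add)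
    show "(\<lambda>z. g z * h z) \<in> R" if "g \<in> R" "h \<in> R" for g h
    proof -
      have "(\<lambda>z. f z * (g z * h z)) \<in> cos_annihilator" if f: "f \<in> cos_annihilator" for f
      proof -
        have "(\<lambda>z. f z * g z) \<in> cos_annihilator" using f \<open>g \<in> R\<close> by (simp add: R_def)
        moreover have "\<forall>g\<in>cos_annihilator. (\<lambda>z. g z * h z) \<in> cos_annihilator"
          using \<open>h \<in> R\<close> by (simp add: R_def)
        ultimately have "(\<lambda>z. (f z * g z) * h z) \<in> cos_annihilator" by (rule bspec[rotated])
        then show ?thesis by (simp only: mult.assoc)
      qed
      then show ?thesis using that by (auto simp: R_def intro!: continuous_intros)
    qed
    show "(\<lambda>_. c) \<in> R" for c
    proof -
      have "(\<lambda>z. g z * c) \<in> cos_annihilator" if "g \<in> cos_annihilator" for g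
      proof -
        have "(LINT z:S|lborel. g z * c * cosprod k z) = c * (LINT z:S|lborel. g z * cosprod k z)" for k
          by (subst set_integral_mult_right[symmetric], rule set_lebesgue_integral_cong) (use rect_borel in auto)
        then show ?thesis using that by (auto simp: cos_annihilator_def)
      qed
      then show ?thesis by (simp add: R_def)
    qed
    fix x y assume xy: "x \<in> K" "y \<in> K" "x \<noteq> y"
    have inj: "u = v" if "cos (pi / C * u) = cos (pi / C * v)" "0 \<le> u" "u \<le> C" "0 \<le> v" "v \<le> C" "C > 0" for u v C
    proof -
      have "pi / C * u = pi / C * v"
      proof (rule cos_inj_pi)
        have "pi / C * t \<le> pi / C * C" if "t \<le> C" for t
          using that \<open>C > 0\<close> by (intro mult_left_mono) auto
        then show "pi / C * u \<le> pi" "pi / C * v \<le> pi" using that(3,5,6) by simp_all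
      qed (use that(1) that(2,4,6) in simp_all)
      then show ?thesis using that by simp
    qed
    show "\<exists>h\<in>R. h x \<noteq> h y"
    proof (rule ccontr)
      assume "\<not> (\<exists>h\<in>R. h x \<noteq> h y)"
      then have all: "h x = h y" if "h \<in> R" for h using that by blast
      have "cos (pi / A * fst x) = cos (pi / A * fst y)" "cos (pi / B * snd x) = cos (pi / B * snd y)"
        using all[OF R1] all[OF R2] by (simp_all add: inner_prod_def)
      moreover have "0 \<le> fst x" "fst x \<le> A" "0 \<le> fst y" "fst y \<le> A" "0 \<le> snd x" "snd x \<le> B" "0 \<le> snd y" "snd y \<le> B"
        using xy by (auto simp: K_def)
      ultimately have "fst x = fst y" "snd x = snd y"
        using inj[OF _ _ _ _ _ AB(1)] inj[OF _ _ _ _ _ AB(2)] by blast+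
      then show False using xy(3) by (simp add: prod_eq_iff)
    qed
  qed
  then interpret function_ring_on R K .
  fix \<phi> assume "test_function S \<phi>"
  then have cont\<phi>: "continuous_on UNIV \<phi>" by (rule test_function_continuous)
  define I where "I = (LINT z:S|lborel. \<bar>f z\<bar>)"
  have I: "I \<ge> 0" unfolding I_def set_lebesgue_integral_def by (intro integral_nonneg_AE) auto
  have "\<bar>LINT z:S|lborel. f z * \<phi> z\<bar> \<le> e * I" if "e > 0" for e
  proof -
    obtain h where h: "h \<in> R" "\<forall>z\<in>K. \<bar>\<phi> z - h z\<bar> < e"
      using Stone_Weierstrass_basic[OF continuous_on_subset[OF cont\<phi>] \<open>e > 0\<close>] by auto
    have conth: "continuous_on UNIV h" using h by (simp add: R_def)
    have "(\<lambda>z. f z * h z) \<in> cos_annihilator" using h(1) f by (simp add: R_def)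
    then have "(LINT z:S|lborel. f z * h z * cosprod (0, 0) z) = 0" by (simp add: cos_annihilator_def)
    \<comment> \<open>the product with index \<open>(0, 0)\<close> is the constant function one\<close>
    then have fh: "(LINT z:S|lborel. f z * h z) = 0" by (simp add: cosprod_def)
    have diff: "(LINT z:S|lborel. f z * \<phi> z) = (LINT z:S|lborel. f z * (\<phi> z - h z))"
      using rect_mult_integrable[OF fm cont\<phi>] rect_mult_integrable[OF fm conth] fh by (simp add: right_diff_distrib)
    have int: "set_integrable lborel S (\<lambda>z. f z * (\<phi> z - h z))"
      using cont\<phi> conth by (intro rect_mult_integrable fm continuous_intros)
    have "\<bar>LINT z:S|lborel. f z * (\<phi> z - h z)\<bar> \<le> (LINT z:S|lborel. \<bar>f z * (\<phi> z - h z)\<bar>)"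
      using set_integral_norm_bound[OF int] by simp
    also have "\<dots> \<le> (LINT z:S|lborel. e * \<bar>f z\<bar>)"
    proof (rule set_integral_mono)
      show "set_integrable lborel S (\<lambda>z. \<bar>f z * (\<phi> z - h z)\<bar>)" using int by (rule set_integrable_abs)
      show "set_integrable lborel S (\<lambda>z. e * \<bar>f z\<bar>)" using set_integrable_abs[OF fm(2)] by simp
      fix z assume "z \<in> S"
      then have "z \<in> K" by (auto simp: S_def K_def)
      then have "\<bar>\<phi> z - h z\<bar> \<le> e" using h(2) by fastforce
      then have "\<bar>f z\<bar> * \<bar>\<phi> z - h z\<bar> \<le> \<bar>f z\<bar> * e" by (intro mult_left_mono) auto
      then show "\<bar>f z * (\<phi> z - h z)\<bar> \<le> e * \<bar>f z\<bar>" by (simp add: abs_mult mult.commute)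
    qed
    finally show ?thesis by (simp add: diff I_def)
  qed
  note le = this
  show "(LINT z:S|lborel. f z * \<phi> z) = 0"
  proof (rule ccontr)
    assume nz: "(LINT z:S|lborel. f z * \<phi> z) \<noteq> 0"
    define d where "d = \<bar>LINT z:S|lborel. f z * \<phi> z\<bar>"
    have d: "d > 0" using nz by (simp add: d_def)
    have "d \<le> d / (2 * (I + 1)) * I" using le[of "d / (2 * (I + 1))"] d I by (simp add: d_def)
    also have "\<dots> < d" using d I by (simp add: field_simps) (simp add: add_nonneg_pos)
    finally show False by simp
  qed
qed

lemma cosprod_complete:
  assumes f: "f \<in> L2_space rect_measure" and orth: "\<And>k. (LINT x|rect_measure. f x * cosprod k x) = 0"
  shows "AE x in rect_measure. f x = 0"
proof -
  have [measurable]: "f \<in> borel_measurable borel"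
    using L2_spaceD(1)[OF f] by simp
  have "(\<lambda>_. 1) \<in> L2_space rect_measure"
    by (auto simp: L2_space_def rect_integrable intro!: rect_set_integrable_cont continuous_intros)
  from L2_space_mult_integrable[OF f this] have "integrable rect_measure f" by simp
  then have "set_integrable lborel S f" by (simp add: rect_integrable)
  moreover have "(LINT z:S|lborel. f z * cosprod k z) = 0" for k
    using orth[of k] by (subst (asm) rect_integral) auto
  ultimately have "f \<in> cos_annihilator" by (simp add: cos_annihilator_def)
  then show ?thesis by (simp add: rect_AE cos_annihilator_AE_eq_0)
qed

lemma finite_rect_eigenvalues: "finite {k. rect_eigenvalue k \<le> c}"
proof -
  define N where "N = nat \<lceil>\<bar>c\<bar> * (A\<^sup>2 + B\<^sup>2 + 1)\<rceil>"
  have le: "m \<le> N" if "(real m * pi / C)\<^sup>2 \<le> c" "C\<^sup>2 \<le> A\<^sup>2 + B\<^sup>2 + 1" "C > 0" for m C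
  proof -
    have "real m \<le> (real m)\<^sup>2" by (cases m) (auto simp: power2_eq_square)
    also have "\<dots> \<le> (real m * pi)\<^sup>2"
      unfolding power_mult_distrib using pi_gt3 by (simp add: power2_eq_square mult_le_cancel_left1 mult_ge1_I)
    also have "\<dots> = (real m * pi / C)\<^sup>2 * C\<^sup>2" using that by (simp add: power_divide)
    also have "\<dots> \<le> \<bar>c\<bar> * (A\<^sup>2 + B\<^sup>2 + 1)" using that by (intro mult_mono) auto
    finally show ?thesis unfolding N_def by linarith
  qed
  have "{k. rect_eigenvalue k \<le> c} \<subseteq> {..N} \<times> {..N}"
  proof
    fix k assume "k \<in> {k. rect_eigenvalue k \<le> c}"
    then have "(real (fst k) * pi / A)\<^sup>2 \<le> c" "(real (snd k) * pi / B)\<^sup>2 \<le> c"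
      unfolding rect_eigenvalue_def using zero_le_power2 by (smt (verit) mem_Collect_eq)+
    then have "fst k \<le> N" "snd k \<le> N" using le AB by auto
    then show "k \<in> {..N} \<times> {..N}" by (simp add: mem_Times_iff)
  qed
  then show ?thesis by (rule finite_subset) simp
qed

text \<open>If the short side is short enough, the values up to \<open>(k\<pi>/A)\<^sup>2\<close> are those with index \<open>(m, 0)\<close>, where
  \<open>m \<le> k\<close>. This fixes the \<open>k\<close>-th member of any increasing enumeration.\<close>

lemma rect_neumann_eigenvalue:
  assumes short: "real k * B < A"
  shows "neumann_eigenvalue S k = (real k * pi / A)\<^sup>2"
proof -
  have "infinite (UNIV :: (nat \<times> nat) set)" by (simp add: finite_prod)
  then obtain \<beta> where \<beta>: "bij_betw \<beta> (UNIV :: nat set) (UNIV :: (nat \<times> nat) set)" "mono (\<lambda>k. rect_eigenvalue (\<beta> k))"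
    using ex_increasing_enumeration[of UNIV rect_eigenvalue] finite_rect_eigenvalues by auto
  have fin: "finite {k \<in> UNIV. rect_eigenvalue k = \<mu>}" for \<mu>
    using finite_rect_eigenvalues[of \<mu>] by (rule rev_finite_subset) auto
  have eig: "neumann_eigenvalue S k = rect_eigenvalue (\<beta> k)" for k
    unfolding neumann_eigenvalue_def
  proof (rule weighted_neumann_eigenvalue_eqI[OF \<beta> fin])
    show "has_dim_AE rect_measure (eigenspace S (\<lambda>_. 1) \<mu>) (card {k \<in> UNIV. rect_eigenvalue k = \<mu>})" for \<mu>
      by (rule has_dim_AE_eigenspace_complete[OF refl cosprod_form_domain cosprod_energy cosprod_orthogonal
            cosprod_norm_nonzero cosprod_complete fin]) auto
  qed
  let ?c = "(real k * pi / A)\<^sup>2"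
  have \<beta>_card: "card {j. P (\<beta> j)} = card {i. P i}" for P
  proof (rule bij_betw_same_card)
    show "bij_betw \<beta> {j. P (\<beta> j)} {i. P i}"
      unfolding bij_betw_def
    proof
      show "inj_on \<beta> {j. P (\<beta> j)}"
        using bij_betw_imp_inj_on[OF \<beta>(1)] by (rule inj_on_subset) simp
      have "i \<in> \<beta> ` {j. P (\<beta> j)}" if "P i" for i
      proof -
        obtain j where "i = \<beta> j" using bij_betw_imp_surj_on[OF \<beta>(1)] by (metis UNIV_I imageE)
        then show ?thesis using that by simp
      qed
      then show "\<beta> ` {j. P (\<beta> j)} = {i. P i}" by auto
    qed
  qed
  have small: "i \<in> (\<lambda>m. (m, 0)) ` {m. rect_eigenvalue (m, 0) \<le> ?c}" if "rect_eigenvalue i \<le> ?c" for i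
  proof -
    have "snd i = 0"
    proof (rule ccontr)
      assume "snd i \<noteq> 0"
      then have "1 \<le> real (snd i)" by simp
      have "real k * pi / A < pi / B" using short AB by (simp add: field_simps)
      also have "pi / B \<le> real (snd i) * pi / B"
        using \<open>1 \<le> real (snd i)\<close> AB by (intro divide_right_mono) auto
      finally have "?c < (real (snd i) * pi / B)\<^sup>2" using AB by (intro power_strict_mono) auto
      also have "\<dots> \<le> rect_eigenvalue i" by (simp add: rect_eigenvalue_def)
      finally show False using that by simp
    qed
    then have "i = (fst i, 0)" by (simp add: prod_eq_iff)
    then show ?thesis using that by (metis (mono_tags, lifting) image_eqI mem_Collect_eq)
  qed
  have row: "rect_eigenvalue (m, 0) \<le> ?c \<longleftrightarrow> m \<le> k" "rect_eigenvalue (m, 0) < ?c \<longleftrightarrow> m < k" for m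
  proof -
    have "real m * pi / A \<le> real k * pi / A \<longleftrightarrow> m \<le> k" "real m * pi / A < real k * pi / A \<longleftrightarrow> m < k"
      using AB by (auto simp: divide_le_cancel divide_less_cancel)
    moreover have "rect_eigenvalue (m, 0) = (real m * pi / A)\<^sup>2" by (simp add: rect_eigenvalue_def)
    moreover have "0 \<le> real m * pi / A" "0 \<le> real k * pi / A" using AB by auto
    ultimately show "rect_eigenvalue (m, 0) \<le> ?c \<longleftrightarrow> m \<le> k" "rect_eigenvalue (m, 0) < ?c \<longleftrightarrow> m < k"
      by (simp_all only: power_mono_iff linorder_not_le[symmetric] zero_less_numeral)
  qed
  have inj: "inj_on (\<lambda>m. (m, 0::nat)) X" for X :: "nat set" by (auto simp: inj_on_def)
  have le: "{i. rect_eigenvalue i \<le> ?c} = (\<lambda>m. (m, 0)) ` {..k}"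
    using small row(1) by (auto simp: atMost_def)
  have lt: "{i. rect_eigenvalue i < ?c} = (\<lambda>m. (m, 0)) ` {..<k}"
  proof
    show "{i. rect_eigenvalue i < ?c} \<subseteq> (\<lambda>m. (m, 0)) ` {..<k}"
    proof
      fix i assume i: "i \<in> {i. rect_eigenvalue i < ?c}"
      then obtain m where "i = (m, 0)" using small[of i] by auto
      then show "i \<in> (\<lambda>m. (m, 0)) ` {..<k}" using i row(2) by auto
    qed
  qed (use row(2) in auto)
  have card_le: "card {j. rect_eigenvalue (\<beta> j) \<le> ?c} = Suc k"
    unfolding \<beta>_card[of "\<lambda>i. rect_eigenvalue i \<le> ?c"] le by (simp add: card_image inj)
  have card_lt: "card {j. rect_eigenvalue (\<beta> j) < ?c} = k"
    unfolding \<beta>_card[of "\<lambda>i. rect_eigenvalue i < ?c"] lt by (simp add: card_image inj)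
  have "\<not> rect_eigenvalue (\<beta> k) < ?c"
  proof
    assume less: "rect_eigenvalue (\<beta> k) < ?c"
    have "{..k} \<subseteq> {j. rect_eigenvalue (\<beta> j) < ?c}"
      using less monoD[OF \<beta>(2), of _ k] by (auto intro: le_less_trans)
    moreover have "finite {j. rect_eigenvalue (\<beta> j) < ?c}" 
    proof (rule finite_subset)
      show "finite (\<beta> -` {i. rect_eigenvalue i \<le> ?c})"
        using finite_rect_eigenvalues bij_betw_imp_inj_on[OF \<beta>(1)] by (rule finite_vimageI)
    qed auto
    ultimately have "card {..k} \<le> k" using card_lt card_mono by metis
    then show False by simp
  qed
  moreover have "\<not> ?c < rect_eigenvalue (\<beta> k)"
  proof
    assume less: "?c < rect_eigenvalue (\<beta> k)"
    have "{j. rect_eigenvalue (\<beta> j) \<le> ?c} \<subseteq> {..<k}"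
    proof
      fix j assume "j \<in> {j. rect_eigenvalue (\<beta> j) \<le> ?c}"
      then have "\<not> k \<le> j" using less monoD[OF \<beta>(2), of k j] by auto
      then show "j \<in> {..<k}" by simp
    qed
    then have "Suc k \<le> card {..<k}" unfolding card_le[symmetric] by (intro card_mono) auto
    then show False by simp
  qed
  ultimately show ?thesis using eig[of k] by simp
qed

end

section \<open>Bessel functions and their phase\<close>

text \<open>The coefficients of the Bessel-Clifford functions, with alternating sign.\<close>

definition clifford_coeff :: "nat \<Rightarrow> nat \<Rightarrow> real" where
  "clifford_coeff i n = (- 1) ^ n / (fact n * fact (n + i))"

text \<open>The entire function with \<open>J\<^sub>i(z) = (z / 2)\<^sup>i * clifford i (z\<^sup>2 / 4)\<close>. Differentiation raises the index
  and changes the sign.\<close>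

definition clifford :: "nat \<Rightarrow> real \<Rightarrow> real" where
  "clifford i t = (\<Sum>n. clifford_coeff i n * t ^ n)"

lemma clifford_coeff_bound: "\<bar>clifford_coeff i n * t ^ n\<bar> \<le> \<bar>t\<bar> ^ n / fact n"
proof -
  have "fact n * 1 \<le> fact n * (fact (n + i) :: real)"
    by (intro mult_left_mono) (auto simp: fact_ge_1)
  then show ?thesis
    by (simp add: clifford_coeff_def abs_mult power_abs divide_left_mono)
qed

lemma exp_sums_fact: "(\<lambda>n. x ^ n / fact n) sums exp (x::real)"
  using exp_converges[of x] by (simp add: divide_inverse mult.commute)

lemma clifford_summable: "summable (\<lambda>n. clifford_coeff i n * t ^ n)"
  by (rule summable_comparison_test'[OF sums_summable[OF exp_sums_fact[of "\<bar>t\<bar>"]], of 0])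
     (use clifford_coeff_bound in auto)

lemma clifford_sums: "(\<lambda>n. clifford_coeff i n * t ^ n) sums clifford i t"
  unfolding clifford_def using clifford_summable by (rule summable_sums)

lemma clifford_abs_le: "\<bar>clifford i t\<bar> \<le> exp \<bar>t\<bar>"
proof -
  have "norm (clifford i t) \<le> (\<Sum>n. \<bar>t\<bar> ^ n / fact n)"
    unfolding clifford_def
    by (rule norm_suminf_le)
       (use clifford_coeff_bound exp_sums_fact[of "\<bar>t\<bar>"] in \<open>auto simp: sums_iff\<close>)
  then show ?thesis using exp_sums_fact[of "\<bar>t\<bar>"] by (simp add: sums_iff)
qed

lemma clifford_at_0: "clifford i 0 = 1 / fact i"
  unfolding clifford_def using powser_zero[of "clifford_coeff i"] by (simp add: clifford_coeff_def)

lemma diffs_clifford_coeff: "diffs (clifford_coeff i) = (\<lambda>n. - clifford_coeff (Suc i) n)"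
proof
  fix n
  have "fact (Suc n) = real (Suc n) * fact n" by (rule fact_Suc)
  then show "diffs (clifford_coeff i) n = - clifford_coeff (Suc i) n"
    unfolding diffs_def clifford_coeff_def by (simp del: of_nat_Suc fact_Suc)
qed

lemma clifford_deriv: "(clifford i has_real_derivative - clifford (Suc i) t) (at t)"
proof -
  have "((\<lambda>x. \<Sum>n. clifford_coeff i n * x ^ n) has_real_derivative (\<Sum>n. diffs (clifford_coeff i) n * t ^ n)) (at t)"
    by (rule termdiffs_strong_converges_everywhere) (rule clifford_summable)
  moreover have "(\<Sum>n. diffs (clifford_coeff i) n * t ^ n) = - clifford (Suc i) t"
    unfolding diffs_clifford_coeff clifford_def using suminf_minus[OF clifford_summable[of "Suc i" t]] by simp
  ultimately show ?thesis by (simp add: clifford_def[abs_def])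
qed

lemma clifford_ode: "t * clifford 2 t = clifford 1 t - clifford 0 t"
proof -
  define g where "g n = (if n = 0 then 0 else clifford_coeff 2 (n - 1) * t ^ n)" for n
  have "(\<lambda>n. g (Suc n)) sums (t * clifford 2 t)"
    using sums_mult[OF clifford_sums[of 2 t], of t] by (simp add: g_def mult_ac)
  then have "g sums (t * clifford 2 t)"
    using sums_Suc_iff[of g] by (simp add: g_def)
  moreover have "(\<lambda>n. clifford_coeff 1 n * t ^ n - clifford_coeff 0 n * t ^ n) sums (clifford 1 t - clifford 0 t)"
    by (intro sums_diff clifford_sums)
  moreover have "g n = clifford_coeff 1 n * t ^ n - clifford_coeff 0 n * t ^ n" for n
  proof (cases n)
    case (Suc m)
    have "fact (Suc m) = real (Suc m) * fact m" "fact (Suc (Suc m)) = real (Suc (Suc m)) * (real (Suc m) * fact m)"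
      by (simp_all only: fact_Suc)
    moreover have "s / (F * (q * (p * F))) = s / ((p * F) * (p * F)) - s / ((p * F) * (q * (p * F)))"
      if "F \<noteq> 0" "p \<noteq> 0" "q \<noteq> 0" "q = p + 1" for s F p q :: real
      using that by (simp add: divide_simps) (simp add: algebra_simps)
    from this[of "fact m" "real (Suc m)" "real (Suc (Suc m))" "(- 1) ^ m * (t * t ^ m)"]
    have "(- 1) ^ m * (t * t ^ m) / (fact m * (real (Suc (Suc m)) * (real (Suc m) * fact m)))
      = (- 1) ^ m * (t * t ^ m) / ((real (Suc m) * fact m) * (real (Suc m) * fact m))
      - (- 1) ^ m * (t * t ^ m) / ((real (Suc m) * fact m) * (real (Suc (Suc m)) * (real (Suc m) * fact m)))"
      by simp
    ultimately show ?thesis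
      by (simp add: Suc g_def clifford_coeff_def numeral_2_eq_2 del: fact_Suc of_nat_Suc)
  qed (simp add: g_def clifford_coeff_def)
  ultimately show ?thesis using sums_unique2 by (metis (no_types, lifting) ext)
qed

text \<open>The Bessel functions of order zero and one, and the entire function \<open>J1 z / z\<close>.\<close>

definition J0 :: "real \<Rightarrow> real" where "J0 z = clifford 0 (z\<^sup>2 / 4)"
definition J1 :: "real \<Rightarrow> real" where "J1 z = z / 2 * clifford 1 (z\<^sup>2 / 4)"
definition J1_quotient :: "real \<Rightarrow> real" where "J1_quotient z = clifford 1 (z\<^sup>2 / 4) / 2"

lemma J1_eq: "J1 z = z * J1_quotient z" by (simp add: J1_def J1_quotient_def)

lemma J0_deriv: "(J0 has_real_derivative - J1 z) (at z)"
  unfolding J0_def[abs_def] J1_def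
proof -
  have "((\<lambda>z. z\<^sup>2 / 4) has_real_derivative z / 2) (at z)"
    by (auto intro!: derivative_eq_intros)
  from DERIV_chain2[OF clifford_deriv this, of 0]
  show "((\<lambda>z. clifford 0 (z\<^sup>2 / 4)) has_real_derivative - (z / 2 * clifford 1 (z\<^sup>2 / 4))) (at z)"
    by (simp add: mult.commute)
qed

lemma J1_deriv: "(J1 has_real_derivative J0 z - J1_quotient z) (at z)"
  unfolding J1_def[abs_def] J0_def J1_quotient_def
  using clifford_ode[of "z\<^sup>2/4"]
  by (auto intro!: derivative_eq_intros DERIV_chain2[OF clifford_deriv] simp: field_simps power2_eq_square numeral_2_eq_2)

lemma J0_0: "J0 0 = 1" and J1_0: "J1 0 = 0"
  by (simp_all add: J0_def J1_def clifford_at_0)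

lemma isCont_J: "isCont J0 z" "isCont J1 z" "isCont J1_quotient z"
proof -
  show "isCont J0 z" "isCont J1 z" using J0_deriv J1_deriv DERIV_isCont by blast+
  have c: "isCont (clifford 1) t" for t using clifford_deriv DERIV_isCont by blast
  show "isCont J1_quotient z"
    unfolding J1_quotient_def[abs_def] by (intro continuous_intros isCont_o2[OF _ c]) simp_all
qed

text \<open>The squared length of the vector \<open>(J0 z, J1 z)\<close>.\<close>

definition bessel_norm2 :: "real \<Rightarrow> real" where "bessel_norm2 z = (J0 z)\<^sup>2 + (J1 z)\<^sup>2"

text \<open>The Bessel functions have no common zero: \<open>z\<^sup>2 (J0\<^sup>2 + J1\<^sup>2)\<close> has derivative \<open>2 z J0\<^sup>2\<close>.\<close>

lemma bessel_norm2_pos: "bessel_norm2 z > 0"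
proof -
  have pos: "bessel_norm2 z > 0" if z: "z > 0" for z
  proof -
    have "eventually (\<lambda>y. J0 y > 0) (at_right 0)"
      using isCont_J(1)[of 0] J0_0
      by (auto simp: continuous_at intro!: order_tendstoD(1)[of J0 1] tendsto_mono[OF at_le[of "{0<..}" UNIV]])
    then obtain b where b: "b > 0" "\<And>y. 0 < y \<Longrightarrow> y < b \<Longrightarrow> J0 y > 0"
      by (auto simp: eventually_at_right_field)
    define y where "y = min (b/2) z"
    have y: "0 < y" "y \<le> z" "J0 y > 0" using b z by (auto simp: y_def)
    have "y\<^sup>2 * bessel_norm2 y \<le> z\<^sup>2 * bessel_norm2 z"
    proof (rule DERIV_nonneg_imp_nondecreasing[OF y(2)])
      fix x assume "y \<le> x" "x \<le> z"
      have "((\<lambda>x. x\<^sup>2 * bessel_norm2 x) has_real_derivative 2 * x * (J0 x)\<^sup>2) (at x)"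
        unfolding bessel_norm2_def
        by (rule derivative_eq_intros J0_deriv J1_deriv refl)+
           (simp add: J1_eq power2_eq_square algebra_simps)
      moreover have "2 * x * (J0 x)\<^sup>2 \<ge> 0" using y \<open>y \<le> x\<close> by simp
      ultimately show "\<exists>d. ((\<lambda>x. x\<^sup>2 * bessel_norm2 x) has_real_derivative d) (at x) \<and> 0 \<le> d" by blast
    qed
    moreover have "y\<^sup>2 * bessel_norm2 y > 0"
      using y by (auto simp: bessel_norm2_def intro!: mult_pos_pos add_pos_nonneg)
    ultimately have "z\<^sup>2 * bessel_norm2 z > 0" by linarith
    then show ?thesis using z by (simp add: zero_less_mult_iff)
  qed
  have even: "bessel_norm2 (- z) = bessel_norm2 z" by (simp add: bessel_norm2_def J0_def J1_def)
  consider "z > 0" | "z = 0" | "z < 0" by linarith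
  then show ?thesis
  proof cases
    case 3
    then show ?thesis using pos[of "- z"] even by simp
  next
    case 2
    then show ?thesis by (simp add: bessel_norm2_def J0_0 J1_0)
  qed (rule pos)
qed

text \<open>The derivative of the polar angle of \<open>(J0 z, J1 z)\<close>. Division by zero does not occur, as
  \<open>J1_quotient\<close> is entire and the norm is positive.\<close>

definition phase_speed :: "real \<Rightarrow> real" where
  "phase_speed z = 1 - J0 z * J1_quotient z / bessel_norm2 z"

lemma isCont_phase_speed: "isCont phase_speed z"
proof -
  have "(J0 z)\<^sup>2 + (J1 z)\<^sup>2 \<noteq> 0" using bessel_norm2_pos[of z] unfolding bessel_norm2_def by linarith
  then show ?thesis
    unfolding phase_speed_def[abs_def] bessel_norm2_def by (intro continuous_intros isCont_J)
qed

text \<open>The polar angle of \<open>(J0 z, J1 z)\<close>, normalised to zero at the origin; being an antiderivative of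
  \<open>phase_speed\<close>, it has no jumps.\<close>

definition bessel_phase :: "real \<Rightarrow> real" where
  "bessel_phase = (SOME \<theta>. \<theta> 0 = 0 \<and> (\<forall>z. (\<theta> has_real_derivative phase_speed z) (at z)))"

lemma bessel_phase_0: "bessel_phase 0 = 0"
  and bessel_phase_deriv: "(bessel_phase has_real_derivative phase_speed z) (at z)"
proof -
  obtain F where F: "\<And>x. (F has_vector_derivative phase_speed x) (at x)"
    using einterval_antiderivative[of "-\<infinity>" "\<infinity>" phase_speed] isCont_phase_speed by auto
  have "\<exists>\<theta>. \<theta> 0 = 0 \<and> (\<forall>z. (\<theta> has_real_derivative phase_speed z) (at z))"
    using F by (intro exI[of _ "\<lambda>z. F z - F 0"])
      (auto intro!: derivative_eq_intros simp: has_real_derivative_iff_has_vector_derivative[symmetric])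
  from someI_ex[OF this]
  show "bessel_phase 0 = 0" "(bessel_phase has_real_derivative phase_speed z) (at z)"
    unfolding bessel_phase_def by auto
qed

text \<open>In the rotating frame of \<open>bessel_phase\<close> the normal component \<open>A\<close> of \<open>(J0, J1)\<close> solves a linear
  equation that damps it to the right, so it stays zero; the tangential component \<open>B\<close> then has no
  zero and stays positive.\<close>

lemma bessel_polar:
  assumes "z \<ge> 0"
  obtains R where "R > 0" "J0 z = R * cos (bessel_phase z)" "J1 z = R * sin (bessel_phase z)"
proof -
  define A where "A y = J0 y * sin (bessel_phase y) - J1 y * cos (bessel_phase y)" for y
  define B where "B y = J0 y * cos (bessel_phase y) + J1 y * sin (bessel_phase y)" for y
  have dA: "(A has_real_derivative - (J1 y * J1_quotient y / bessel_norm2 y) * A y) (at y)" for y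
  proof -
    have "(A has_real_derivative (- J1 y) * sin (bessel_phase y) + J0 y * (cos (bessel_phase y) * phase_speed y)
       - ((J0 y - J1_quotient y) * cos (bessel_phase y) + J1 y * (- sin (bessel_phase y) * phase_speed y))) (at y)"
      unfolding A_def[abs_def]
      by (rule derivative_eq_intros J0_deriv J1_deriv bessel_phase_deriv refl)+ (simp add: algebra_simps)
    moreover have "(- J1 y) * sin (bessel_phase y) + J0 y * (cos (bessel_phase y) * phase_speed y)
       - ((J0 y - J1_quotient y) * cos (bessel_phase y) + J1 y * (- sin (bessel_phase y) * phase_speed y))
       = - (J1 y * J1_quotient y / bessel_norm2 y) * A y"
      using bessel_norm2_pos[of y] unfolding phase_speed_def A_def
      by (simp add: field_simps) (simp add: bessel_norm2_def power2_eq_square algebra_simps)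
    ultimately show ?thesis by simp
  qed
  have A0: "A 0 = 0" by (simp add: A_def bessel_phase_0 J1_0)
  have A: "A y = 0" if "y \<ge> 0" for y
  proof -
    have "(A y)\<^sup>2 \<le> (A 0)\<^sup>2"
    proof (rule DERIV_nonpos_imp_nonincreasing[OF that])
      fix x assume "0 \<le> x" "x \<le> y"
      have "((\<lambda>x. (A x)\<^sup>2) has_real_derivative - (2 * x * (J1_quotient x)\<^sup>2 / bessel_norm2 x * (A x)\<^sup>2)) (at x)"
        by (rule derivative_eq_intros dA refl)+ (simp add: J1_eq power2_eq_square)
      moreover have "- (2 * x * (J1_quotient x)\<^sup>2 / bessel_norm2 x * (A x)\<^sup>2) \<le> 0"
        using bessel_norm2_pos[of x] \<open>0 \<le> x\<close> by simp
      ultimately show "\<exists>d. ((\<lambda>x. (A x)\<^sup>2) has_real_derivative d) (at x) \<and> d \<le> 0" by blast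
    qed
    then show ?thesis by (simp add: A0)
  qed
  have AB: "(A y)\<^sup>2 + (B y)\<^sup>2 = bessel_norm2 y" for y
  proof -
    have "(A y)\<^sup>2 + (B y)\<^sup>2 = ((J0 y)\<^sup>2 + (J1 y)\<^sup>2) * ((sin (bessel_phase y))\<^sup>2 + (cos (bessel_phase y))\<^sup>2)"
      unfolding A_def B_def by algebra
    then show ?thesis by (simp add: bessel_norm2_def)
  qed
  have B0: "B y \<noteq> 0" if "y \<ge> 0" for y
    using AB[of y] A[OF that] bessel_norm2_pos[of y] by auto
  have "B z > 0"
  proof (rule ccontr)
    assume "\<not> B z > 0"
    moreover have "continuous_on {0..z} B"
      unfolding B_def[abs_def]
      by (intro continuous_intros continuous_at_imp_continuous_on ballI isCont_J DERIV_isCont[OF bessel_phase_deriv])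
    moreover have "B 0 = 1" by (simp add: B_def bessel_phase_0 J0_0)
    ultimately obtain y where "0 \<le> y" "y \<le> z" "B y = 0"
      using IVT2'[of B z 0 0] assms by auto
    then show False using B0 by blast
  qed
  moreover have "J0 z = B z * cos (bessel_phase z)" "J1 z = B z * sin (bessel_phase z)"
  proof -
    have sc: "(sin (bessel_phase z))\<^sup>2 + (cos (bessel_phase z))\<^sup>2 = 1" by simp
    have "J0 z = B z * cos (bessel_phase z) + A z * sin (bessel_phase z)"
      using sc unfolding A_def B_def by algebra
    moreover have "J1 z = B z * sin (bessel_phase z) - A z * cos (bessel_phase z)"
      using sc unfolding A_def B_def by algebra
    ultimately show "J0 z = B z * cos (bessel_phase z)" "J1 z = B z * sin (bessel_phase z)"
      using A[OF assms] by simp_all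
  qed
  ultimately show ?thesis using that by blast
qed

lemma clifford_near_0:
  assumes "0 \<le> t" "t \<le> 1/16"
  shows "\<bar>clifford 0 t - 1\<bar> \<le> 2 * t" "\<bar>clifford 1 t - 1\<bar> \<le> 2 * t"
proof -
  have "\<bar>clifford i t - 1 / fact i\<bar> \<le> 2 * t" for i
  proof (cases "t = 0")
    case False
    then obtain s where s: "0 < s" "s < t" "clifford i t - clifford i 0 = (t - 0) * (- clifford (Suc i) s)"
      using MVT2[of 0 t "clifford i" "\<lambda>s. - clifford (Suc i) s"] clifford_deriv assms by force
    have "\<bar>clifford (Suc i) s\<bar> \<le> exp \<bar>s\<bar>" by (rule clifford_abs_le)
    also have "\<dots> \<le> 1 + s + s\<^sup>2" using s assms exp_bound[of s] by simp
    also have "s\<^sup>2 \<le> s * 1" using s assms unfolding power2_eq_square by (intro mult_left_mono) auto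
    finally have "\<bar>clifford (Suc i) s\<bar> \<le> 2" using s assms by simp
    then show ?thesis using s assms by (simp add: clifford_at_0 abs_mult mult.commute mult_left_mono)
  qed (simp add: clifford_at_0)
  from this[of 0] this[of 1]
  show "\<bar>clifford 0 t - 1\<bar> \<le> 2 * t" "\<bar>clifford 1 t - 1\<bar> \<le> 2 * t" by simp_all
qed

text \<open>For \<open>z \<le> 1/2\<close> the estimates near zero give \<open>J1 z / z \<le> 9/16 < J0 z\<close>. For larger \<open>z\<close> the inequality
  \<open>2 * J0 z * J1 z \<le> bessel_norm2 z\<close> suffices.\<close>

lemma phase_speed_nonneg:
  assumes "z \<ge> 0"
  shows "phase_speed z \<ge> 0"
proof -
  have "J0 z * J1_quotient z \<le> bessel_norm2 z"
  proof (cases "z \<le> 1/2")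
    case True
    have "z\<^sup>2 \<le> (1/2)\<^sup>2" using True assms by (intro power_mono) auto
    then have t: "0 \<le> z\<^sup>2 / 4" "z\<^sup>2 / 4 \<le> 1/16" by (auto simp: power2_eq_square)
    have "J0 z \<ge> 7/8" "J1_quotient z \<le> 9/16"
      using clifford_near_0[OF t] t unfolding J0_def J1_quotient_def abs_le_iff by linarith+
    then have "J0 z * J1_quotient z \<le> J0 z * J0 z" by (intro mult_left_mono) auto
    also have "\<dots> \<le> bessel_norm2 z" by (simp add: bessel_norm2_def power2_eq_square)
    finally show ?thesis .
  next
    case False
    have "2 * (J0 z * J1 z) \<le> bessel_norm2 z"
      using sum_squares_bound[of "J0 z" "J1 z"] by (simp add: bessel_norm2_def)
    then have "2 * z * (J0 z * J1_quotient z) \<le> bessel_norm2 z" by (simp add: J1_eq mult_ac)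
    show ?thesis
    proof (cases "J0 z * J1_quotient z \<ge> 0")
      case True
      have "1 * (J0 z * J1_quotient z) \<le> 2 * z * (J0 z * J1_quotient z)"
        using True False by (intro mult_right_mono) auto
      then show ?thesis using \<open>2 * z * (J0 z * J1_quotient z) \<le> bessel_norm2 z\<close> by linarith
    next
      case False
      then show ?thesis using bessel_norm2_pos[of z] by linarith
    qed
  qed
  then show ?thesis using bessel_norm2_pos[of z] by (simp add: phase_speed_def)
qed

lemma phase_speed_near_0:
  assumes "0 \<le> z" "z \<le> 1/2"
  shows "\<bar>phase_speed z - 1/2\<bar> \<le> 2 * z\<^sup>2"
proof -
  define t where "t = z\<^sup>2 / 4"
  have "z\<^sup>2 \<le> (1/2)\<^sup>2" using assms by (intro power_mono) auto
  then have t: "0 \<le> t" "t \<le> 1/16" by (auto simp: t_def power2_eq_square)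
  define a b where "a = clifford 0 t" and "b = clifford 1 t"
  have ab: "\<bar>a - 1\<bar> \<le> 2 * t" "\<bar>b - 1\<bar> \<le> 2 * t"
    using clifford_near_0[OF t] by (auto simp: a_def b_def)
  have n: "bessel_norm2 z = a\<^sup>2 + t * b\<^sup>2"
    by (simp add: bessel_norm2_def J0_def J1_def a_def b_def t_def power2_eq_square)
  have "(7/8)\<^sup>2 \<le> a\<^sup>2" using ab t by (intro power_mono) auto
  moreover have "0 \<le> t * b\<^sup>2" using t by simp
  ultimately have n1: "bessel_norm2 z \<ge> 1/2" unfolding n by (simp add: power2_eq_square)
  have "phase_speed z - 1/2 = (a * (a - b) + t * b\<^sup>2) / 2 / bessel_norm2 z"
    using n1 by (simp add: phase_speed_def J0_def J1_quotient_def a_def[symmetric] b_def[symmetric] t_def[symmetric] field_simps del: One_nat_def)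
      (simp add: n power2_eq_square algebra_simps)
  moreover have "\<bar>a * (a - b) + t * b\<^sup>2\<bar> \<le> 8 * t"
  proof -
    have "\<bar>a * (a - b)\<bar> \<le> (9/8) * (4 * t)"
      unfolding abs_mult using ab t by (intro mult_mono) auto
    moreover have "t * b\<^sup>2 \<le> t * (9/8)\<^sup>2"
      using ab t by (intro mult_left_mono power_mono) auto
    moreover have "t * (9/8)\<^sup>2 \<le> 2 * t" using t by (simp add: power2_eq_square)
    ultimately show ?thesis using \<open>0 \<le> t * b\<^sup>2\<close> t by linarith
  qed
  then have "\<bar>(a * (a - b) + t * b\<^sup>2) / 2 / bessel_norm2 z\<bar> \<le> (4 * t) / (1/2)"
    using n1 t unfolding abs_divide by (intro frac_le) auto
  ultimately show ?thesis by (simp add: t_def)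
qed

lemma bessel_phase_near_0:
  assumes "0 \<le> z" "z \<le> 1/2"
  shows "\<bar>bessel_phase z - z / 2\<bar> \<le> 2 * z ^ 3"
proof (cases "z = 0")
  case False
  have "((\<lambda>z. bessel_phase z - z / 2) has_real_derivative phase_speed x - 1/2) (at x)" for x
    by (auto intro!: derivative_eq_intros bessel_phase_deriv)
  then obtain s where s: "0 < s" "s < z" "bessel_phase z - z / 2 - (bessel_phase 0 - 0 / 2) = (z - 0) * (phase_speed s - 1/2)"
    using MVT2[of 0 z "\<lambda>z. bessel_phase z - z / 2" "\<lambda>s. phase_speed s - 1/2"] False assms by force
  have "\<bar>phase_speed s - 1/2\<bar> \<le> 2 * s\<^sup>2" using s assms by (intro phase_speed_near_0) auto
  also have "\<dots> \<le> 2 * z\<^sup>2" using s by (intro mult_left_mono power_mono) auto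
  finally have "z * \<bar>phase_speed s - 1/2\<bar> \<le> z * (2 * z\<^sup>2)" using assms by (intro mult_left_mono) auto
  then show ?thesis using s assms
    by (simp add: bessel_phase_0 abs_mult power3_eq_cube power2_eq_square mult_ac)
qed (simp add: bessel_phase_0)

lemma bessel_phase_mono:
  assumes "0 \<le> x" "x \<le> y"
  shows "bessel_phase x \<le> bessel_phase y"
  by (rule DERIV_nonneg_imp_nondecreasing[OF assms(2)])
     (use assms bessel_phase_deriv phase_speed_nonneg in \<open>meson order.trans\<close>)

text \<open>Twice the phase, at the midpoint of the unit interval, of the solution with frequency \<open>l\<close> that is
  a Bessel function on \<open>[0, d]\<close> and a trigonometric function on \<open>[d, 1/2]\<close>.\<close>

definition total_phase :: "real \<Rightarrow> real \<Rightarrow> real" where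
  "total_phase d l = l * (1 - 2 * d) + 2 * bessel_phase (l * d)"

lemma total_phase_growth:
  assumes "0 < d" "d < 1/2" "0 \<le> x" "x \<le> y"
  shows "total_phase d y - total_phase d x \<ge> (y - x) * (1 - 2 * d)"
  using bessel_phase_mono[of "x * d" "y * d"] assms
  by (simp add: total_phase_def mult_right_mono algebra_simps)

lemma total_phase_inj:
  assumes "0 < d" "d < 1/2" "0 \<le> x" "0 \<le> y" "total_phase d x = total_phase d y"
  shows "x = y"
proof -
  have "\<not> x < y" if "0 \<le> x" "total_phase d x = total_phase d y" for x y
  proof
    assume "x < y"
    then have "(y - x) * (1 - 2 * d) > 0" using assms by simp
    moreover have "total_phase d y - total_phase d x \<ge> (y - x) * (1 - 2 * d)"
      using assms that \<open>x < y\<close> by (intro total_phase_growth) auto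
    ultimately show False using that by linarith
  qed
  from this[of x y] this[of y x] show ?thesis using assms by force
qed

text \<open>The nonnegative solution \<open>l\<close> of the quantisation condition \<open>total_phase d l = k * \<pi>\<close>; it is unique for
  \<open>0 < d < 1/2\<close>.\<close>

definition frequency :: "real \<Rightarrow> nat \<Rightarrow> real" where
  "frequency d k = (THE l. 0 \<le> l \<and> total_phase d l = real k * pi)"

lemma frequency_ex1:
  assumes d: "0 < d" "d < 1/2"
  shows "\<exists>!l. 0 \<le> l \<and> total_phase d l = real k * pi"
proof -
  define b where "b = real k * pi / (1 - 2 * d)"
  have b: "b \<ge> 0" using d by (simp add: b_def)
  have 0: "total_phase d 0 = 0" by (simp add: total_phase_def bessel_phase_0)
  have "total_phase d b \<ge> real k * pi"
    using total_phase_growth[OF d, of 0 b] b 0 d by (simp add: b_def)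
  moreover have "continuous_on {0..b} (total_phase d)"
    unfolding total_phase_def[abs_def]
    by (intro continuous_intros continuous_at_imp_continuous_on ballI isCont_o2[OF _ DERIV_isCont[OF bessel_phase_deriv]])
  ultimately obtain l where "0 \<le> l" "l \<le> b" "total_phase d l = real k * pi"
    using IVT'[of "total_phase d" 0 "real k * pi" b] b 0 by auto
  then show ?thesis using total_phase_inj[OF d] by (metis (no_types))
qed

lemma frequency:
  assumes "0 < d" "d < 1/2"
  shows "0 \<le> frequency d k" "total_phase d (frequency d k) = real k * pi"
  using theI'[OF frequency_ex1[OF assms, of k]] unfolding frequency_def by auto

lemma frequency_unique:
  assumes "0 < d" "d < 1/2" "0 \<le> l" "total_phase d l = real k * pi"
  shows "l = frequency d k"
  using total_phase_inj[OF assms(1-3) frequency(1)] frequency(2) assms by metis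

lemma frequency_le: 
  assumes "0 < d" "d < 1/2"
  shows "frequency d k \<le> real k * pi / (1 - 2 * d)"
  using total_phase_growth[OF assms order.refl frequency(1)[OF assms], of k] frequency(2)[OF assms, of k] assms
  by (simp add: total_phase_def bessel_phase_0 field_simps)

lemma frequency_strict_mono:
  assumes d: "0 < d" "d < 1/2" and "j < k"
  shows "frequency d j < frequency d k"
proof (rule ccontr)
  assume "\<not> frequency d j < frequency d k"
  then have le: "frequency d k \<le> frequency d j" by simp
  have "0 \<le> (frequency d j - frequency d k) * (1 - 2 * d)" using le d by simp
  then have "real k * pi \<le> real j * pi"
    using total_phase_growth[OF d frequency(1)[OF d] le] unfolding frequency(2)[OF d] by linarith
  then show False using \<open>j < k\<close> by simp
qed

section \<open>Solutions of the eigenvalue equation on the interval\<close>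

lemma has_real_derivative_glue:
  fixes f g :: "real \<Rightarrow> real"
  assumes f: "\<And>x. (f has_real_derivative f' x) (at x)" and g: "\<And>x. (g has_real_derivative g' x) (at x)"
    and eq: "f d = g d" "f' d = g' d"
  shows "((\<lambda>x. if x \<le> d then f x else g x) has_real_derivative (if x \<le> d then f' x else g' x)) (at x)"
proof -
  consider "x < d" | "x = d" | "x > d" by linarith
  then show ?thesis
  proof cases
    case 1
    have "((\<lambda>x. if x \<le> d then f x else g x) has_real_derivative f' x) (at x)"
      by (rule has_field_derivative_transform_within_open[OF f, of "{..<d}"]) (use 1 in auto)
    then show ?thesis using 1 by simp
  next
    case 3
    have "((\<lambda>x. if x \<le> d then f x else g x) has_real_derivative g' x) (at x)"
      by (rule has_field_derivative_transform_within_open[OF g, of "{d<..}"]) (use 3 in auto)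
    then show ?thesis using 3 by simp
  next
    case 2
    let ?h = "\<lambda>x. if x \<le> d then f x else g x"
    have "((\<lambda>y. (?h y - ?h d) / (y - d)) \<longlongrightarrow> f' d) (at d)"
    proof (rule filterlim_split_at)
      have "((\<lambda>y. (f y - f d) / (y - d)) \<longlongrightarrow> f' d) (at_left d)"
        using has_field_derivative_at_within[OF f[of d], of "{..<d}"] by (simp add: has_field_derivative_iff)
      then show "((\<lambda>y. (?h y - ?h d) / (y - d)) \<longlongrightarrow> f' d) (at_left d)"
        by (rule Lim_transform_eventually) (auto simp: eventually_at_filter)
      have "((\<lambda>y. (g y - g d) / (y - d)) \<longlongrightarrow> f' d) (at_right d)"
        using has_field_derivative_at_within[OF g[of d], of "{d<..}"] eq by (simp add: has_field_derivative_iff)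
      then show "((\<lambda>y. (?h y - ?h d) / (y - d)) \<longlongrightarrow> f' d) (at_right d)"
        by (rule Lim_transform_eventually) (auto simp: eventually_at_filter eq)
    qed
    then show ?thesis using 2 by (simp add: has_field_derivative_iff)
  qed
qed

text \<open>On the unit interval: the weight that rises linearly with slope \<open>\<kappa>\<close> up to \<open>x = d\<close>, is constant up
  to \<open>1 - d\<close>, and decreases linearly to zero.\<close>

definition trapezoid :: "real \<Rightarrow> real \<Rightarrow> real \<Rightarrow> real" where
  "trapezoid \<kappa> d x = \<kappa> * min x (min d (1 - x))"

lemma trapezoid_reflect: "trapezoid \<kappa> d (1 - x) = trapezoid \<kappa> d x"
  by (simp add: trapezoid_def min.left_commute min.commute)

lemma trapezoid_pos: "\<kappa> > 0 \<Longrightarrow> 0 < d \<Longrightarrow> 0 < x \<Longrightarrow> x < 1 \<Longrightarrow> 0 < trapezoid \<kappa> d x"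
  by (simp add: trapezoid_def)

lemma trapezoid_continuous: "continuous_on A (trapezoid \<kappa> d)"
  unfolding trapezoid_def by (intro continuous_intros)

text \<open>The length of the vector \<open>(J0 z, J1 z)\<close>, for \<open>z \<ge> 0\<close>.\<close>

definition amplitude :: "real \<Rightarrow> real" where
  "amplitude z = (SOME R. R > 0 \<and> J0 z = R * cos (bessel_phase z) \<and> J1 z = R * sin (bessel_phase z))"

lemma amplitude:
  assumes "z \<ge> 0"
  shows "amplitude z > 0" "J0 z = amplitude z * cos (bessel_phase z)" "J1 z = amplitude z * sin (bessel_phase z)"
proof -
  obtain R where "R > 0 \<and> J0 z = R * cos (bessel_phase z) \<and> J1 z = R * sin (bessel_phase z)"
    using bessel_polar[OF assms] by blast
  from someI[of "\<lambda>R. R > 0 \<and> J0 z = R * cos (bessel_phase z) \<and> J1 z = R * sin (bessel_phase z)", OF this]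
  show "amplitude z > 0" "J0 z = amplitude z * cos (bessel_phase z)" "J1 z = amplitude z * sin (bessel_phase z)"
    unfolding amplitude_def by auto
qed

lemma J_scaled_deriv:
  "((\<lambda>x. J0 (l * x)) has_real_derivative - l * J1 (l * x)) (at x)"
  "((\<lambda>x. J1 (l * x)) has_real_derivative l * (J0 (l * x) - J1_quotient (l * x))) (at x)"
proof -
  have l: "((\<lambda>x. l * x) has_real_derivative l) (at x)" by (auto intro!: derivative_eq_intros)
  show "((\<lambda>x. J0 (l * x)) has_real_derivative - l * J1 (l * x)) (at x)"
    "((\<lambda>x. J1 (l * x)) has_real_derivative l * (J0 (l * x) - J1_quotient (l * x))) (at x)"
    using DERIV_chain2[OF J0_deriv l] DERIV_chain2[OF J1_deriv l] by (simp_all add: mult.commute)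
qed

context
  fixes \<kappa> d l :: real
  assumes \<kappa>: "\<kappa> > 0" and d: "0 < d" "d < 1/2" and l: "l \<ge> 0"
begin

text \<open>The solution of \<open>- (h u')' = l\<^sup>2 h u\<close> on \<open>(0, 1 - d)\<close> that is regular at zero: a Bessel function where
  \<open>h\<close> is linear, continued by a cosine where \<open>h\<close> is constant. As a function on the line it is
  continuously differentiable.\<close>

definition left_sol :: "real \<Rightarrow> real" where
  "left_sol x = (if x \<le> d then J0 (l * x) else amplitude (l * d) * cos (l * (x - d) + bessel_phase (l * d)))"

text \<open>The derivative of \<open>left_sol\<close>.\<close>

definition left_sol_deriv :: "real \<Rightarrow> real" where
  "left_sol_deriv x = (if x \<le> d then - l * J1 (l * x) else - l * amplitude (l * d) * sin (l * (x - d) + bessel_phase (l * d)))"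

text \<open>The flux \<open>- h u'\<close> of the solution, with the weight as it is to the left of \<open>1 - d\<close>.\<close>

definition left_flux :: "real \<Rightarrow> real" where "left_flux x = - (\<kappa> * min x d) * left_sol_deriv x"

lemma scaled_kink_nonneg: "l * d \<ge> 0" using l d by simp

lemma left_sol_has_deriv: "(left_sol has_real_derivative left_sol_deriv x) (at x)"
  unfolding left_sol_def[abs_def] left_sol_deriv_def
proof (rule has_real_derivative_glue)
  show "((\<lambda>x. J0 (l * x)) has_real_derivative - l * J1 (l * x)) (at x)" for x
    by (rule J_scaled_deriv)
  show "((\<lambda>x. amplitude (l * d) * cos (l * (x - d) + bessel_phase (l * d))) has_real_derivative
      - l * amplitude (l * d) * sin (l * (x - d) + bessel_phase (l * d))) (at x)" for x
    by (auto intro!: derivative_eq_intros)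
qed (use amplitude[OF scaled_kink_nonneg] in auto)

lemma left_flux_alt: "left_flux x = (if x \<le> d then \<kappa> * l * (x * J1 (l * x))
    else \<kappa> * d * l * amplitude (l * d) * sin (l * (x - d) + bessel_phase (l * d)))"
  by (simp add: left_flux_def left_sol_deriv_def)

lemma left_flux_has_deriv: "(left_flux has_real_derivative \<kappa> * min x d * l\<^sup>2 * left_sol x) (at x)"
proof -
  have "((\<lambda>x. if x \<le> d then \<kappa> * l * (x * J1 (l * x)) else \<kappa> * d * l * amplitude (l * d) * sin (l * (x - d) + bessel_phase (l * d)))
    has_real_derivative (if x \<le> d then \<kappa> * x * l\<^sup>2 * J0 (l * x)
      else \<kappa> * d * l\<^sup>2 * (amplitude (l * d) * cos (l * (x - d) + bessel_phase (l * d))))) (at x)"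
  proof (rule has_real_derivative_glue)
    show "((\<lambda>x. \<kappa> * l * (x * J1 (l * x))) has_real_derivative \<kappa> * x * l\<^sup>2 * J0 (l * x)) (at x)" for x
      by (rule derivative_eq_intros J_scaled_deriv refl)+
         (simp add: J1_eq power2_eq_square algebra_simps)
    show "((\<lambda>x. \<kappa> * d * l * amplitude (l * d) * sin (l * (x - d) + bessel_phase (l * d))) has_real_derivative
        \<kappa> * d * l\<^sup>2 * (amplitude (l * d) * cos (l * (x - d) + bessel_phase (l * d)))) (at x)" for x
      by (auto intro!: derivative_eq_intros simp: power2_eq_square)
  qed (use amplitude[OF scaled_kink_nonneg] in auto)
  moreover have "left_flux = (\<lambda>x. if x \<le> d then \<kappa> * l * (x * J1 (l * x)) else \<kappa> * d * l * amplitude (l * d) * sin (l * (x - d) + bessel_phase (l * d)))"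
    by (rule ext) (rule left_flux_alt)
  moreover have "(if x \<le> d then \<kappa> * x * l\<^sup>2 * J0 (l * x)
      else \<kappa> * d * l\<^sup>2 * (amplitude (l * d) * cos (l * (x - d) + bessel_phase (l * d)))) = \<kappa> * min x d * l\<^sup>2 * left_sol x"
    by (simp add: left_sol_def)
  ultimately show ?thesis by simp
qed

text \<open>Solution and flux have no common zero on the positive half line.\<close>

lemma left_sol_nontrivial:
  assumes "x > 0" shows "(left_sol x)\<^sup>2 + (left_flux x)\<^sup>2 > 0"
proof (rule ccontr)
  assume "\<not> ?thesis"
  then have 0: "left_sol x = 0" "left_flux x = 0"
    using sum_power2_gt_zero_iff by blast+
  show False
  proof (cases "l = 0")
    case True
    have "amplitude 0 = 1" using amplitude(2)[of 0] by (simp add: bessel_phase_0 J0_0)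
    then have "left_sol x = 1" unfolding left_sol_def using True by (simp add: J0_0 bessel_phase_0)
    then show False using 0(1) by simp
  next
    case False
    show False
    proof (cases "x \<le> d")
      case True
      then have "J0 (l * x) = 0" "J1 (l * x) = 0"
        using 0 False \<kappa> assms by (auto simp: left_sol_def left_flux_alt)
      then show False using bessel_norm2_pos[of "l * x"] by (simp add: bessel_norm2_def)
    next
      case F: False
      then have "cos (l * (x - d) + bessel_phase (l * d)) = 0" "sin (l * (x - d) + bessel_phase (l * d)) = 0"
        using 0 False \<kappa> d amplitude(1)[OF scaled_kink_nonneg] by (auto simp: left_sol_def left_flux_alt)
      then show False using sin_cos_squared_add[of "l * (x - d) + bessel_phase (l * d)"] by simp
    qed
  qed
qed

lemma trapezoid_left: "x \<le> 1 - d \<Longrightarrow> trapezoid \<kappa> d x = \<kappa> * min x d"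
  by (auto simp: trapezoid_def min_def)

text \<open>A solution of the first order system whose flux vanishes linearly at the left end is a
  multiple of the one above, since the Wronskian is constant and tends to zero.\<close>

lemma left_solution_unique:
  assumes V: "\<And>x. 0 < x \<Longrightarrow> x < 1 - d \<Longrightarrow> (V has_real_derivative - P x / trapezoid \<kappa> d x) (at x)"
    and P: "\<And>x. 0 < x \<Longrightarrow> x < 1 - d \<Longrightarrow> (P has_real_derivative l\<^sup>2 * trapezoid \<kappa> d x * V x) (at x)"
    and P0: "\<And>x. 0 < x \<Longrightarrow> x < 1 - d \<Longrightarrow> \<bar>P x\<bar> \<le> C * x"
  obtains c where "\<And>x. 0 < x \<Longrightarrow> x < 1 - d \<Longrightarrow> V x = c * left_sol x \<and> P x = c * left_flux x"
proof -
  let ?h = "trapezoid \<kappa> d"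
  have h: "?h x = \<kappa> * min x d" "?h x > 0" if "0 < x" "x < 1 - d" for x
    using that trapezoid_left[of x] \<kappa> d by auto
  have s: "left_sol_deriv x = - left_flux x / ?h x" if "0 < x" "x < 1 - d" for x
  proof -
    have "m \<noteq> 0 \<Longrightarrow> D = - (- m * D) / m" for m D :: real by simp
    then show ?thesis using h[OF that] unfolding left_flux_def h(1)[OF that] by (metis less_numeral_extra(3))
  qed
  define W where "W x = P x * left_sol x - left_flux x * V x" for x
  have dW: "(W has_real_derivative 0) (at x)" if "0 < x" "x < 1 - d" for x
  proof -
    have "(W has_real_derivative (l\<^sup>2 * ?h x * V x) * left_sol x + P x * left_sol_deriv x
        - ((\<kappa> * min x d * l\<^sup>2 * left_sol x) * V x + left_flux x * (- P x / ?h x))) (at x)"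
      unfolding W_def[abs_def]
      by (rule derivative_eq_intros V[OF that] P[OF that] left_sol_has_deriv left_flux_has_deriv refl)+ (simp add: algebra_simps)
    moreover have "(l\<^sup>2 * ?h x * V x) * left_sol x + P x * left_sol_deriv x
        - ((\<kappa> * min x d * l\<^sup>2 * left_sol x) * V x + left_flux x * (- P x / ?h x)) = 0"
      unfolding s[OF that] h(1)[OF that, symmetric] by (simp add: algebra_simps)
    ultimately show ?thesis by simp
  qed
  have Wc: "W x = W y" if "0 < x" "x < 1 - d" "0 < y" "y < 1 - d" for x y
    by (rule DERIV_isconst3[of 0 "1 - d" x y W]) (use d that dW in auto)
  have W0: "W x = 0" if x: "0 < x" "x < 1 - d" for x
  proof -
    have "\<bar>P d\<bar> \<le> C * d" using d by (intro P0) auto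
    then have "0 \<le> C * d" by linarith
    then have "C \<ge> 0" using d by (simp add: zero_le_mult_iff)
    have Vb: "\<bar>V y\<bar> \<le> \<bar>V d\<bar> + C / \<kappa>" if y: "0 < y" "y < d" for y
    proof -
      obtain z where z: "y < z" "z < d" "V d - V y = (d - y) * (- P z / ?h z)"
        using MVT2[OF y(2), of V "\<lambda>z. - P z / ?h z"] V y d by fastforce
      have "\<bar>P z / ?h z\<bar> = \<bar>P z\<bar> / (\<kappa> * z)"
        using h(1)[of z] z y d \<kappa> by (simp add: abs_mult)
      also have "\<dots> \<le> C * z / (\<kappa> * z)"
        using z y d \<kappa> by (intro divide_right_mono P0) auto
      also have "\<dots> = C / \<kappa>" using z y by simp
      finally have "\<bar>V d - V y\<bar> \<le> 1 * (C / \<kappa>)"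
        unfolding z(3) abs_mult using y d \<open>C \<ge> 0\<close> \<kappa> by (intro mult_mono) auto
      then show ?thesis by linarith
    qed
    have ev: "eventually (\<lambda>y. 0 < y \<and> y < d) (at_right 0)"
      using d by (auto simp: eventually_at_right_field)
    have cont: "isCont left_sol 0" "isCont left_flux 0"
      using left_sol_has_deriv left_flux_has_deriv DERIV_isCont by blast+
    have "(W \<longlongrightarrow> 0) (at_right 0)"
    proof -
      have "((\<lambda>y. C * y) \<longlongrightarrow> C * 0) (at_right 0)" by (intro tendsto_intros)
      then have "((\<lambda>y. C * y) \<longlongrightarrow> 0) (at_right 0)" by simp
      moreover have "\<forall>\<^sub>F y in at_right 0. norm (P y) \<le> C * y"
        using ev by eventually_elim (use P0 d in auto)
      ultimately have "(P \<longlongrightarrow> 0) (at_right 0)" by (rule Lim_null_comparison[rotated])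
      moreover have "(left_sol \<longlongrightarrow> left_sol 0) (at_right 0)" "(left_flux \<longlongrightarrow> left_flux 0) (at_right 0)"
        using cont by (auto simp: continuous_at intro: tendsto_mono[OF at_le])
      moreover have "left_flux 0 = 0" using d by (simp add: left_flux_alt)
      moreover have "((\<lambda>y. left_flux y * V y) \<longlongrightarrow> 0) (at_right 0)"
      proof (rule Lim_null_comparison)
        show "\<forall>\<^sub>F y in at_right 0. norm (left_flux y * V y) \<le> \<bar>left_flux y\<bar> * (\<bar>V d\<bar> + C / \<kappa>)"
          using ev by eventually_elim (use Vb in \<open>auto simp: abs_mult intro!: mult_left_mono\<close>)
        show "((\<lambda>y. \<bar>left_flux y\<bar> * (\<bar>V d\<bar> + C / \<kappa>)) \<longlongrightarrow> 0) (at_right 0)"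
          using tendsto_mult_left_zero[OF tendsto_rabs_zero] \<open>(left_flux \<longlongrightarrow> left_flux 0) (at_right 0)\<close> \<open>left_flux 0 = 0\<close> by metis
      qed
      ultimately have "((\<lambda>y. P y * left_sol y - left_flux y * V y) \<longlongrightarrow> 0 * left_sol 0 - 0) (at_right 0)"
        by (intro tendsto_intros)
      then show ?thesis by (simp add: W_def[abs_def])
    qed
    moreover have "(W \<longlongrightarrow> W x) (at_right 0)"
    proof (rule tendsto_eventually)
      show "\<forall>\<^sub>F y in at_right 0. W y = W x"
        using ev by eventually_elim (use Wc[OF _ _ x] d in auto)
    qed
    ultimately show ?thesis using tendsto_unique trivial_limit_at_right_real by blast
  qed
  \<comment> \<open>with zero Wronskian the vectors \<open>(V, P)\<close> and \<open>(left_sol, left_flux)\<close> are parallel, with factor \<open>c x\<close>;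
    both solve the same linear system, so \<open>c\<close> has derivative zero\<close>
  define c where "c x = (left_sol x * V x + P x * left_flux x) / ((left_sol x)\<^sup>2 + (left_flux x)\<^sup>2)" for x
  have c: "V x = c x * left_sol x" "P x = c x * left_flux x" if x: "0 < x" "x < 1 - d" for x
  proof -
    have n: "(left_sol x)\<^sup>2 + (left_flux x)\<^sup>2 \<noteq> 0" using left_sol_nontrivial[OF x(1)] by (rule less_imp_neq[THEN not_sym])
    have w: "P x * left_sol x = left_flux x * V x" using W0[OF x] by (simp add: W_def)
    have "V x * ((left_sol x)\<^sup>2 + (left_flux x)\<^sup>2) = (left_sol x * V x + P x * left_flux x) * left_sol x"
      using w by algebra
    then show "V x = c x * left_sol x" using n by (simp add: c_def field_simps)
    have "P x * ((left_sol x)\<^sup>2 + (left_flux x)\<^sup>2) = (left_sol x * V x + P x * left_flux x) * left_flux x"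
      using w by algebra
    then show "P x = c x * left_flux x" using n by (simp add: c_def field_simps)
  qed
  have dc: "(c has_real_derivative 0) (at x)" if x: "0 < x" "x < 1 - d" for x
  proof -
    have n: "(left_sol x)\<^sup>2 + (left_flux x)\<^sup>2 \<noteq> 0" using left_sol_nontrivial[OF x(1)] by (rule less_imp_neq[THEN not_sym])
    have "c differentiable (at x)"
      unfolding c_def[abs_def] using n V[OF x] P[OF x] left_sol_has_deriv[of x] left_flux_has_deriv[of x]
      by (intro derivative_intros) (auto simp: real_differentiable_def)
    then obtain c' where c': "(c has_real_derivative c') (at x)" by (auto simp: real_differentiable_def)
    have op: "open {0<..<1 - d}" "x \<in> {0<..<1 - d}" using x by auto
    have "((\<lambda>x. c x * left_sol x) has_real_derivative c' * left_sol x + left_sol_deriv x * c x) (at x)"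
      by (rule DERIV_mult[OF c' left_sol_has_deriv])
    then have "(V has_real_derivative c' * left_sol x + left_sol_deriv x * c x) (at x)"
      by (rule has_field_derivative_transform_within_open[OF _ op]) (use c in auto)
    then have "- P x / ?h x = c' * left_sol x + left_sol_deriv x * c x" using V[OF x] DERIV_unique by blast
    moreover have "- P x / ?h x = left_sol_deriv x * c x" unfolding s[OF x] c(2)[OF x] by simp
    ultimately have 1: "c' * left_sol x = 0" by linarith
    have "((\<lambda>x. c x * left_flux x) has_real_derivative c' * left_flux x + (\<kappa> * min x d * l\<^sup>2 * left_sol x) * c x) (at x)"
      by (rule DERIV_mult[OF c' left_flux_has_deriv])
    then have "(P has_real_derivative c' * left_flux x + (\<kappa> * min x d * l\<^sup>2 * left_sol x) * c x) (at x)"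
      by (rule has_field_derivative_transform_within_open[OF _ op]) (use c in auto)
    then have "l\<^sup>2 * ?h x * V x = c' * left_flux x + (\<kappa> * min x d * l\<^sup>2 * left_sol x) * c x" using P[OF x] DERIV_unique by blast
    moreover have "l\<^sup>2 * ?h x * V x = (\<kappa> * min x d * l\<^sup>2 * left_sol x) * c x" unfolding c(1)[OF x] h(1)[OF x] by simp
    ultimately have 2: "c' * left_flux x = 0" by linarith
    have "c' = 0" using 1 2 n by auto
    then show ?thesis using c' by simp
  qed
  have "c x = c d" if "0 < x" "x < 1 - d" for x
    by (rule DERIV_isconst3[of 0 "1 - d" x d c]) (use d that dc in auto)
  then show ?thesis using that[of "c d"] c by metis
qed

lemma left_sol_half:
  "left_sol (1/2) = amplitude (l * d) * cos (total_phase d l / 2)"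
  "left_flux (1/2) = \<kappa> * d * l * amplitude (l * d) * sin (total_phase d l / 2)"
proof -
  have e: "l * (1/2 - d) + bessel_phase (l * d) = total_phase d l / 2"
    by (simp add: total_phase_def field_simps)
  have nd: "\<not> 1/2 \<le> d" using d by simp
  show "left_sol (1/2) = amplitude (l * d) * cos (total_phase d l / 2)"
    "left_flux (1/2) = \<kappa> * d * l * amplitude (l * d) * sin (total_phase d l / 2)"
    by (simp_all only: left_sol_def left_flux_alt nd if_False e)
qed

text \<open>The quantisation condition makes the trigonometric part even or odd about the midpoint, according
  to the parity of \<open>k\<close>.\<close>

lemma left_sol_symmetric:
  assumes k: "total_phase d l = real k * pi" and x: "d \<le> x" "x \<le> 1 - d"
  shows "left_sol (1 - x) = (- 1) ^ k * left_sol x" "left_sol_deriv (1 - x) = - ((- 1) ^ k * left_sol_deriv x)"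
proof -
  have left_sol: "left_sol y = amplitude (l * d) * cos (l * (y - d) + bessel_phase (l * d))"
    "left_sol_deriv y = - l * amplitude (l * d) * sin (l * (y - d) + bessel_phase (l * d))" if "d \<le> y" for y
    using that amplitude(2,3)[OF scaled_kink_nonneg] by (auto simp: left_sol_def left_sol_deriv_def)
  have eq: "l * (1 - x - d) + bessel_phase (l * d) = real k * pi - (l * (x - d) + bessel_phase (l * d))"
    using k by (simp add: total_phase_def algebra_simps)
  have "cos (real k * pi - t) = (- 1) ^ k * cos t" "sin (real k * pi - t) = - ((- 1) ^ k * sin t)" for t
    by (simp_all add: cos_diff sin_diff)
  then show "left_sol (1 - x) = (- 1) ^ k * left_sol x" "left_sol_deriv (1 - x) = - ((- 1) ^ k * left_sol_deriv x)"
    using x by (simp_all add: left_sol eq)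
qed

lemma left_sol_deriv_bound:
  obtains L where "L \<ge> 0" "\<And>x. 0 \<le> x \<Longrightarrow> x \<le> 1/2 \<Longrightarrow> \<bar>left_sol_deriv x\<bar> \<le> L * x"
proof -
  have "continuous_on {0..l * d} J1_quotient"
    using isCont_J(3) by (simp add: continuous_at_imp_continuous_on)
  then have "bounded (J1_quotient ` {0..l * d})"
    by (intro compact_imp_bounded compact_continuous_image) auto
  then obtain B where "\<forall>z\<in>{0..l * d}. \<bar>J1_quotient z\<bar> \<le> B" unfolding bounded_iff by force
  then have B: "\<bar>J1_quotient z\<bar> \<le> B" if "0 \<le> z" "z \<le> l * d" for z using that by simp
  have "B \<ge> 0" using B[of 0] scaled_kink_nonneg by linarith
  define L where "L = l\<^sup>2 * B + l * amplitude (l * d) / d"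
  have L: "l\<^sup>2 * B \<ge> 0" "l * amplitude (l * d) / d \<ge> 0" using \<open>B \<ge> 0\<close> l d amplitude(1)[OF scaled_kink_nonneg] by auto
  have "\<bar>left_sol_deriv x\<bar> \<le> L * x" if x: "0 \<le> x" for x
  proof (cases "x \<le> d")
    case True
    have "\<bar>left_sol_deriv x\<bar> = l\<^sup>2 * x * \<bar>J1_quotient (l * x)\<bar>"
      using True x l by (simp add: left_sol_deriv_def J1_eq abs_mult power2_eq_square)
    also have "\<dots> \<le> l\<^sup>2 * x * B"
      using True x l by (intro mult_left_mono B) (auto intro: mult_left_mono)
    also have "\<dots> = (l\<^sup>2 * B) * x" by simp
    also have "\<dots> \<le> L * x" using L x unfolding L_def by (intro mult_right_mono) auto
    finally show ?thesis .
  next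
    case False
    have "\<bar>left_sol_deriv x\<bar> \<le> l * amplitude (l * d) * 1"
      using False l amplitude(1)[OF scaled_kink_nonneg] by (simp add: left_sol_deriv_def abs_mult mult_left_le)
    also have "\<dots> = (l * amplitude (l * d) / d) * d" using d by simp
    also have "\<dots> \<le> (l * amplitude (l * d) / d) * x"
      using False L(2) by (intro mult_left_mono) auto
    also have "\<dots> \<le> L * x" using L x unfolding L_def by (intro mult_right_mono) auto
    finally show ?thesis .
  qed
  moreover have "L \<ge> 0" using L by (simp add: L_def)
  ultimately show ?thesis using that by blast
qed

end

section \<open>The weighted interval\<close>

lemma C_k_1_real:
  fixes v :: "real \<Rightarrow> real"
  assumes "\<And>x. (v has_real_derivative v' x) (at x)" "continuous_on UNIV v'"
  shows "C_k (Suc 0) v"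
proof -
  have "partial_deriv 1 v = v'" using partial_deriv_real(1)[OF assms(1)] by auto
  then show ?thesis using partial_deriv_real(2)[OF assms(1)] assms(2) by simp
qed

lemma cutoff_deriv_eq_0:
  assumes "x \<notin> {1 / real n..a - 1 / real n}" "n > 0" shows "cutoff_deriv a n x = 0"
proof -
  have "real n * x - 1 \<le> 0 \<or> real n * (a - x) - 1 \<le> 0"
    using assms by (auto simp: field_simps)
  then show ?thesis by (auto simp: cutoff_deriv_def flat_exp_def flat_exp_deriv_def)
qed

lemma cutoff_endpoints:
  assumes "n > 0" shows "cutoff a n (1 / real n) = 0" "cutoff a n (a - 1 / real n) = 0"
  using assms by (auto simp: cutoff_def flat_exp_def)

lemma continuous_on_cutoff_deriv: "continuous_on UNIV (cutoff_deriv a n)"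
proof -
  have "partial_deriv 1 (cutoff a n) = cutoff_deriv a n" using partial_deriv_real(1)[OF cutoff_has_deriv] by auto
  then show ?thesis using C_k_cutoff[of "Suc 0" a n] by auto
qed

context
  fixes \<kappa> d :: real and S :: "real set" and h :: "real \<Rightarrow> real"
  assumes \<kappa>: "\<kappa> > 0" and d: "0 < d" "d < 1/2"
    and S_def: "S = {0<..<1}" and h_def: "h = trapezoid \<kappa> d"
begin

lemma int_open: "open S" and int_borel: "S \<in> sets borel"
  by (auto simp: S_def)

lemma h_pos: "x \<in> S \<Longrightarrow> 0 < h x"
  using \<kappa> d by (simp add: S_def h_def trapezoid_pos)

lemma h_nonneg: "x \<in> S \<Longrightarrow> 0 \<le> h x" using h_pos by force

lemma h_cont: "continuous_on A h" by (simp add: h_def trapezoid_continuous)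

lemma h_measurable: "h \<in> borel_measurable borel" by (rule continuous_real_measurable[OF h_cont])

lemma h_weight: "(\<lambda>x. indicator S x * h x) \<in> borel_measurable borel"
  using int_borel h_measurable by simp

abbreviation "int_measure \<equiv> weighted_measure S h"

lemma int_integrable: "f \<in> borel_measurable borel \<Longrightarrow> integrable int_measure f \<longleftrightarrow> set_integrable lborel S (\<lambda>x. h x * f x)"
  by (rule integrable_weighted_measure[OF h_nonneg h_weight])

lemma int_integral: "f \<in> borel_measurable borel \<Longrightarrow> (LINT x|int_measure. f x) = (LINT x:S|lborel. h x * f x)"
  by (rule integral_weighted_measure[OF h_nonneg h_weight])

lemma int_AE: "(AE x in int_measure. P x) \<longleftrightarrow> (AE x in lborel. x \<in> S \<longrightarrow> P x)"
  by (rule AE_weighted_measure[OF h_nonneg h_weight h_pos])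

lemma int_set_integrable_cont:
  assumes "continuous_on UNIV f" shows "set_integrable lborel S (f :: real \<Rightarrow> real)"
proof -
  have "set_integrable lborel {0..1} f"
    unfolding set_integrable_def using assms by (intro borel_integrable_compact) (auto intro: continuous_on_subset)
  then show ?thesis by (rule set_integrable_subset) (auto simp: S_def)
qed

lemma int_form_domain_integrable:
  assumes v: "v \<in> form_domain S h"
  shows "set_integrable lborel S (\<lambda>x. h x * v x)" "set_integrable lborel S (\<lambda>x. h x * weak_gradient S v x)"
    "set_integrable lborel S (\<lambda>x. h x * (v x)\<^sup>2)"
proof -
  note [measurable] = weak_gradient_measurable(1,2)[OF v] int_borel h_measurable
  have "integrable int_measure (\<lambda>x. (v x)\<^sup>2 + (norm (weak_gradient S v x))\<^sup>2)" using v by (simp add: form_domain_def)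
  then have i: "set_integrable lborel S (\<lambda>x. h x * ((v x)\<^sup>2 + (weak_gradient S v x)\<^sup>2))"
    by (subst (asm) int_integrable) auto
  then have i1: "set_integrable lborel S (\<lambda>x. h x * ((v x)\<^sup>2 + (weak_gradient S v x)\<^sup>2) + h x)"
    by (rule set_integral_add(1)) (rule int_set_integrable_cont[OF h_cont])
  have *: "\<bar>a\<bar> \<le> a\<^sup>2 + b\<^sup>2 + 1" "\<bar>b\<bar> \<le> a\<^sup>2 + b\<^sup>2 + 1" for a b :: real
    using sum_squares_bound[of "\<bar>a\<bar>" 1] sum_squares_bound[of "\<bar>b\<bar>" 1] zero_le_power2[of a] zero_le_power2[of b]
      abs_ge_zero[of a] abs_ge_zero[of b] unfolding power2_abs power_one mult_1_right by linarith+
  have le: "norm (h x * f x) \<le> norm (h x * ((v x)\<^sup>2 + (weak_gradient S v x)\<^sup>2) + h x)"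
    if "x \<in> S" "\<bar>f x\<bar> \<le> (v x)\<^sup>2 + (weak_gradient S v x)\<^sup>2 + 1" for x f
  proof -
    have "h x * \<bar>f x\<bar> \<le> h x * ((v x)\<^sup>2 + (weak_gradient S v x)\<^sup>2 + 1)"
      using that h_nonneg by (intro mult_left_mono) auto
    then show ?thesis using h_nonneg[OF that(1)] by (simp add: abs_mult distrib_left)
  qed
  show "set_integrable lborel S (\<lambda>x. h x * v x)"
    by (rule set_integrable_bound[OF i1]) (auto simp: set_borel_measurable_def simp del: real_norm_def intro!: AE_I2 le *)
  show "set_integrable lborel S (\<lambda>x. h x * weak_gradient S v x)"
    by (rule set_integrable_bound[OF i1]) (auto simp: set_borel_measurable_def simp del: real_norm_def intro!: AE_I2 le *)
  have sq: "norm (h x * (v x)\<^sup>2) \<le> norm (h x * ((v x)\<^sup>2 + (weak_gradient S v x)\<^sup>2))" if "x \<in> S" for x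
    using h_nonneg[OF that] by (simp add: abs_mult mult_left_mono)
  show "set_integrable lborel S (\<lambda>x. h x * (v x)\<^sup>2)"
    by (rule set_integrable_bound[OF i]) (auto simp: set_borel_measurable_def simp del: real_norm_def intro!: AE_I2 sq)
qed

lemma int_C1_weak_gradient:
  assumes v: "\<And>x. (v has_real_derivative v' x) (at x)" "continuous_on UNIV v'"
  shows "v \<in> form_domain S h" "AE x in lborel. x \<in> S \<longrightarrow> weak_gradient S v x = v' x"
proof -
  have G: "v' x \<bullet> i = partial_deriv i v x" if "i \<in> Basis" for i x
    using that partial_deriv_real(1)[OF v(1)] by simp
  note cg = classical_gradient[OF int_open C_k_1_real[OF v] G]
  show ae: "AE x in lborel. x \<in> S \<longrightarrow> weak_gradient S v x = v' x" using cg(5) .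
  have cv: "continuous_on UNIV v" using C_k_1_real[OF v] by (rule C_k_imp_continuous)
  have wm: "weak_gradient S v \<in> borel_measurable borel"
    using weak_gradient_works(1)[OF cg(4)] by (auto simp: L2_loc_def)
  note [measurable] = wm int_borel h_measurable continuous_real_measurable[OF cv] continuous_real_measurable[OF v(2)]
  have "set_integrable lborel S (\<lambda>x. h x * ((v x)\<^sup>2 + (v' x)\<^sup>2))"
    by (intro int_set_integrable_cont continuous_intros cv v(2) h_cont)
  moreover have "set_integrable lborel S (\<lambda>x. h x * ((v x)\<^sup>2 + (norm (weak_gradient S v x))\<^sup>2))
    = set_integrable lborel S (\<lambda>x. h x * ((v x)\<^sup>2 + (v' x)\<^sup>2))"
  proof (rule set_integrable_cong_AE)
    show "AE x\<in>S in lborel. h x * ((v x)\<^sup>2 + (norm (weak_gradient S v x))\<^sup>2) = h x * ((v x)\<^sup>2 + (v' x)\<^sup>2)"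
      using ae by eventually_elim simp
  qed measurable
  ultimately have "integrable int_measure (\<lambda>x. (v x)\<^sup>2 + (norm (weak_gradient S v x))\<^sup>2)"
    by (subst int_integrable) auto
  then show "v \<in> form_domain S h" using cg(4) by (simp add: form_domain_def)
qed

lemma int_energy_C1:
  assumes u: "u \<in> form_domain S h" and v: "\<And>x. (v has_real_derivative v' x) (at x)" "continuous_on UNIV v'"
  shows "energy S h u v = (LINT x:S|lborel. (h x * weak_gradient S u x) * v' x)"
proof -
  note vd = int_C1_weak_gradient[OF v]
  note [measurable] = weak_gradient_measurable(2)[OF u] weak_gradient_measurable(2)[OF vd(1)]
    int_borel h_measurable continuous_real_measurable[OF v(2)]
  have "energy S h u v = (LINT x:S|lborel. h x * (weak_gradient S u x \<bullet> weak_gradient S v x))"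
    unfolding energy_def by (intro int_integral) measurable
  also have "\<dots> = (LINT x:S|lborel. (h x * weak_gradient S u x) * v' x)"
  proof (rule set_lebesgue_integral_cong_AE)
    show "AE x\<in>S in lborel. h x * (weak_gradient S u x \<bullet> weak_gradient S v x) = (h x * weak_gradient S u x) * v' x"
      using vd(2) by eventually_elim simp
  qed measurable
  finally show ?thesis .
qed

text \<open>Integration by parts against a flux \<open>h * p\<close> that is only once differentiable, for an arbitrary
  function of the form domain. Test functions are replaced by cutoffs of the flux, which is possible
  because \<open>v\<close> is an indefinite integral. The derivative of the cutoff meets \<open>h * v * p\<close>, where
  \<open>h * v\<close> is integrable, although \<open>v\<close> itself need not be, and \<open>p\<close> vanishes linearly at both ends.\<close>

lemma int_by_parts:
  assumes v: "v \<in> form_domain S h"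
    and q: "\<And>x. x \<in> S \<Longrightarrow> ((\<lambda>x. h x * p x) has_real_derivative h x * r x) (at x)"
    and p: "continuous_on UNIV p" and r: "continuous_on UNIV r"
    and L: "L \<ge> 0" "\<And>x. x \<in> S \<Longrightarrow> \<bar>p x\<bar> \<le> L * x" "\<And>x. x \<in> S \<Longrightarrow> \<bar>p x\<bar> \<le> L * (1 - x)"
  shows "(LINT x:S|lborel. (h x * weak_gradient S v x) * p x) = - (LINT x:S|lborel. (h x * v x) * r x)"
proof -
  let ?G = "weak_gradient S v"
  note wg = weak_gradient_measurable[OF v] and vi = int_form_domain_integrable[OF v]
  obtain V where V: "continuous_on S V" "AE x in lborel. x \<in> S \<longrightarrow> v x = V x"
    "\<And>x y. 0 < x \<Longrightarrow> x \<le> y \<Longrightarrow> y < 1 \<Longrightarrow> V y - V x = (LINT t:{x..y}|lborel. ?G t)"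
    using weak_gradient_real_indefinite_integral[of 0 1 v ?G] wg(3-5) unfolding S_def by auto
  define w w' where "w n = cutoff 1 (n + 2)" and "w' n = cutoff_deriv 1 (n + 2)" for n
  have wd: "(w n has_real_derivative w' n x) (at x)" for n x
    unfolding w_def w'_def by (rule cutoff_has_deriv)
  have wc: "continuous_on A (w n)" "continuous_on A (w' n)" for n A
    unfolding w_def w'_def
    by (rule continuous_on_subset[OF _ subset_UNIV], rule C_k_imp_continuous[OF C_k_cutoff] continuous_on_cutoff_deriv)+
  note [measurable] = wg(1,2) int_borel h_measurable continuous_real_measurable[OF p] continuous_real_measurable[OF r]
    continuous_real_measurable[OF wc(1)] continuous_real_measurable[OF wc(2)]
  have eq: "(LINT x:S|lborel. (h x * v x) * (w' n x * p x + w n x * r x))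
      = - (LINT x:S|lborel. (h x * ?G x) * (w n x * p x))" for n
  proof -
    define c where "c = 1 / real (n + 2)"
    define q where "q x = w n x * (h x * p x)" for x
    define q' where "q' x = w' n x * (h x * p x) + w n x * (h x * r x)" for x
    have c: "0 < c" "c \<le> 1 - c" "c < 1" by (auto simp: c_def field_simps)
    have sub: "{c..1 - c} \<subseteq> S" using c by (auto simp: S_def)
    have out: "w n x = 0" "w' n x = 0" if "x \<notin> {c..1 - c}" for x
      using that cutoff_eq_0[of x "n + 2" 1] cutoff_deriv_eq_0[of x "n + 2" 1] by (auto simp: w_def w'_def c_def)
    have ends: "q c = 0" "q (1 - c) = 0"
      using cutoff_endpoints[of "n + 2" 1] by (auto simp: q_def w_def c_def)
    have qd: "(q has_real_derivative q' x) (at x within {c..1 - c})" if "x \<in> {c..1 - c}" for x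
    proof -
      have "x \<in> S" using that sub by blast
      have "(q has_real_derivative w' n x * (h x * p x) + (h x * r x) * w n x) (at x)"
        unfolding q_def[abs_def] by (rule DERIV_mult[OF wd assms(2)[OF \<open>x \<in> S\<close>]])
      then show ?thesis by (auto simp: q'_def mult.commute intro: has_field_derivative_at_within)
    qed
    have q'c: "continuous_on {c..1 - c} q'"
      unfolding q'_def by (intro continuous_intros wc h_cont continuous_on_subset[OF p] continuous_on_subset[OF r]) auto
    have Vc: "continuous_on {c..1 - c} V" using V(1) sub by (rule continuous_on_subset)
    have Vint: "(LINT t:{c..x}|lborel. ?G t) = V x - V c" if "x \<in> {c..1 - c}" for x
      using V(3)[of c x] that c by simp
    have FTC: "(LINT x:{c..1 - c}|lborel. q' x) = 0"
    proof -
      have "(LINT x:{c..1 - c}|lborel. q' x) = q (1 - c) - q c"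
        unfolding set_lebesgue_integral_def using c qd q'c
        by (intro integral_FTC_Icc) (auto simp: has_real_derivative_iff_has_vector_derivative[symmetric])
      then show ?thesis using ends by simp
    qed
    have i1: "set_integrable lborel {c..1 - c} (\<lambda>x. V x * q' x)" "set_integrable lborel {c..1 - c} (\<lambda>x. V c * q' x)"
      unfolding set_integrable_def using q'c Vc by (intro borel_integrable_compact continuous_intros; simp)+
    have "(LINT x:{c..1 - c}|lborel. (LINT t:{c..x}|lborel. ?G t) * q' x)
        = q (1 - c) * (LINT t:{c..1 - c}|lborel. ?G t) - (LINT t:{c..1 - c}|lborel. ?G t * q t)"
      by (rule integral_by_parts_indefinite[OF c(2) L2_loc_set_integrable[OF wg(4) compact_Icc sub] _ q'c])
         (use qd in auto)
    moreover have "(LINT x:{c..1 - c}|lborel. (LINT t:{c..x}|lborel. ?G t) * q' x)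
        = (LINT x:{c..1 - c}|lborel. V x * q' x - V c * q' x)"
      by (rule set_lebesgue_integral_cong) (auto simp: Vint left_diff_distrib)
    ultimately have main: "(LINT x:{c..1 - c}|lborel. V x * q' x) = - (LINT t:{c..1 - c}|lborel. ?G t * q t)"
      using ends FTC set_integral_diff(2)[OF i1] by simp
    have q0: "q x = 0" "q' x = 0" if "x \<notin> {c..1 - c}" for x
      using out[OF that] by (auto simp: q_def q'_def)
    have toS: "(LINT x:{c..1 - c}|lborel. f x * g x) = (LINT x:S|lborel. f x * g x)" if "\<And>x. x \<notin> {c..1 - c} \<Longrightarrow> g x = 0" for f g :: "real \<Rightarrow> real"
      unfolding set_lebesgue_integral_def using that sub
      by (intro Bochner_Integration.integral_cong) (auto simp: indicator_def)
    have "(LINT x:{c..1 - c}|lborel. V x * q' x) = (LINT x:{c..1 - c}|lborel. v x * q' x)"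
    proof -
      have [measurable]: "q' \<in> borel_measurable borel" unfolding q'_def by measurable
      have [measurable]: "(\<lambda>x. indicator S x * V x) \<in> borel_measurable borel"
        using borel_measurable_continuous_on_indicator[OF int_borel V(1)] by simp
      have "(LINT x:{c..1 - c}|lborel. V x * q' x) = (LINT x:{c..1 - c}|lborel. (indicator S x * V x) * q' x)"
        by (rule set_lebesgue_integral_cong) (use sub in auto)
      also have "\<dots> = (LINT x:{c..1 - c}|lborel. v x * q' x)"
      proof (rule set_lebesgue_integral_cong_AE)
        show "AE x\<in>{c..1 - c} in lborel. indicator S x * V x * q' x = v x * q' x"
          using V(2) by eventually_elim (use sub in auto)
      qed measurable
      finally show ?thesis .
    qed
    then have "(LINT x:S|lborel. v x * q' x) = - (LINT x:S|lborel. ?G x * q x)"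
      using main toS[of q' v] toS[of q ?G] q0 by simp
    moreover have "v x * q' x = (h x * v x) * (w' n x * p x + w n x * r x)" "?G x * q x = (h x * ?G x) * (w n x * p x)" for x
      by (simp_all add: q_def q'_def algebra_simps)
    ultimately show ?thesis by simp
  qed
  obtain C where C: "\<And>x. x \<in> S \<Longrightarrow> \<bar>r x\<bar> \<le> C"
  proof -
    have "bounded (r ` {0..1})"
      using r by (intro compact_imp_bounded compact_continuous_image) (auto intro: continuous_on_subset)
    then obtain C where "\<forall>x\<in>{0..1}. \<bar>r x\<bar> \<le> C" unfolding bounded_iff by force
    then show ?thesis using that[of C] by (auto simp: S_def)
  qed
  have lims: "(\<lambda>n. w n x) \<longlonglongrightarrow> 1" "(\<lambda>n. w' n x) \<longlonglongrightarrow> 0" if "x \<in> S" for x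
    using that LIMSEQ_ignore_initial_segment[OF cutoff_tendsto[of x 1], of 2]
      LIMSEQ_ignore_initial_segment[OF cutoff_deriv_tendsto[of x 1], of 2] by (auto simp: S_def w_def w'_def)
  have wb: "\<bar>w n x * y\<bar> \<le> \<bar>y\<bar>" for n x y
    using cutoff_bounds[of 1 "n + 2" x] by (simp add: abs_mult w_def mult_left_le_one_le)
  have lim1: "(\<lambda>n. LINT x:S|lborel. (h x * v x) * (w' n x * p x + w n x * r x))
      \<longlonglongrightarrow> (LINT x:S|lborel. (h x * v x) * r x)"
  proof (rule set_integral_mult_tendsto[OF int_borel vi(1), where C = "6 * L + C"])
    show "(\<lambda>x. w' n x * p x + w n x * r x) \<in> borel_measurable borel" for n by measurable
    fix x assume x: "x \<in> S"
    show "\<bar>w' n x * p x + w n x * r x\<bar> \<le> 6 * L + C" for n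
    proof -
      have "\<bar>w' n x * p x\<bar> \<le> 6 * L" unfolding w'_def using L x by (intro cutoff_deriv_bound) auto
      moreover have "\<bar>w n x * r x\<bar> \<le> C" using wb[of n x "r x"] C[OF x] by linarith
      ultimately show ?thesis by linarith
    qed
    have "(\<lambda>n. w' n x * p x + w n x * r x) \<longlonglongrightarrow> 0 * p x + 1 * r x"
      by (intro tendsto_intros lims x)
    then show "(\<lambda>n. w' n x * p x + w n x * r x) \<longlonglongrightarrow> r x" by simp
  qed
  have lim2: "(\<lambda>n. LINT x:S|lborel. (h x * ?G x) * (w n x * p x))
      \<longlonglongrightarrow> (LINT x:S|lborel. (h x * ?G x) * p x)"
  proof (rule set_integral_mult_tendsto[OF int_borel vi(2), where C = L])
    show "(\<lambda>x. w n x * p x) \<in> borel_measurable borel" for n by measurable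
    fix x assume x: "x \<in> S"
    have "\<bar>p x\<bar> \<le> L * 1" using L(2)[OF x] mult_left_mono[of x 1 L] L(1) x by (auto simp: S_def)
    then show "\<bar>w n x * p x\<bar> \<le> L" for n using wb[of n x "p x"] by linarith
    have "(\<lambda>n. w n x * p x) \<longlonglongrightarrow> 1 * p x" by (intro tendsto_intros lims x)
    then show "(\<lambda>n. w n x * p x) \<longlonglongrightarrow> p x" by simp
  qed
  have "(LINT x:S|lborel. (h x * v x) * r x) = - (LINT x:S|lborel. (h x * ?G x) * p x)"
    by (rule LIMSEQ_unique[OF lim1[unfolded eq] tendsto_minus[OF lim2]])
  then show ?thesis by simp
qed

text \<open>The eigenfunction with frequency \<open>frequency d k\<close>, continued from the left half of the interval to
  the right half as an even or odd function about the midpoint.\<close>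

definition eigenfun :: "nat \<Rightarrow> real \<Rightarrow> real" where
  "eigenfun k x = (if x \<le> 1/2 then left_sol d (frequency d k) x else (- 1) ^ k * left_sol d (frequency d k) (1 - x))"

text \<open>The derivative of \<open>eigenfun k\<close>.\<close>

definition eigenfun_deriv :: "nat \<Rightarrow> real \<Rightarrow> real" where
  "eigenfun_deriv k x = (if x \<le> 1/2 then left_sol_deriv d (frequency d k) x
     else - ((- 1) ^ k * left_sol_deriv d (frequency d k) (1 - x)))"

lemma frequency_nonneg: "0 \<le> frequency d k" and frequency_phase: "total_phase d (frequency d k) = real k * pi"
  using frequency[OF d] by auto

lemmas left_sol_facts = left_sol_has_deriv[OF \<kappa> d frequency_nonneg] left_flux_has_deriv[OF \<kappa> d frequency_nonneg] left_sol_symmetric[OF \<kappa> d frequency_nonneg frequency_phase]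

lemma continuous_on_glue:
  fixes f g :: "real \<Rightarrow> real"
  assumes "continuous_on UNIV f" "continuous_on UNIV g" "f a = g a"
  shows "continuous_on UNIV (\<lambda>x. if x \<le> a then f x else g x)"
  using assms by (intro continuous_on_cases_le) (auto intro: continuous_on_subset)

lemma left_sol_deriv_continuous: "l \<ge> 0 \<Longrightarrow> continuous_on UNIV (left_sol_deriv d l)"
proof -
  assume l: "l \<ge> 0"
  have "continuous_on UNIV (\<lambda>x. J1 (l * x))"
    using J_scaled_deriv(2) by (blast intro: continuous_at_imp_continuous_on DERIV_isCont)
  moreover have "- l * J1 (l * d) = - l * amplitude (l * d) * sin (l * (d - d) + bessel_phase (l * d))"
    using amplitude(3)[of "l * d"] l d by simp
  ultimately show ?thesis
    unfolding left_sol_deriv_def[OF \<kappa> d l, abs_def]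
    by (intro continuous_on_glue continuous_intros)
qed

lemma eigenfun_has_deriv: "(eigenfun k has_real_derivative eigenfun_deriv k x) (at x)"
  unfolding eigenfun_def[abs_def] eigenfun_deriv_def
proof (rule has_real_derivative_glue)
  show "((\<lambda>x. (- 1) ^ k * left_sol d (frequency d k) (1 - x)) has_real_derivative
      - ((- 1) ^ k * left_sol_deriv d (frequency d k) (1 - x))) (at x)" for x
  proof -
    have "((\<lambda>x. 1 - x) has_real_derivative - 1) (at x)" by (auto intro!: derivative_eq_intros)
    from DERIV_cmult[OF DERIV_chain2[OF left_sol_facts(1)[of k] this], of "(- 1) ^ k"] show ?thesis by simp
  qed
qed (use left_sol_facts(1) left_sol_facts(3,4)[of "1/2" k] d in auto)

lemma eigenfun_deriv_continuous: "continuous_on UNIV (eigenfun_deriv k)"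
  unfolding eigenfun_deriv_def[abs_def]
proof (rule continuous_on_glue)
  have c: "continuous_on UNIV (left_sol_deriv d (frequency d k))" by (rule left_sol_deriv_continuous[OF frequency_nonneg])
  then show "continuous_on UNIV (left_sol_deriv d (frequency d k))" .
  show "continuous_on UNIV (\<lambda>x. - ((- 1) ^ k * left_sol_deriv d (frequency d k) (1 - x)))"
    by (intro continuous_intros continuous_on_compose2[OF c]) auto
qed (use left_sol_facts(4)[of "1/2" k] d in auto)

lemma eigenfun_continuous: "continuous_on UNIV (eigenfun k)"
  using eigenfun_has_deriv by (blast intro: continuous_at_imp_continuous_on DERIV_isCont)

text \<open>By the symmetry of the trigonometric part the left formula remains valid beyond the midpoint.\<close>

lemma eigenfun_left:
  assumes "x < 1 - d"
  shows "eigenfun k x = left_sol d (frequency d k) x" "eigenfun_deriv k x = left_sol_deriv d (frequency d k) x"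
proof -
  have sq: "(- 1) ^ k * ((- 1) ^ k * y) = y" for y :: real
    by (simp add: mult.assoc[symmetric] power_mult_distrib[symmetric])
  show "eigenfun k x = left_sol d (frequency d k) x" "eigenfun_deriv k x = left_sol_deriv d (frequency d k) x"
    using assms d left_sol_facts(3,4)[of x k] sq by (auto simp: eigenfun_def eigenfun_deriv_def)
qed

lemma eigenfun_flux_deriv:
  assumes x: "x \<in> S"
  shows "((\<lambda>x. h x * (- eigenfun_deriv k x)) has_real_derivative h x * ((frequency d k)\<^sup>2 * eigenfun k x)) (at x)"
proof (cases "x < 1 - d")
  case True
  let ?l = "frequency d k"
  have hl: "h y = \<kappa> * min y d" if "y < 1 - d" for y
    using trapezoid_left[OF \<kappa> d frequency_nonneg, of y] that by (simp add: h_def)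
  have "(left_flux \<kappa> d ?l has_real_derivative h x * (?l\<^sup>2 * eigenfun k x)) (at x)"
    using left_sol_facts(2)[of k x] hl[OF True] eigenfun_left(1)[OF True] by (simp add: mult.assoc)
  then show ?thesis
    by (rule has_field_derivative_transform_within_open[of _ _ _ "{..<1 - d}"])
       (use True hl eigenfun_left(2) in \<open>auto simp: left_flux_def[OF \<kappa> d frequency_nonneg]\<close>)
next
  case False
  let ?l = "frequency d k"
  have x': "x \<in> {1/2<..<1}" using False x d by (auto simp: S_def)
  have hr: "h y = \<kappa> * min (1 - y) d" if "1/2 < y" for y
    using trapezoid_left[OF \<kappa> d frequency_nonneg, of "1 - y"] that d by (simp add: h_def trapezoid_reflect)
  have "((\<lambda>x. 1 - x) has_real_derivative - 1) (at x)" by (auto intro!: derivative_eq_intros)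
  from DERIV_cmult[OF DERIV_chain2[OF left_sol_facts(2)[of k] this], of "- ((- 1) ^ k)"]
  have "((\<lambda>y. - ((- 1) ^ k) * left_flux \<kappa> d ?l (1 - y)) has_real_derivative h x * (?l\<^sup>2 * eigenfun k x)) (at x)"
    using hr[of x] x' by (simp add: eigenfun_def mult_ac)
  then show ?thesis
    by (rule has_field_derivative_transform_within_open[of _ _ _ "{1/2<..<1}"])
       (use x' hr in \<open>auto simp: left_flux_def[OF \<kappa> d frequency_nonneg] eigenfun_deriv_def\<close>)
qed

lemma eigenfun_eigenspace: "eigenfun k \<in> eigenspace S h ((frequency d k)\<^sup>2)"
proof -
  let ?l = "frequency d k"
  have fd: "eigenfun k \<in> form_domain S h"
    by (rule int_C1_weak_gradient(1)[OF eigenfun_has_deriv eigenfun_deriv_continuous])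
  obtain L where L: "L \<ge> 0" "\<And>x. 0 \<le> x \<Longrightarrow> x \<le> 1/2 \<Longrightarrow> \<bar>left_sol_deriv d ?l x\<bar> \<le> L * x"
    using left_sol_deriv_bound[OF \<kappa> d frequency_nonneg] by blast
  have b: "\<bar>- eigenfun_deriv k x\<bar> \<le> L * x \<and> \<bar>- eigenfun_deriv k x\<bar> \<le> L * (1 - x)" if "x \<in> S" for x
  proof (cases "x \<le> 1/2")
    case True
    then have "\<bar>eigenfun_deriv k x\<bar> \<le> L * x" using L(2)[of x] that by (simp add: eigenfun_deriv_def S_def)
    moreover have "L * x \<le> L * (1 - x)" using True L(1) by (intro mult_left_mono) auto
    ultimately show ?thesis by simp
  next
    case False
    then have "\<bar>eigenfun_deriv k x\<bar> \<le> L * (1 - x)"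
      using L(2)[of "1 - x"] that by (simp add: eigenfun_deriv_def S_def abs_mult)
    moreover have "L * (1 - x) \<le> L * x" using False L(1) by (intro mult_left_mono) auto
    ultimately show ?thesis by simp
  qed
  have "energy S h (eigenfun k) v = (LINT x|int_measure. ?l\<^sup>2 * eigenfun k x * v x)" if v: "v \<in> form_domain S h" for v
  proof -
    note [measurable] = weak_gradient_measurable(1)[OF v] continuous_real_measurable[OF eigenfun_continuous]
    have "energy S h (eigenfun k) v = (LINT x:S|lborel. (h x * weak_gradient S v x) * eigenfun_deriv k x)"
      unfolding energy_commute[of S h "eigenfun k"]
      by (rule int_energy_C1[OF v eigenfun_has_deriv eigenfun_deriv_continuous])
    also have "\<dots> = - (LINT x:S|lborel. (h x * weak_gradient S v x) * (- eigenfun_deriv k x))"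
      by (simp add: set_lebesgue_integral_def)
    also have "\<dots> = (LINT x:S|lborel. (h x * v x) * (?l\<^sup>2 * eigenfun k x))"
      by (subst int_by_parts[OF v eigenfun_flux_deriv _ _ L(1)])
         (use b in \<open>auto intro!: continuous_intros eigenfun_continuous eigenfun_deriv_continuous\<close>)
    also have "\<dots> = (LINT x|int_measure. ?l\<^sup>2 * eigenfun k x * v x)"
      by (subst int_integral) (auto simp: mult_ac)
    finally show ?thesis .
  qed
  then show ?thesis
    using fd L2_space_cmult[OF form_domain_L2_space[OF fd]] by (simp add: eigenspace_def neumann_operator_def)
qed

lemma eigenfun_nonzero:
  assumes "AE x in int_measure. c * eigenfun k x = 0" shows "c = 0"
proof (rule ccontr)
  assume c: "c \<noteq> 0"
  have "eigenfun k 0 = 1"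
    using d by (simp add: eigenfun_def left_sol_def[OF \<kappa> d frequency_nonneg] J0_0)
  then have "isCont (eigenfun k) 0" "eigenfun k 0 > 0"
    using eigenfun_has_deriv DERIV_isCont by (blast, simp)
  then have "eventually (\<lambda>x. eigenfun k x > 0) (at_right 0)"
    by (auto simp: continuous_at intro!: order_tendstoD(1)[of "eigenfun k" "eigenfun k 0"] tendsto_mono[OF at_le[of "{0<..}" UNIV]])
  then obtain b where b: "b > 0" "\<And>y. 0 < y \<Longrightarrow> y < b \<Longrightarrow> eigenfun k y > 0"
    by (auto simp: eventually_at_right_field)
  have "AE x in lborel. x \<in> S \<longrightarrow> eigenfun k x = 0" using assms c by (simp add: int_AE)
  then have "AE x in lborel. x \<notin> {0<..<min b 1}"
    by eventually_elim (use b(2) in \<open>force simp: S_def\<close>)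
  then have "{0<..<min b 1} \<in> null_sets lborel" by (subst AE_iff_null_sets) auto
  then show False using b(1) by (simp add: null_sets_def)
qed

lemma has_derivative_of_integral_identity:
  assumes f: "continuous_on S f"
    and F: "\<And>x y. 0 < x \<Longrightarrow> x \<le> y \<Longrightarrow> y < 1 \<Longrightarrow> F y - F x = (LINT t:{x..y}|lborel. f t :: real)"
    and x: "x \<in> S"
  shows "(F has_real_derivative f x) (at x)"
proof -
  obtain a b where ab: "0 < a" "a < x" "x < b" "b < 1"
    using x dense[of 0 x] dense[of x 1] by (auto simp: S_def)
  have sub: "{a..b} \<subseteq> S" using ab by (auto simp: S_def)
  have fc: "continuous_on {a..b} f" using f sub by (rule continuous_on_subset)
  have "((\<lambda>y. integral {a..y} f) has_real_derivative f x) (at x within {a..b})"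
    using fc ab by (intro integral_has_real_derivative) auto
  then have D: "((\<lambda>y. F a + integral {a..y} f) has_real_derivative f x) (at x within {a..b})"
    by (auto intro!: derivative_eq_intros)
  have eq: "F a + integral {a..y} f = F y" if "y \<in> {a..b}" for y
  proof -
    have "set_integrable lborel {a..y} f"
      unfolding set_integrable_def using that fc
      by (intro borel_integrable_compact) (auto intro: continuous_on_subset)
    then show ?thesis using F[of a y] set_borel_integral_eq_integral(2)[of "{a..y}" f] ab that by simp
  qed
  have "(F has_real_derivative f x) (at x within {a..b})"
    by (rule has_field_derivative_transform_within[OF D, of 1]) (use ab eq in auto)
  then show ?thesis using at_within_interior[of x "{a..b}"] ab by simp
qed

lemma set_integral_cong_AE_continuous:
  assumes a: "a \<in> borel_measurable borel" and b: "continuous_on S b"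
    and ae: "AE x in lborel. x \<in> S \<longrightarrow> a x = b x" and K: "K \<in> sets borel" "K \<subseteq> S"
  shows "(LINT x:K|lborel. a x) = (LINT x:K|lborel. b x :: real)"
proof -
  have [measurable]: "(\<lambda>x. indicator S x * b x) \<in> borel_measurable borel"
    using borel_measurable_continuous_on_indicator[OF int_borel b] by simp
  note [measurable] = a
  have "(LINT x:K|lborel. a x) = (LINT x:K|lborel. indicator S x * b x)"
  proof (rule set_lebesgue_integral_cong_AE)
    show "AE x\<in>K in lborel. a x = indicator S x * b x"
      using ae by eventually_elim (use K(2) in auto)
  qed (use K in measurable)
  also have "\<dots> = (LINT x:K|lborel. b x)"
    by (rule set_lebesgue_integral_cong) (use K in auto)
  finally show ?thesis .
qed

text \<open>The weak equation, tested with antiderivatives of test functions, shows that the flux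
  \<open>P = - h u'\<close> is the antiderivative of \<open>\<mu> h u\<close> that vanishes at both ends. The linear bounds on
  \<open>P\<close> follow from the integrability of \<open>h u\<^sup>2\<close>.\<close>

lemma eigenfunction_regularity:
  assumes u: "u \<in> eigenspace S h \<mu>"
  obtains V P C where "AE x in lborel. x \<in> S \<longrightarrow> u x = V x"
    "\<And>x. x \<in> S \<Longrightarrow> (V has_real_derivative - P x / h x) (at x)"
    "\<And>x. x \<in> S \<Longrightarrow> (P has_real_derivative \<mu> * h x * V x) (at x)"
    "\<And>x. x \<in> S \<Longrightarrow> \<bar>P x\<bar> \<le> C * x" "\<And>x. x \<in> S \<Longrightarrow> \<bar>P x\<bar> \<le> C * (1 - x)"
proof -
  let ?M = "weighted_measure S h"
  let ?G = "weak_gradient S u"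
  have ud: "u \<in> form_domain S h"
    and ue: "\<And>v. v \<in> form_domain S h \<Longrightarrow> energy S h u v = (LINT x|?M. \<mu> * u x * v x)"
    using u by (auto simp: eigenspace_def neumann_operator_def)
  note wg = weak_gradient_measurable[OF ud] and ui = int_form_domain_integrable[OF ud]
  have Sb: "S \<in> sets borel" by (rule int_borel)
  note [measurable] = wg(1,2) Sb h_measurable
  define g where "g x = indicator S x * (\<mu> * (h x * u x))" for x
  have gm [measurable]: "g \<in> borel_measurable borel" unfolding g_def by measurable
  have gint: "integrable lborel g"
    using set_integrable_mult_right[OF ui(1), of \<mu>] by (simp add: g_def[abs_def] set_integrable_def)
  have gK: "set_integrable lborel K g" if "K \<in> sets borel" for K
    unfolding set_integrable_def using integrable_mult_indicator[OF _ gint, of K] that by simp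
  have weak: "(LINT x:S|lborel. (h x * ?G x) * v' x) = (LINT x:{0..1}|lborel. g x * v x)"
    if v: "\<And>x. (v has_real_derivative v' x) (at x)" "continuous_on UNIV v'" for v v'
  proof -
    note fdv = int_C1_weak_gradient(1)[OF v]
    note [measurable] = weak_gradient_measurable(1)[OF fdv]
    have "(LINT x:S|lborel. (h x * ?G x) * v' x) = (LINT x|?M. \<mu> * u x * v x)"
      using int_energy_C1[OF ud v] ue[OF fdv] by simp
    also have "\<dots> = (LINT x:S|lborel. h x * (\<mu> * u x * v x))" by (rule int_integral) measurable
    also have "\<dots> = (LINT x:{0..1}|lborel. g x * v x)"
      unfolding set_lebesgue_integral_def
      by (intro Bochner_Integration.integral_cong) (auto simp: g_def indicator_def S_def)
    finally show ?thesis .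
  qed
  \<comment> \<open>tested with the constant function one; this is the boundary condition at the right end\<close>
  have g0: "(LINT x:{0..1}|lborel. g x) = 0"
    using weak[of "\<lambda>_. 1" "\<lambda>_. 0"] by simp
  define P where "P x = (LINT t:{0..x}|lborel. g t)" for x
  have Pdiff: "P y - P x = (LINT t:{x..y}|lborel. g t)" if "0 \<le> x" "x \<le> y" for x y
  proof -
    have "(LINT t:{0..x} \<union> {x..y}|lborel. g t) = P x + (LINT t:{x..y}|lborel. g t)"
      unfolding P_def
    proof (rule set_integral_Un_AE)
      show "AE t in lborel. \<not> (t \<in> {0..x} \<and> t \<in> {x..y})"
        using AE_lborel_singleton[of x] by eventually_elim auto
    qed (auto intro: gK)
    moreover have "{0..x} \<union> {x..y} = {0..y}" using that by auto
    ultimately show ?thesis by (simp add: P_def)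
  qed
  have P1: "P 1 = 0" using g0 by (simp add: P_def)
  have Pcont: "continuous_on {0..1} P"
  proof -
    have "g integrable_on {0..1}" using set_borel_integral_eq_integral(1)[OF gK[of "{0..1}"]] by simp
    then have "continuous_on {0..1} (\<lambda>x. integral {0..x} g)" by (rule indefinite_integral_continuous_1)
    moreover have "integral {0..x} g = P x" for x
      unfolding P_def using set_borel_integral_eq_integral(2)[OF gK[of "{0..x}"]] by simp
    ultimately show ?thesis by simp
  qed
  have Scl: "S \<subseteq> {0..1}" by (auto simp: S_def)
  have PS: "continuous_on S P" using Pcont Scl by (rule continuous_on_subset)
  have left_flux: "AE x in lborel. x \<in> S \<longrightarrow> h x * ?G x + P x = 0"
  proof (rule AE_eq_0_if_test_integrals_eq_0)
    show "open S" by (rule int_open)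
    have iP: "set_integrable lborel {0..1} P"
      unfolding set_integrable_def by (intro borel_integrable_compact Pcont) simp
    have iG: "set_integrable lborel S (\<lambda>x. h x * ?G x)" by (rule ui(2))
    show "set_integrable lborel K (\<lambda>x. h x * ?G x + P x)" if K: "compact K" "K \<subseteq> S" for K
    proof (rule set_integral_add(1))
      show "set_integrable lborel K (\<lambda>x. h x * ?G x)"
        using iG by (rule set_integrable_subset) (use K in \<open>auto intro: borel_compact\<close>)
      show "set_integrable lborel K P"
        using iP by (rule set_integrable_subset) (use K Scl in \<open>auto intro: borel_compact\<close>)
    qed
    fix \<psi> assume \<psi>: "test_function S \<psi>"
    have \<psi>c: "continuous_on UNIV \<psi>" using \<psi> by (rule test_function_continuous)
    obtain \<Phi> where "\<And>x. (\<Phi> has_vector_derivative \<psi> x) (at x)"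
      using einterval_antiderivative[of "-\<infinity>" "\<infinity>" \<psi>] \<psi>c by (auto simp: continuous_on_eq_continuous_at)
    then have \<Phi>: "(\<Phi> has_real_derivative \<psi> x) (at x)" for x
      by (simp add: has_real_derivative_iff_has_vector_derivative)
    have "(LINT x:{0..1}|lborel. P x * \<psi> x) = \<Phi> 1 * (LINT t:{0..1}|lborel. g t) - (LINT t:{0..1}|lborel. g t * \<Phi> t)"
      unfolding P_def
      by (rule integral_by_parts_indefinite) (use gK \<Phi> \<psi>c in \<open>auto intro: has_field_derivative_at_within continuous_on_subset\<close>)
    then have "(LINT x:S|lborel. (h x * ?G x) * \<psi> x) + (LINT x:{0..1}|lborel. P x * \<psi> x) = 0"
      using g0 weak[OF \<Phi> \<psi>c] by simp
    moreover have "(LINT x:{0..1}|lborel. P x * \<psi> x) = (LINT x:S|lborel. P x * \<psi> x)"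
      unfolding set_lebesgue_integral_def
    proof (rule Bochner_Integration.integral_cong)
      fix x
      have "\<psi> x = 0" if "x \<notin> S" using \<psi> that unfolding test_function_def by blast
      then show "indicator {0..1} x *\<^sub>R (P x * \<psi> x) = indicator S x *\<^sub>R (P x * \<psi> x)"
        using Scl by (cases "x \<in> S") (auto simp: indicator_def)
    qed simp
    moreover have "set_integrable lborel S (\<lambda>x. (h x * ?G x) * \<psi> x)"
    proof (rule set_integrable_mult_test_function[OF _ _ \<psi>])
      show "set_integrable lborel K (\<lambda>x. h x * ?G x)" if "compact K" "K \<subseteq> S" for K
        using iG by (rule set_integrable_subset) (use that in \<open>auto intro: borel_compact\<close>)
    qed measurable
    moreover have "set_integrable lborel S (\<lambda>x. P x * \<psi> x)"
    proof -
      have "set_integrable lborel {0..1} (\<lambda>x. P x * \<psi> x)"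
        unfolding set_integrable_def
        by (intro borel_integrable_compact continuous_intros Pcont continuous_on_subset[OF \<psi>c]) auto
      then show ?thesis by (rule set_integrable_subset) (use Scl Sb in auto)
    qed
    ultimately show "(LINT x:S|lborel. (h x * ?G x + P x) * \<psi> x) = 0"
      by (simp add: distrib_right)
  qed
  obtain V where V: "continuous_on S V" "AE x in lborel. x \<in> S \<longrightarrow> u x = V x"
    "\<And>x y. 0 < x \<Longrightarrow> x \<le> y \<Longrightarrow> y < 1 \<Longrightarrow> V y - V x = (LINT t:{x..y}|lborel. ?G t)"
    using weak_gradient_real_indefinite_integral[of 0 1 u ?G] wg(3-5) unfolding S_def by auto
  have dV: "(V has_real_derivative - P x / h x) (at x)" if "x \<in> S" for x
  proof (rule has_derivative_of_integral_identity[OF _ _ that])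
    show c: "continuous_on S (\<lambda>x. - P x / h x)"
      using h_pos by (intro continuous_intros PS h_cont) force
    have ae: "AE x in lborel. x \<in> S \<longrightarrow> ?G x = - P x / h x"
      using left_flux
    proof eventually_elim
      case (elim x)
      show ?case
      proof
        assume "x \<in> S"
        then have "h x > 0" "h x * ?G x = - P x" using h_pos elim by auto
        then show "?G x = - P x / h x" by (simp add: field_simps)
      qed
    qed
    show "V y - V x = (LINT t:{x..y}|lborel. - P t / h t)" if "0 < x" "x \<le> y" "y < 1" for x y
      unfolding V(3)[OF that]
      by (rule set_integral_cong_AE_continuous[OF wg(2) c ae]) (use that in \<open>auto simp: S_def\<close>)
  qed
  have dP: "(P has_real_derivative \<mu> * h x * V x) (at x)" if "x \<in> S" for x
  proof (rule has_derivative_of_integral_identity[OF _ _ that])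
    show c: "continuous_on S (\<lambda>x. \<mu> * h x * V x)" by (intro continuous_intros V(1) h_cont)
    have ae: "AE x in lborel. x \<in> S \<longrightarrow> g x = \<mu> * h x * V x"
      using V(2) by eventually_elim (auto simp: g_def)
    show "P y - P x = (LINT t:{x..y}|lborel. \<mu> * h t * V t)" if "0 < x" "x \<le> y" "y < 1" for x y
    proof -
      have "P y - P x = (LINT t:{x..y}|lborel. g t)" using that by (intro Pdiff) auto
      also have "\<dots> = (LINT t:{x..y}|lborel. \<mu> * h t * V t)"
        by (rule set_integral_cong_AE_continuous[OF gm c ae]) (use that in \<open>auto simp: S_def\<close>)
      finally show ?thesis .
    qed
  qed
  define E where "E = (LINT x:S|lborel. h x * (u x)\<^sup>2)"
  have bound: "\<bar>LINT t:{\<alpha>..\<beta>}|lborel. g t\<bar> \<le> \<bar>\<mu>\<bar> * (\<kappa> + E) * (\<beta> - \<alpha>)"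
    if ab: "0 \<le> \<alpha>" "\<alpha> < \<beta>" "\<beta> \<le> 1" and hb: "\<And>t. t \<in> {\<alpha>..\<beta>} \<Longrightarrow> h t \<le> \<kappa> * (\<beta> - \<alpha>)" for \<alpha> \<beta>
  proof -
    define \<rho> where "\<rho> = \<beta> - \<alpha>"
    have \<rho>: "\<rho> > 0" using ab by (simp add: \<rho>_def)
    define e where "e t = indicator S t * (h t * (u t)\<^sup>2)" for t
    have eint: "integrable lborel e" using ui(3) by (simp add: e_def[abs_def] set_integrable_def)
    have e0: "e t \<ge> 0" for t using h_pos by (auto simp: e_def indicator_def less_imp_le)
    have ie: "set_integrable lborel {\<alpha>..\<beta>} e"
      unfolding set_integrable_def using integrable_mult_indicator[OF _ eint, of "{\<alpha>..\<beta>}"] by simp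
    have eE: "(LINT t:{\<alpha>..\<beta>}|lborel. e t) \<le> E"
    proof -
      have "(LINT t:{\<alpha>..\<beta>}|lborel. e t) \<le> (\<integral>t. e t \<partial>lborel)"
        unfolding set_lebesgue_integral_def
      proof (rule integral_mono)
        show "integrable lborel (\<lambda>x. indicator {\<alpha>..\<beta>} x *\<^sub>R e x)" using ie by (simp add: set_integrable_def)
        show "indicator {\<alpha>..\<beta>} x *\<^sub>R e x \<le> e x" for x using e0[of x] by (auto simp: indicator_def)
      qed (rule eint)
      also have "\<dots> = E" by (simp add: E_def e_def[abs_def] set_lebesgue_integral_def)
      finally show ?thesis .
    qed
    have ik: "set_integrable lborel {\<alpha>..\<beta>} (\<lambda>_. \<kappa>)"
      unfolding set_integrable_def by (intro borel_integrable_compact) auto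
    have kint: "(LINT t:{\<alpha>..\<beta>}|lborel. \<kappa>) = \<kappa> * \<rho>"
      using ab by (simp add: set_lebesgue_integral_def \<rho>_def)
    have ib: "set_integrable lborel {\<alpha>..\<beta>} (\<lambda>t. \<bar>\<mu>\<bar> * (\<kappa> + \<rho> * e t))"
      by (intro set_integrable_mult_right set_integral_add(1) ik ie)
    have "\<bar>LINT t:{\<alpha>..\<beta>}|lborel. g t\<bar> \<le> (LINT t:{\<alpha>..\<beta>}|lborel. \<bar>g t\<bar>)"
      using set_integral_norm_bound[OF gK[of "{\<alpha>..\<beta>}"]] by simp
    also have "\<dots> \<le> (LINT t:{\<alpha>..\<beta>}|lborel. \<bar>\<mu>\<bar> * (\<kappa> + \<rho> * e t))"
    proof (rule set_integral_mono[OF _ ib])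
      show "set_integrable lborel {\<alpha>..\<beta>} (\<lambda>t. \<bar>g t\<bar>)" by (rule set_integrable_abs[OF gK]) simp
      fix t assume t: "t \<in> {\<alpha>..\<beta>}"
      show "\<bar>g t\<bar> \<le> \<bar>\<mu>\<bar> * (\<kappa> + \<rho> * e t)"
      proof (cases "t \<in> S")
        case True
        have hp: "h t > 0" using h_pos True by simp
        \<comment> \<open>\<open>h \<bar>u\<bar> \<le> h / \<rho> + \<rho> h u\<^sup>2\<close>, with \<open>\<rho>\<close> the length of the interval; the first term is at most \<open>\<kappa>\<close>\<close>
        have "2 * (\<rho> * \<bar>u t\<bar>) \<le> (\<rho> * u t)\<^sup>2 + 1"
          using sum_squares_bound[of "\<rho> * \<bar>u t\<bar>" 1] by (simp add: power_mult_distrib)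
        moreover have "0 \<le> \<rho> * \<bar>u t\<bar>" using \<rho> by simp
        ultimately have "\<rho> * \<bar>u t\<bar> \<le> 1 + \<rho> * (\<rho> * (u t)\<^sup>2)" by (simp add: power2_eq_square mult_ac)
        then have "h t * (\<rho> * \<bar>u t\<bar>) \<le> h t * (1 + \<rho> * (\<rho> * (u t)\<^sup>2))" using hp by (intro mult_left_mono) auto
        also have "\<dots> = h t + \<rho> * (\<rho> * e t)" using True by (simp add: e_def algebra_simps)
        also have "h t \<le> \<kappa> * \<rho>" using hb[OF t] by (simp add: \<rho>_def)
        finally have "\<rho> * (h t * \<bar>u t\<bar>) \<le> \<rho> * (\<kappa> + \<rho> * e t)" by (simp add: algebra_simps)
        then have "h t * \<bar>u t\<bar> \<le> \<kappa> + \<rho> * e t" using \<rho> by simp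
        then have "\<bar>\<mu>\<bar> * (h t * \<bar>u t\<bar>) \<le> \<bar>\<mu>\<bar> * (\<kappa> + \<rho> * e t)" by (intro mult_left_mono) auto
        then show ?thesis using True hp by (simp add: g_def abs_mult)
      next
        case False
        then show ?thesis using e0[of t] \<rho> \<kappa> by (simp add: g_def)
      qed
    qed
    also have "\<dots> = \<bar>\<mu>\<bar> * (\<kappa> * \<rho> + \<rho> * (LINT t:{\<alpha>..\<beta>}|lborel. e t))"
      using ik ie by (simp add: kint)
    also have "\<dots> \<le> \<bar>\<mu>\<bar> * (\<kappa> * \<rho> + \<rho> * E)"
      using eE \<rho> by (intro mult_left_mono add_left_mono) auto
    finally show ?thesis by (simp add: \<rho>_def algebra_simps)
  qed
  have ht: "h t \<le> \<kappa> * t" "h t \<le> \<kappa> * (1 - t)" for t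
    using \<kappa> by (auto simp: h_def trapezoid_def intro!: mult_left_mono)
  have "\<bar>P x\<bar> \<le> (\<bar>\<mu>\<bar> * (\<kappa> + E)) * x" if x: "x \<in> S" for x
  proof -
    have "h t \<le> \<kappa> * (x - 0)" if "t \<in> {0..x}" for t
    proof -
      have "\<kappa> * t \<le> \<kappa> * (x - 0)" using that \<kappa> by (intro mult_left_mono) auto
      then show ?thesis using ht(1)[of t] by simp
    qed
    then show ?thesis using bound[of 0 x] x by (simp add: P_def S_def)
  qed
  moreover have "\<bar>P x\<bar> \<le> (\<bar>\<mu>\<bar> * (\<kappa> + E)) * (1 - x)" if x: "x \<in> S" for x
  proof -
    have "h t \<le> \<kappa> * (1 - x)" if "t \<in> {x..1}" for t
    proof -
      have "\<kappa> * (1 - t) \<le> \<kappa> * (1 - x)" using that \<kappa> by (intro mult_left_mono) auto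
      then show ?thesis using ht(2)[of t] by simp
    qed
    moreover have "- P x = (LINT t:{x..1}|lborel. g t)" using Pdiff[of x 1] P1 x by (simp add: S_def)
    ultimately show ?thesis using bound[of x 1] x by (simp add: S_def)
  qed
  ultimately show ?thesis using that[OF V(2) dV dP] by blast
qed

text \<open>The left solution with factor \<open>c1\<close> and the reflected one with factor \<open>c2\<close> agree at the midpoint in
  value and flux. So either the flux vanishes there and \<open>c1 = c2\<close>, or the value vanishes there and
  \<open>c1 = - c2\<close>; in both cases the total phase is a multiple of \<open>\<pi>\<close>.\<close>

lemma eigenspace_solution:
  assumes l: "l \<ge> 0" and u: "u \<in> eigenspace S h (l\<^sup>2)"
    and nz: "\<not> (AE x in weighted_measure S h. u x = 0)"
  obtains k c where "l = frequency d k" "AE x in weighted_measure S h. u x = c * eigenfun k x"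
proof -
  let ?left_sol = "left_sol d l" and ?left_flux = "left_flux \<kappa> d l"
  obtain V P C where V: "AE x in lborel. x \<in> S \<longrightarrow> u x = V x"
    and dV: "\<And>x. x \<in> S \<Longrightarrow> (V has_real_derivative - P x / h x) (at x)"
    and dP: "\<And>x. x \<in> S \<Longrightarrow> (P has_real_derivative l\<^sup>2 * h x * V x) (at x)"
    and bd: "\<And>x. x \<in> S \<Longrightarrow> \<bar>P x\<bar> \<le> C * x" "\<And>x. x \<in> S \<Longrightarrow> \<bar>P x\<bar> \<le> C * (1 - x)"
    by (rule eigenfunction_regularity[OF u]) (rule that; blast)
  have inS: "x \<in> S" "1 - x \<in> S" if "0 < x" "x < 1 - d" for x using that d by (auto simp: S_def)
  obtain c1 where c1: "\<And>x. 0 < x \<Longrightarrow> x < 1 - d \<Longrightarrow> V x = c1 * ?left_sol x \<and> P x = c1 * ?left_flux x"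
  proof (rule left_solution_unique[OF \<kappa> d l, of V P C])
    fix x assume x: "0 < x" "x < 1 - d"
    show "(V has_real_derivative - P x / trapezoid \<kappa> d x) (at x)" using dV[OF inS(1)[OF x]] by (simp add: h_def)
    show "(P has_real_derivative l\<^sup>2 * trapezoid \<kappa> d x * V x) (at x)" using dP[OF inS(1)[OF x]] by (simp add: h_def)
    show "\<bar>P x\<bar> \<le> C * x" by (rule bd(1)[OF inS(1)[OF x]])
  qed blast
  obtain c2 where c2: "\<And>x. 0 < x \<Longrightarrow> x < 1 - d \<Longrightarrow> V (1 - x) = c2 * ?left_sol x \<and> - P (1 - x) = c2 * ?left_flux x"
  proof (rule left_solution_unique[OF \<kappa> d l, of "\<lambda>x. V (1 - x)" "\<lambda>x. - P (1 - x)" C])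
    fix x assume x: "0 < x" "x < 1 - d"
    have r: "((\<lambda>x. 1 - x) has_real_derivative - 1) (at x)" by (auto intro!: derivative_eq_intros)
    show "((\<lambda>x. V (1 - x)) has_real_derivative - (- P (1 - x)) / trapezoid \<kappa> d x) (at x)"
      using DERIV_chain2[OF dV[OF inS(2)[OF x]] r] by (simp add: h_def trapezoid_reflect)
    show "((\<lambda>x. - P (1 - x)) has_real_derivative l\<^sup>2 * trapezoid \<kappa> d x * V (1 - x)) (at x)"
      using DERIV_minus[OF DERIV_chain2[OF dP[OF inS(2)[OF x]] r]] by (simp add: h_def trapezoid_reflect)
    show "\<bar>- P (1 - x)\<bar> \<le> C * x" using bd(2)[OF inS(2)[OF x]] by simp
  qed blast
  let ?s = "?left_sol (1/2)" and ?f = "?left_flux (1/2)"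
  have half: "c1 * ?s = c2 * ?s" "c1 * ?f = - (c2 * ?f)"
    using c1[of "1/2"] c2[of "1/2"] d by auto
  have c: "\<not> (c1 = 0 \<and> c2 = 0)"
  proof
    assume 0: "c1 = 0 \<and> c2 = 0"
    have V0: "V x = 0" if "x \<in> S" for x
      using c1[of x] c2[of "1 - x"] that 0 d by (cases "x < 1 - d") (auto simp: S_def)
    have "AE x in lborel. x \<in> S \<longrightarrow> u x = 0" using V by eventually_elim (use V0 in auto)
    then show False using nz by (simp add: int_AE)
  qed
  have "?s = 0 \<or> ?f = 0"
  proof (rule ccontr)
    assume "\<not> ?thesis"
    moreover have "(c1 - c2) * ?s = 0" "(c1 + c2) * ?f = 0"
      using half by (simp_all add: left_diff_distrib distrib_right)
    ultimately have "c1 - c2 = 0" "c1 + c2 = 0" by (metis mult_eq_0_iff)+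
    then show False using c by simp
  qed
  have ph0: "total_phase d 0 = 0" by (simp add: total_phase_def bessel_phase_0)
  have "sin (total_phase d l) = 0"
  proof (cases "l = 0")
    case False
    have "l * d \<ge> 0" using l d by simp
    then have "cos (total_phase d l / 2) = 0 \<or> sin (total_phase d l / 2) = 0"
      using \<open>?s = 0 \<or> ?f = 0\<close> amplitude(1)[of "l * d"] \<kappa> d False unfolding left_sol_half[OF \<kappa> d l] by auto
    then show ?thesis using sin_double[of "total_phase d l / 2"] by auto
  qed (simp add: ph0)
  then obtain i :: int where i: "total_phase d l = of_int i * pi" using sin_zero_iff_int2 by blast
  have "0 \<le> l * (1 - 2 * d)" using l d by simp
  then have "0 \<le> total_phase d l" using total_phase_growth[OF d order.refl l] ph0 by simp
  then have "i \<ge> 0" unfolding i using pi_gt_zero by (simp add: zero_le_mult_iff)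
  then have ik: "total_phase d l = real (nat i) * pi" using i by simp
  define k where "k = nat i"
  have k: "l = frequency d k" using frequency_unique[OF d l ik] by (simp add: k_def)
  have sym: "?s = (- 1) ^ k * ?s" "left_sol_deriv d l (1/2) = - ((- 1) ^ k * left_sol_deriv d l (1/2))"
    using left_sol_symmetric[OF \<kappa> d l ik, of "1/2"] d by (simp_all add: k_def)
  have fsym: "?f = - ((- 1) ^ k * ?f)"
  proof -
    have "- m * D = - (e * (- m * D))" if "D = - (e * D)" for m D e :: real
    proof -
      have "m * D = m * (- (e * D))" using that by (rule arg_cong)
      then show ?thesis by (simp add: mult.left_commute)
    qed
    from this[OF sym(2)] show ?thesis unfolding left_flux_def[OF \<kappa> d l] .
  qed
  have cc: "c2 = c1 * (- 1) ^ k"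
  proof (cases "?s = 0")
    case False
    then have "(- 1) ^ k = (1::real)" using sym(1) by simp
    moreover have "c1 = c2" using half(1) False by simp
    ultimately show ?thesis by simp
  next
    case True
    then have f: "?f \<noteq> 0" using left_sol_nontrivial[OF \<kappa> d l, of "1/2"] by auto
    have "(1 + (- 1) ^ k) * ?f = 0" using fsym unfolding distrib_right by linarith
    then have "(- 1) ^ k = (- 1 :: real)" using f by simp
    moreover have "(c1 + c2) * ?f = 0" using half(2) by (simp add: distrib_right)
    ultimately show ?thesis using f by simp
  qed
  have Vk: "V x = c1 * eigenfun k x" if x: "x \<in> S" for x
  proof (cases "x \<le> 1/2")
    case True
    then show ?thesis
      using c1[of x] x d eigenfun_def[of k x] by (auto simp: S_def k)
  next
    case False
    then show ?thesis
      using c2[of "1 - x"] x d cc eigenfun_def[of k x] by (auto simp: S_def k)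
  qed
  have "AE x in weighted_measure S h. u x = c1 * eigenfun k x"
    unfolding int_AE using V by eventually_elim (use Vk in auto)
  then show ?thesis using that k by blast
qed

lemma eigenspace_negative:
  assumes \<mu>: "\<mu> < 0" and u: "u \<in> eigenspace S h \<mu>"
  shows "AE x in weighted_measure S h. u x = 0"
proof -
  let ?M = "weighted_measure S h"
  have ud: "u \<in> form_domain S h" and ue: "energy S h u u = (LINT x|?M. \<mu> * u x * u x)"
    using u by (auto simp: eigenspace_def neumann_operator_def)
  have uL: "u \<in> L2_space ?M" by (rule form_domain_L2_space[OF ud])
  have "0 \<le> energy S h u u" unfolding energy_def by (intro integral_nonneg_AE) auto
  then have "0 \<le> \<mu> * (LINT x|?M. u x * u x)" unfolding ue by (simp add: mult.assoc)
  moreover have "0 \<le> (LINT x|?M. u x * u x)" by (intro integral_nonneg_AE) auto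
  ultimately have "(LINT x|?M. u x * u x) = 0" using \<mu> by (simp add: zero_le_mult_iff)
  then have "AE x in ?M. u x * u x = 0"
    using integral_nonneg_eq_0_iff_AE[OF L2_space_mult_integrable[OF uL uL]] by simp
  then show ?thesis by eventually_elim simp
qed

lemma interval_eigenspace_dim:
  "has_dim_AE (weighted_measure S h) (eigenspace S h \<mu>) (card {k \<in> UNIV. (frequency d k)\<^sup>2 = \<mu>})"
    (is "has_dim_AE ?M _ (card ?K)")
proof (cases "\<exists>k. (frequency d k)\<^sup>2 = \<mu>")
  case True
  then obtain k where k: "(frequency d k)\<^sup>2 = \<mu>" by blast
  have inj: "j = i" if "(frequency d i)\<^sup>2 = (frequency d j)\<^sup>2" for i j
  proof -
    have "frequency d i = frequency d j"
      using that frequency(1)[OF d] by (simp add: power2_eq_iff_nonneg)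
    then show ?thesis using frequency_strict_mono[OF d, of i j] frequency_strict_mono[OF d, of j i] by force
  qed
  have "?K = {k}" using inj k by auto
  then have card: "card ?K = 1" by simp
  show ?thesis
    unfolding card has_dim_AE_def
  proof (intro exI[of _ "\<lambda>_. eigenfun k"] conjI allI impI ballI)
    show "eigenfun k \<in> eigenspace S h \<mu>" using eigenfun_eigenspace[of k] k by simp
    show "c i = 0" if "AE x in ?M. (\<Sum>i<1. c i * eigenfun k x) = 0" "i < 1" for c :: "nat \<Rightarrow> real" and i
      using eigenfun_nonzero[of "c 0" k] that by simp
    fix u assume u: "u \<in> eigenspace S h \<mu>"
    show "\<exists>c :: nat \<Rightarrow> real. AE x in ?M. u x = (\<Sum>i<1. c i * eigenfun k x)"
    proof (cases "AE x in ?M. u x = 0")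
      case True
      then show ?thesis by (intro exI[of _ "\<lambda>_. 0"]) simp
    next
      case False
      obtain j c where j: "frequency d k = frequency d j" and ae: "AE x in ?M. u x = c * eigenfun j x"
        using eigenspace_solution[OF frequency(1)[OF d], of u k] u k False by metis
      have "j = k" using inj[of k j] j by simp
      then show ?thesis using ae by (intro exI[of _ "\<lambda>_. c"]) simp
    qed
  qed
next
  case False
  have "AE x in ?M. u x = 0" if u: "u \<in> eigenspace S h \<mu>" for u
  proof (cases "\<mu> < 0")
    case True
    then show ?thesis using eigenspace_negative u by blast
  next
    case nonneg: False
    show ?thesis
    proof (rule ccontr)
      assume "\<not> ?thesis"
      moreover have "u \<in> eigenspace S h ((sqrt \<mu>)\<^sup>2)" "0 \<le> sqrt \<mu>" using u nonneg by simp_all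
      ultimately obtain k where "sqrt \<mu> = frequency d k" using eigenspace_solution by metis
      then have "(frequency d k)\<^sup>2 = \<mu>" using nonneg by (metis not_le_imp_less real_sqrt_pow2)
      then show False using False by blast
    qed
  qed
  moreover have "card ?K = 0" using False by simp
  ultimately show ?thesis unfolding has_dim_AE_def by auto
qed

lemma interval_weighted_neumann_eigenvalue:
  "weighted_neumann_eigenvalue S h k = (frequency d k)\<^sup>2"
proof (rule weighted_neumann_eigenvalue_eqI[where \<beta> = id and I = UNIV and \<nu> = "\<lambda>k. (frequency d k)\<^sup>2", simplified id_apply])
  have sm: "(frequency d i)\<^sup>2 < (frequency d j)\<^sup>2" if "i < j" for i j
    using frequency_strict_mono[OF d that] frequency(1)[OF d] by (intro power_strict_mono) auto
  show "bij_betw id UNIV UNIV" by simp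
  show "mono (\<lambda>k. (frequency d k)\<^sup>2)"
    using sm by (intro monoI) (metis less_eq_real_def nat_less_le)
  show "has_dim_AE (weighted_measure S h) (eigenspace S h \<mu>) (card {k \<in> UNIV. (frequency d k)\<^sup>2 = \<mu>})" for \<mu>
    by (rule interval_eigenspace_dim)
  show "finite {k \<in> UNIV. (frequency d k)\<^sup>2 = \<mu>}" for \<mu>
  proof (rule finite_subset)
    show "{k \<in> UNIV. (frequency d k)\<^sup>2 = \<mu>} \<subseteq> {LEAST k. (frequency d k)\<^sup>2 = \<mu>}"
    proof
      fix j assume j: "j \<in> {k \<in> UNIV. (frequency d k)\<^sup>2 = \<mu>}"
      then have "(frequency d (LEAST k. (frequency d k)\<^sup>2 = \<mu>))\<^sup>2 = (frequency d j)\<^sup>2"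
        by simp (rule LeastI)
      then have "(LEAST k. (frequency d k)\<^sup>2 = \<mu>) = j"
        using sm[of j "LEAST k. (frequency d k)\<^sup>2 = \<mu>"] sm[of "LEAST k. (frequency d k)\<^sup>2 = \<mu>" j] by force
      then show "j \<in> {LEAST k. (frequency d k)\<^sup>2 = \<mu>}" by simp
    qed
  qed simp
qed

end

section \<open>The geometry of the rectangle\<close>

context
  fixes \<epsilon> :: real
  assumes eps: "0 < \<epsilon>" "\<epsilon> < 1 / sqrt 2"
begin

lemma eps_square: "0 < \<epsilon>\<^sup>2" "\<epsilon>\<^sup>2 < 1/2"
proof -
  show "0 < \<epsilon>\<^sup>2" using eps by simp
  have "\<epsilon>\<^sup>2 < (1 / sqrt 2)\<^sup>2" using eps by (intro power_strict_mono) auto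
  then show "\<epsilon>\<^sup>2 < 1/2" by (simp add: power_divide)
qed

lemma side_square: "(side \<epsilon>)\<^sup>2 = 1 - \<epsilon>\<^sup>2"
  using eps_square by (simp add: side_def)

lemma side_pos: "0 < side \<epsilon>" using eps_square by (simp add: side_def)

lemma side_gt: "\<epsilon> < side \<epsilon>"
proof (rule power_less_imp_less_base)
  show "\<epsilon>\<^sup>2 < (side \<epsilon>)\<^sup>2" using eps_square by (simp add: side_square)
qed (use side_pos in simp)

lemma closure_rectangle: "closure (rectangle \<epsilon>) = {0..side \<epsilon>} \<times> {0..\<epsilon>}"
  using side_pos eps by (simp add: rectangle_def closure_Times)

lemma bounded_rectangle: "bounded (rectangle \<epsilon>)"
  unfolding rectangle_def by (intro bounded_Times) auto

lemma corners_in_closure: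
  "(0, 0) \<in> closure (rectangle \<epsilon>)" "(side \<epsilon>, \<epsilon>) \<in> closure (rectangle \<epsilon>)"
  "(side \<epsilon>, 0) \<in> closure (rectangle \<epsilon>)" "(0, \<epsilon>) \<in> closure (rectangle \<epsilon>)"
  unfolding closure_rectangle using side_pos eps by auto

lemma norm_diagonal: "norm (side \<epsilon>, \<epsilon>) = 1"
  using side_square by (simp add: norm_Pair)

lemma dist_diagonal: "dist (0, 0) (side \<epsilon>, \<epsilon>) = 1"
  using norm_diagonal by (simp add: dist_norm norm_Pair)

lemma diameter_rectangle: "diameter (rectangle \<epsilon>) = 1"
proof -
  have "diameter (closure (rectangle \<epsilon>)) \<le> 1"
  proof (rule diameter_le)
    fix x y assume "x \<in> closure (rectangle \<epsilon>)" "y \<in> closure (rectangle \<epsilon>)"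
    then have "\<bar>fst x - fst y\<bar> \<le> side \<epsilon>" "\<bar>snd x - snd y\<bar> \<le> \<epsilon>"
      unfolding closure_rectangle by auto
    then have "(fst x - fst y)\<^sup>2 \<le> (side \<epsilon>)\<^sup>2" "(snd x - snd y)\<^sup>2 \<le> \<epsilon>\<^sup>2"
      by (metis abs_ge_zero power2_abs power_mono)+
    then have "(fst x - fst y)\<^sup>2 + (snd x - snd y)\<^sup>2 \<le> 1" unfolding side_square by linarith
    then have "sqrt ((fst x - fst y)\<^sup>2 + (snd x - snd y)\<^sup>2) \<le> sqrt 1" by (rule real_sqrt_le_mono)
    then show "norm (x - y) \<le> 1" by (simp add: norm_prod_def)
  qed simp
  moreover have "1 \<le> diameter (closure (rectangle \<epsilon>))"
    using diameter_bounded_bound[OF bounded_closure[OF bounded_rectangle] corners_in_closure(1,2)] dist_diagonal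
    by simp
  ultimately show ?thesis using diameter_closure[OF bounded_rectangle] by simp
qed

lemma min_width_rectangle: "min_width (rectangle \<epsilon>) = \<epsilon>"
proof -
  let ?w = "\<lambda>e. diameter (proj_perp e ` rectangle \<epsilon>)"
  have lower: "\<epsilon> \<le> ?w e" if e: "e \<in> sphere 0 1" for e
  proof -
    obtain e1 e2 where e12: "e = (e1, e2)" by (cases e)
    have e1: "e1\<^sup>2 + e2\<^sup>2 = 1" using e by (simp add: e12 norm_Pair)
    have lin: "bounded_linear (proj_perp e)"
      unfolding proj_perp_def[abs_def]
      by (intro bounded_linear_sub bounded_linear_ident bounded_linear_compose[OF bounded_linear_scaleR_left bounded_linear_inner_left])
    have cont: "continuous_on A (proj_perp e)" for A
      using linear_continuous_on[OF lin] .
    have bdd: "bounded (proj_perp e ` rectangle \<epsilon>)"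
      by (rule bounded_linear_image[OF bounded_rectangle lin])
    have "proj_perp e ` closure (rectangle \<epsilon>) \<subseteq> closure (proj_perp e ` rectangle \<epsilon>)"
      by (rule image_closure_subset[OF cont]) (auto intro: closure_subset[THEN subsetD])
    then have corner: "norm (proj_perp e p - proj_perp e q) \<le> ?w e"
      if "p \<in> closure (rectangle \<epsilon>)" "q \<in> closure (rectangle \<epsilon>)" for p q
      using diameter_bounded_bound[OF bounded_closure[OF bdd], of "proj_perp e p" "proj_perp e q"] that
        diameter_closure[OF bdd] by (auto simp: dist_norm)
    have nrm: "norm (proj_perp e z) = \<bar>fst z * e2 - snd z * e1\<bar>" for z
    proof -
      have "(norm (proj_perp e z))\<^sup>2 = (fst z - (fst z * e1 + snd z * e2) * e1)\<^sup>2 + (snd z - (fst z * e1 + snd z * e2) * e2)\<^sup>2"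
        by (simp add: norm_prod_def proj_perp_def e12 inner_prod_def)
      also have "\<dots> = (fst z * e2 - snd z * e1)\<^sup>2" using e1 by algebra
      finally show ?thesis by (metis abs_ge_zero norm_ge_zero power2_abs power2_eq_imp_eq)
    qed
    have diff: "proj_perp e p - proj_perp e q = proj_perp e (p - q)" for p q
      using linear_diff[OF bounded_linear.linear[OF lin]] by simp
    \<comment> \<open>the two diagonals of the rectangle\<close>
    have w1: "\<bar>side \<epsilon> * e2 - \<epsilon> * e1\<bar> \<le> ?w e"
      using corner[OF corners_in_closure(2,1)] unfolding diff nrm by simp
    have w2: "\<bar>side \<epsilon> * e2 + \<epsilon> * e1\<bar> \<le> ?w e"
      using corner[OF corners_in_closure(3,4)] unfolding diff nrm by simp
    have "side \<epsilon> * \<bar>e2\<bar> + \<epsilon> * \<bar>e1\<bar> = \<bar>side \<epsilon> * e2\<bar> + \<bar>\<epsilon> * e1\<bar>"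
      using side_pos eps by (simp add: abs_mult)
    also have "\<dots> \<le> ?w e" using w1 w2 by linarith
    finally have "side \<epsilon> * \<bar>e2\<bar> + \<epsilon> * \<bar>e1\<bar> \<le> ?w e" .
    moreover have "\<epsilon> * \<bar>e2\<bar> \<le> side \<epsilon> * \<bar>e2\<bar>" using side_gt by (intro mult_right_mono) auto
    moreover have "1 \<le> \<bar>e1\<bar> + \<bar>e2\<bar>"
    proof (rule power2_le_imp_le)
      have "1\<^sup>2 = \<bar>e1\<bar>\<^sup>2 + \<bar>e2\<bar>\<^sup>2" using e1 by simp
      also have "\<dots> \<le> (\<bar>e1\<bar> + \<bar>e2\<bar>)\<^sup>2" unfolding power2_sum by simp
      finally show "1\<^sup>2 \<le> (\<bar>e1\<bar> + \<bar>e2\<bar>)\<^sup>2" .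
    qed simp
    then have "\<epsilon> * 1 \<le> \<epsilon> * (\<bar>e1\<bar> + \<bar>e2\<bar>)" using eps by (intro mult_left_mono) auto
    ultimately show ?thesis by (simp add: distrib_left)
  qed
  have upper: "?w (1, 0) \<le> \<epsilon>"
  proof (rule diameter_le)
    fix x y assume "x \<in> proj_perp (1, 0) ` rectangle \<epsilon>" "y \<in> proj_perp (1, 0) ` rectangle \<epsilon>"
    then have "fst x = 0" "fst y = 0" "\<bar>snd x - snd y\<bar> \<le> \<epsilon>"
      by (auto simp: proj_perp_def rectangle_def)
    then show "norm (x - y) \<le> \<epsilon>" by (simp add: norm_prod_def)
  qed (use eps in auto)
  have ne: "(1, 0) \<in> sphere (0 :: real \<times> real) 1" by (simp add: norm_Pair)
  show ?thesis
    unfolding min_width_def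
  proof (rule antisym)
    have "(INF e\<in>sphere 0 1. ?w e) \<le> ?w (1, 0)"
      using lower ne by (intro cINF_lower bdd_belowI2[of _ \<epsilon>]) auto
    then show "(INF e\<in>sphere 0 1. ?w e) \<le> \<epsilon>" using upper by linarith
    show "\<epsilon> \<le> (INF e\<in>sphere 0 1. ?w e)"
      using ne lower by (intro cINF_greatest) auto
  qed
qed

text \<open>The perpendicular line through the point at arclength \<open>x\<close> meets the rectangle in the parameter
  interval from \<open>lo\<close> to \<open>up\<close>; which side of the rectangle bounds it changes at \<open>x = \<epsilon>\<^sup>2\<close> and at
  \<open>x = 1 - \<epsilon>\<^sup>2\<close>.\<close>

lemma section_length_rectangle:
  assumes x: "0 < x" "x < 1"
  shows "section_length (rectangle \<epsilon>) (0, 0) (side \<epsilon>, \<epsilon>) x = trapezoid (1 / (side \<epsilon> * \<epsilon>)) (\<epsilon>\<^sup>2) x"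
proof -
  define a where "a = side \<epsilon>"
  have a: "a > 0" "a * a = 1 - \<epsilon> * \<epsilon>" using side_pos side_square by (simp_all add: a_def power2_eq_square)
  have ee: "\<epsilon> * \<epsilon> < 1/2" using eps_square by (simp add: power2_eq_square)
  have sgn: "sgn ((side \<epsilon>, \<epsilon>) - (0, 0)) = (a, \<epsilon>)"
    using norm_diagonal by (simp add: sgn_div_norm a_def)
  define lo where "lo = max (- (1 - x) * a / \<epsilon>) (- x * \<epsilon> / a)"
  define up where "up = min (x * a / \<epsilon>) ((1 - x) * \<epsilon> / a)"
  have "(0, 0) + x *\<^sub>R (a, \<epsilon>) + t *\<^sub>R rot90 (a, \<epsilon>) \<in> rectangle \<epsilon> \<longleftrightarrow> t \<in> {lo<..<up}" for t
  proof -
    have "0 < x * a - t * \<epsilon> \<longleftrightarrow> t < x * a / \<epsilon>" "x * a - t * \<epsilon> < a \<longleftrightarrow> - (1 - x) * a / \<epsilon> < t"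
      "0 < x * \<epsilon> + t * a \<longleftrightarrow> - x * \<epsilon> / a < t" "x * \<epsilon> + t * a < \<epsilon> \<longleftrightarrow> t < (1 - x) * \<epsilon> / a"
      using a eps by (auto simp: field_simps)
    then show ?thesis by (auto simp: rectangle_def rot90_def lo_def up_def a_def)
  qed
  then have seteq: "{t. (0, 0) + x *\<^sub>R (a, \<epsilon>) + t *\<^sub>R rot90 (a, \<epsilon>) \<in> rectangle \<epsilon>} = {lo<..<up}" by blast
  have "section_length (rectangle \<epsilon>) (0, 0) (side \<epsilon>, \<epsilon>) x = measure lborel {lo<..<up}"
    unfolding section_length_def Let_def sgn seteq ..
  moreover have up: "up = (if x \<le> \<epsilon>\<^sup>2 then x * a / \<epsilon> else (1 - x) * \<epsilon> / a)"
  proof -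
    have "x * a / \<epsilon> \<le> (1 - x) * \<epsilon> / a \<longleftrightarrow> x * (a * a) \<le> (1 - x) * (\<epsilon> * \<epsilon>)"
      using a(1) eps by (simp add: field_simps)
    also have "\<dots> \<longleftrightarrow> x \<le> \<epsilon>\<^sup>2" unfolding a(2) by (simp add: power2_eq_square algebra_simps)
    finally show ?thesis by (auto simp: up_def min_def)
  qed
  moreover have lo: "- lo = (if 1 - x \<le> \<epsilon>\<^sup>2 then (1 - x) * a / \<epsilon> else x * \<epsilon> / a)"
  proof -
    have "(1 - x) * a / \<epsilon> \<le> x * \<epsilon> / a \<longleftrightarrow> (1 - x) * (a * a) \<le> x * (\<epsilon> * \<epsilon>)"
      using a(1) eps by (simp add: field_simps)
    also have "\<dots> \<longleftrightarrow> 1 - x \<le> \<epsilon>\<^sup>2" unfolding a(2) by (simp add: power2_eq_square algebra_simps)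
    finally have iff: "(1 - x) * a / \<epsilon> \<le> x * \<epsilon> / a \<longleftrightarrow> 1 - x \<le> \<epsilon>\<^sup>2" .
    have "- max (- s) (- r) = (if s \<le> r then s else r)" for r s :: real by simp
    from this[of "(1 - x) * a / \<epsilon>" "x * \<epsilon> / a"] show ?thesis
      unfolding lo_def iff by (simp only: minus_divide_left mult_minus_left)
  qed
  have sum: "y * a / \<epsilon> + y * \<epsilon> / a = 1 / (a * \<epsilon>) * y" for y
  proof -
    have "y * a / \<epsilon> + y * \<epsilon> / a = y * (a * a + \<epsilon> * \<epsilon>) / (a * \<epsilon>)"
      using a(1) eps by (simp add: field_simps)
    then show ?thesis using a(2) by simp
  qed
  have diff: "up - lo = trapezoid (1 / (a * \<epsilon>)) (\<epsilon>\<^sup>2) x"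
  proof -
    consider "x \<le> \<epsilon>\<^sup>2" | "\<epsilon>\<^sup>2 < x" "x < 1 - \<epsilon>\<^sup>2" | "1 - \<epsilon>\<^sup>2 \<le> x" by linarith
    then show ?thesis
    proof cases
      case 1
      then have "up - lo = x * a / \<epsilon> + x * \<epsilon> / a" using up lo eps_square by simp
      moreover have "min x (min (\<epsilon>\<^sup>2) (1 - x)) = x" using 1 eps_square by (simp add: min_def)
      ultimately show ?thesis using sum[of x] by (simp add: trapezoid_def)
    next
      case 2
      then have "up - lo = (1 - x) * \<epsilon> / a + x * \<epsilon> / a" using up lo by simp
      also have "\<dots> = \<epsilon> / a" by (simp add: add_divide_distrib[symmetric] algebra_simps)
      finally have "up - lo = 1 / (a * \<epsilon>) * \<epsilon>\<^sup>2" using eps by (simp add: power2_eq_square)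
      moreover have "min x (min (\<epsilon>\<^sup>2) (1 - x)) = \<epsilon>\<^sup>2" using 2 by (simp add: min_def)
      ultimately show ?thesis by (simp add: trapezoid_def)
    next
      case 3
      then have "up - lo = (1 - x) * a / \<epsilon> + (1 - x) * \<epsilon> / a" using up lo eps_square by simp
      moreover have "min x (min (\<epsilon>\<^sup>2) (1 - x)) = 1 - x" using 3 eps_square by (simp add: min_def)
      ultimately show ?thesis using sum[of "1 - x"] by (simp add: trapezoid_def)
    qed
  qed
  have "0 < trapezoid (1 / (a * \<epsilon>)) (\<epsilon>\<^sup>2) x"
    using a eps eps_square x by (intro trapezoid_pos) auto
  then have "lo \<le> up" using diff by linarith
  ultimately show ?thesis using diff by (simp add: a_def)
qed

lemma weighted_neumann_eigenvalue_cong: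
  "weighted_measure S w = weighted_measure S w' \<Longrightarrow> weighted_neumann_eigenvalue S w = weighted_neumann_eigenvalue S w'"
  unfolding weighted_neumann_eigenvalue_def enumerates_eigenvalues_def eigenspace_def neumann_operator_def
    form_domain_def energy_def by simp

lemma mu_N_eq: "mu_N k \<epsilon> = (frequency (\<epsilon>\<^sup>2) k)\<^sup>2"
proof -
  let ?h = "trapezoid (1 / (side \<epsilon> * \<epsilon>)) (\<epsilon>\<^sup>2)"
  have "weighted_measure {0<..<1} (section_length (rectangle \<epsilon>) (0, 0) (side \<epsilon>, \<epsilon>)) = weighted_measure {0<..<1} ?h"
    by (rule weighted_measure_cong) (simp add: section_length_rectangle)
  then have "mu_N k \<epsilon> = weighted_neumann_eigenvalue {0<..<1} ?h k"
    unfolding mu_N_def interval_eigenvalue_def by (metis weighted_neumann_eigenvalue_cong)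
  also have "\<dots> = (frequency (\<epsilon>\<^sup>2) k)\<^sup>2"
    using side_pos eps by (intro interval_weighted_neumann_eigenvalue[OF _ eps_square refl refl]) auto
  finally show ?thesis .
qed

lemma mu_Omega_eq:
  assumes "real k * \<epsilon> < side \<epsilon>"
  shows "mu_Omega k \<epsilon> = (real k * pi)\<^sup>2 / (1 - \<epsilon>\<^sup>2)"
  using rect_neumann_eigenvalue[OF side_pos eps(1) _ assms, of "rectangle \<epsilon>"]
  by (simp add: mu_Omega_def rectangle_def power_divide side_square)

end

section \<open>The expansion of the eigenvalue difference\<close>

text \<open>With \<open>d = \<epsilon>\<^sup>2\<close> the subtracted term \<open>K\<^sup>2 / (1 - d)\<close> is the eigenvalue of the rectangle.\<close>

lemma frequency_asymptotics:
  fixes K :: real and k :: nat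
  defines "K \<equiv> real k * pi"
  assumes d: "0 < d" "d \<le> 1/4" "d * (4 * K) \<le> 1"
  shows "\<bar>(frequency d k)\<^sup>2 - K\<^sup>2 / (1 - d) - (K\<^sup>2 * d + 2 * K\<^sup>2 * d\<^sup>2)\<bar> \<le> (256 * K ^ 4 + 12 * K\<^sup>2) * d ^ 3"
proof -
  let ?l = "frequency d k"
  have d2: "0 < d" "d < 1/2" using d by auto
  have K: "K \<ge> 0" by (simp add: K_def)
  have l0: "0 \<le> ?l" by (rule frequency(1)[OF d2])
  have half: "K / c \<le> 2 * K" if "1/2 \<le> c" for c
  proof -
    have "K / c \<le> K / (1/2)" using that K by (intro divide_left_mono) auto
    then show ?thesis by simp
  qed
  have l2: "?l \<le> 2 * K" using frequency_le[OF d2, of k] half[of "1 - 2 * d"] d by (simp add: K_def)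
  have scaled_kink_nonneg: "0 \<le> ?l * d" "?l * d \<le> 2 * K * d" using l0 l2 d by (auto intro: mult_right_mono)
  have small: "?l * d \<le> 1/2" using scaled_kink_nonneg d(3) by (simp add: mult_ac)
  have "?l * (1 - 2 * d) + 2 * bessel_phase (?l * d) = K"
    using frequency(2)[OF d2, of k] by (simp add: total_phase_def K_def)
  then have "?l * (1 - d) - K = - 2 * (bessel_phase (?l * d) - ?l * d / 2)" by (simp add: algebra_simps)
  moreover have "\<bar>- 2 * y\<bar> = 2 * \<bar>y\<bar>" for y :: real by simp
  ultimately have "\<bar>?l * (1 - d) - K\<bar> = 2 * \<bar>bessel_phase (?l * d) - ?l * d / 2\<bar>" by (simp only:)
  also have "\<dots> \<le> 2 * (2 * (?l * d) ^ 3)"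
    using bessel_phase_near_0[OF scaled_kink_nonneg(1) small] by (intro mult_left_mono) auto
  also have "\<dots> \<le> 2 * (2 * (2 * K * d) ^ 3)"
    using scaled_kink_nonneg by (intro mult_left_mono power_mono) auto
  also have "\<dots> = 32 * K ^ 3 * d ^ 3" by (simp add: power_mult_distrib)
  finally have e: "\<bar>?l * (1 - d) - K\<bar> \<le> 32 * K ^ 3 * d ^ 3" .
  have "?l - K / (1 - d) = (?l * (1 - d) - K) / (1 - d)" using d by (simp add: field_simps)
  then have "\<bar>?l - K / (1 - d)\<bar> = \<bar>?l * (1 - d) - K\<bar> / (1 - d)" using d by (simp add: abs_divide)
  also have "\<dots> \<le> (32 * K ^ 3 * d ^ 3) / (1/2)" using e d K by (intro frac_le) auto
  finally have e1: "\<bar>?l - K / (1 - d)\<bar> \<le> 64 * K ^ 3 * d ^ 3" by simp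
  have "?l\<^sup>2 - K\<^sup>2 / (1 - d)\<^sup>2 = (?l - K / (1 - d)) * (?l + K / (1 - d))"
    by (simp add: power2_eq_square algebra_simps)
  moreover have "\<bar>?l + K / (1 - d)\<bar> \<le> 4 * K"
  proof -
    have "0 \<le> K / (1 - d)" "K / (1 - d) \<le> 2 * K" using K d by (simp, intro half) auto
    then show ?thesis using l0 l2 by linarith
  qed
  then have "\<bar>(?l - K / (1 - d)) * (?l + K / (1 - d))\<bar> \<le> (64 * K ^ 3 * d ^ 3) * (4 * K)"
    unfolding abs_mult using e1 K d by (intro mult_mono) auto
  ultimately have "\<bar>?l\<^sup>2 - K\<^sup>2 / (1 - d)\<^sup>2\<bar> \<le> (64 * K ^ 3 * d ^ 3) * (4 * K)" by (simp only:)
  then have A: "\<bar>?l\<^sup>2 - K\<^sup>2 / (1 - d)\<^sup>2\<bar> \<le> 256 * K ^ 4 * d ^ 3"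
    by (simp add: power4_eq_xxxx power3_eq_cube mult_ac)
  have "K\<^sup>2 / (1 - d)\<^sup>2 - K\<^sup>2 / (1 - d) - (K\<^sup>2 * d + 2 * K\<^sup>2 * d\<^sup>2) = K\<^sup>2 * (3 * d ^ 3 - 2 * d ^ 4) / (1 - d)\<^sup>2"
  proof -
    define c where "c = 1 - d"
    have c: "c \<noteq> 0" "d = 1 - c" using d by (auto simp: c_def)
    show ?thesis
      unfolding c_def[symmetric] using c(1) by (simp add: field_simps) (simp add: c(2) power2_eq_square power3_eq_cube power4_eq_xxxx algebra_simps)
  qed
  moreover have "\<bar>K\<^sup>2 * (3 * d ^ 3 - 2 * d ^ 4) / (1 - d)\<^sup>2\<bar> \<le> (K\<^sup>2 * (3 * d ^ 3)) / (1/4)"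
  proof -
    have "d ^ 4 \<le> d ^ 3" using d by (intro power_decreasing) auto
    moreover have "0 \<le> d ^ 4" "0 \<le> d ^ 3" using d by auto
    ultimately have p: "0 \<le> 3 * d ^ 3 - 2 * d ^ 4" "3 * d ^ 3 - 2 * d ^ 4 \<le> 3 * d ^ 3" by linarith+
    have "(1/2)\<^sup>2 \<le> (1 - d)\<^sup>2" using d by (intro power_mono) auto
    then have "1/4 \<le> (1 - d)\<^sup>2" by (simp add: power2_eq_square)
    then have "K\<^sup>2 * (3 * d ^ 3 - 2 * d ^ 4) / (1 - d)\<^sup>2 \<le> (K\<^sup>2 * (3 * d ^ 3)) / (1/4)"
      using p d by (intro frac_le mult_left_mono mult_nonneg_nonneg) auto
    moreover have "0 \<le> K\<^sup>2 * (3 * d ^ 3 - 2 * d ^ 4) / (1 - d)\<^sup>2" using p by auto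
    ultimately show ?thesis by linarith
  qed
  ultimately have "\<bar>K\<^sup>2 / (1 - d)\<^sup>2 - K\<^sup>2 / (1 - d) - (K\<^sup>2 * d + 2 * K\<^sup>2 * d\<^sup>2)\<bar> \<le> 12 * K\<^sup>2 * d ^ 3" by simp
  then have "\<bar>?l\<^sup>2 - K\<^sup>2 / (1 - d) - (K\<^sup>2 * d + 2 * K\<^sup>2 * d\<^sup>2)\<bar> \<le> 256 * K ^ 4 * d ^ 3 + 12 * K\<^sup>2 * d ^ 3"
    using A by linarith
  then show ?thesis by (simp add: distrib_right)
qed

lemma eigenvalue_difference_bound:
  fixes K :: real and k :: nat
  defines "K \<equiv> real k * pi"
  assumes \<epsilon>: "0 < \<epsilon>" "\<epsilon> \<le> 1 / (2 * K + 2)"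
  shows "\<bar>mu_N k \<epsilon> - mu_Omega k \<epsilon> - ((real k)\<^sup>2 * pi\<^sup>2 * \<epsilon>\<^sup>2 + 2 * (real k)\<^sup>2 * pi\<^sup>2 * \<epsilon> ^ 4)\<bar>
    \<le> (256 * K ^ 4 + 12 * K\<^sup>2) * \<epsilon> ^ 6" "\<epsilon> < 1 / sqrt 2"
proof -
  have K: "K \<ge> 0" by (simp add: K_def)
  have m: "\<epsilon> * (2 * K + 2) \<le> 1" using \<epsilon> K by (simp add: field_simps)
  have eK: "0 \<le> \<epsilon> * K" using \<epsilon> K by simp
  have half: "\<epsilon> \<le> 1/2" "\<epsilon> * K \<le> 1/2" using m eK \<epsilon> by (auto simp: algebra_simps)
  have "sqrt 2 < 2" by (rule real_less_lsqrt) auto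
  then have "1/2 < 1 / sqrt 2" by (simp add: field_simps)
  then show e2: "\<epsilon> < 1 / sqrt 2" using half by linarith
  have d: "\<epsilon>\<^sup>2 \<le> 1/4" using power_mono[OF half(1), of 2] \<epsilon> by (simp add: power2_eq_square)
  have "\<epsilon> * (\<epsilon> * K) \<le> (1/2) * (1/2)" using half \<epsilon> eK by (intro mult_mono) auto
  then have dK: "\<epsilon>\<^sup>2 * (4 * K) \<le> 1" by (simp add: power2_eq_square mult_ac)
  have "real k * \<epsilon> \<le> 1/2"
  proof -
    have "real k * \<epsilon> * 1 \<le> real k * \<epsilon> * pi" using \<epsilon> pi_ge_two by (intro mult_left_mono) auto
    also have "\<dots> = \<epsilon> * K" by (simp add: K_def)
    finally show ?thesis using half(2) by simp
  qed
  moreover have "1/2 < side \<epsilon>"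
  proof (rule power_less_imp_less_base)
    show "(1/2)\<^sup>2 < (side \<epsilon>)\<^sup>2" unfolding side_square[OF \<epsilon>(1) e2] using d by (simp add: power2_eq_square)
  qed (use side_pos[OF \<epsilon>(1) e2] in simp)
  ultimately have k: "real k * \<epsilon> < side \<epsilon>" by linarith
  have e: "(\<epsilon>\<^sup>2)\<^sup>2 = \<epsilon> ^ 4" "(\<epsilon>\<^sup>2) ^ 3 = \<epsilon> ^ 6" by (simp_all add: power_mult[symmetric])
  have K2: "(real k)\<^sup>2 * pi\<^sup>2 = K\<^sup>2" by (simp add: K_def power_mult_distrib)
  show "\<bar>mu_N k \<epsilon> - mu_Omega k \<epsilon> - ((real k)\<^sup>2 * pi\<^sup>2 * \<epsilon>\<^sup>2 + 2 * (real k)\<^sup>2 * pi\<^sup>2 * \<epsilon> ^ 4)\<bar>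
    \<le> (256 * K ^ 4 + 12 * K\<^sup>2) * \<epsilon> ^ 6"
    using frequency_asymptotics[of "\<epsilon>\<^sup>2" k] d dK \<epsilon>
    unfolding mu_N_eq[OF \<epsilon>(1) e2] mu_Omega_eq[OF \<epsilon>(1) e2 k] e K_def[symmetric] mult.assoc[of 2] K2 by simp
qed

theorem proposition9p1:
  fixes k :: nat
  assumes "k \<ge> 1"
  shows "(\<forall>\<epsilon>::real. 0 < \<epsilon> \<and> \<epsilon> < 1 / sqrt 2 \<longrightarrow>
            diameter (rectangle \<epsilon>) = 1 \<and>
            (0, 0) \<in> closure (rectangle \<epsilon>) \<and> (side \<epsilon>, \<epsilon>) \<in> closure (rectangle \<epsilon>) \<and>
            dist (0, 0) (side \<epsilon>, \<epsilon>) = 1 \<and>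
            min_width (rectangle \<epsilon>) = \<epsilon>) \<and>
         (\<lambda>\<epsilon>. mu_N k \<epsilon> - mu_Omega k \<epsilon>
               - ((real k)\<^sup>2 * pi\<^sup>2 * \<epsilon>\<^sup>2 + 2 * (real k)\<^sup>2 * pi\<^sup>2 * \<epsilon> ^ 4))
            \<in> O[at_right 0](\<lambda>\<epsilon>. \<epsilon> ^ 6) \<and>
         ((\<lambda>\<epsilon>. (mu_N k \<epsilon> - mu_Omega k \<epsilon>) / (min_width (rectangle \<epsilon>))\<^sup>2)
            \<longlongrightarrow> (real k)\<^sup>2 * pi\<^sup>2) (at_right 0) \<and>
         (real k)\<^sup>2 * pi\<^sup>2 > 0"
proof (intro conjI allI impI)
  let ?K = "real k * pi"
  let ?c = "(real k)\<^sup>2 * pi\<^sup>2"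
  let ?C = "256 * ?K ^ 4 + 12 * ?K\<^sup>2"
  have small: "eventually (\<lambda>\<epsilon>. 0 < \<epsilon> \<and> \<epsilon> \<le> 1 / (2 * ?K + 2)) (at_right 0)"
  proof -
    have "0 < 1 / (2 * ?K + 2)" by (simp add: add_nonneg_pos)
    then show ?thesis unfolding eventually_at_right_field by (intro exI[of _ "1 / (2 * ?K + 2)"]) auto
  qed
  show "(\<lambda>\<epsilon>. mu_N k \<epsilon> - mu_Omega k \<epsilon> - (?c * \<epsilon>\<^sup>2 + 2 * (real k)\<^sup>2 * pi\<^sup>2 * \<epsilon> ^ 4)) \<in> O[at_right 0](\<lambda>\<epsilon>. \<epsilon> ^ 6)"
  proof (rule bigoI[where c = ?C])
    show "\<forall>\<^sub>F \<epsilon> in at_right 0. norm (mu_N k \<epsilon> - mu_Omega k \<epsilon> - (?c * \<epsilon>\<^sup>2 + 2 * (real k)\<^sup>2 * pi\<^sup>2 * \<epsilon> ^ 4)) \<le> ?C * norm (\<epsilon> ^ 6)"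
      using small
    proof eventually_elim
      case (elim \<epsilon>)
      then show ?case using eigenvalue_difference_bound(1)[of \<epsilon> k] by simp
    qed
  qed
  \<comment> \<open>divide the estimate with remainder \<open>O(\<epsilon>\<^sup>6)\<close> by \<open>\<epsilon>\<^sup>2\<close>\<close>
  show "((\<lambda>\<epsilon>. (mu_N k \<epsilon> - mu_Omega k \<epsilon>) / (min_width (rectangle \<epsilon>))\<^sup>2) \<longlongrightarrow> ?c) (at_right 0)"
  proof (rule LIM_zero_cancel, rule Lim_null_comparison)
    show "\<forall>\<^sub>F \<epsilon> in at_right 0. norm ((mu_N k \<epsilon> - mu_Omega k \<epsilon>) / (min_width (rectangle \<epsilon>))\<^sup>2 - ?c)
        \<le> 2 * ?c * \<epsilon>\<^sup>2 + ?C * \<epsilon> ^ 4"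
      using small
    proof eventually_elim
      case (elim \<epsilon>)
      define D where "D = mu_N k \<epsilon> - mu_Omega k \<epsilon>"
      have b: "\<bar>D - (?c * \<epsilon>\<^sup>2 + 2 * ?c * \<epsilon> ^ 4)\<bar> \<le> ?C * \<epsilon> ^ 6" "\<epsilon> < 1 / sqrt 2"
        using eigenvalue_difference_bound[of \<epsilon> k] elim by (auto simp: D_def mult.assoc)
      have w: "min_width (rectangle \<epsilon>) = \<epsilon>" using min_width_rectangle elim b(2) by simp
      have "0 \<le> 2 * ?c * \<epsilon> ^ 4" by simp
      then have "\<bar>D - ?c * \<epsilon>\<^sup>2\<bar> \<le> 2 * ?c * \<epsilon> ^ 4 + ?C * \<epsilon> ^ 6" using b(1) by linarith
      then have "\<bar>D - ?c * \<epsilon>\<^sup>2\<bar> / \<epsilon>\<^sup>2 \<le> (2 * ?c * \<epsilon> ^ 4 + ?C * \<epsilon> ^ 6) / \<epsilon>\<^sup>2" by (rule divide_right_mono) simp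
      moreover have "\<bar>D - ?c * \<epsilon>\<^sup>2\<bar> / \<epsilon>\<^sup>2 = \<bar>D / \<epsilon>\<^sup>2 - ?c\<bar>"
      proof -
        have "D / \<epsilon>\<^sup>2 - ?c = (D - ?c * \<epsilon>\<^sup>2) / \<epsilon>\<^sup>2" using elim by (simp add: diff_divide_distrib)
        then show ?thesis by (simp add: abs_divide)
      qed
      moreover have "(2 * ?c * \<epsilon> ^ 4 + ?C * \<epsilon> ^ 6) / \<epsilon>\<^sup>2 = 2 * ?c * \<epsilon>\<^sup>2 + ?C * \<epsilon> ^ 4"
      proof -
        have "\<epsilon> ^ 4 = \<epsilon>\<^sup>2 * \<epsilon>\<^sup>2" "\<epsilon> ^ 6 = \<epsilon> ^ 4 * \<epsilon>\<^sup>2" by (simp_all add: power_add[symmetric])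
        then have "2 * ?c * \<epsilon> ^ 4 + ?C * \<epsilon> ^ 6 = (2 * ?c * \<epsilon>\<^sup>2 + ?C * \<epsilon> ^ 4) * \<epsilon>\<^sup>2" by (simp only: distrib_right mult.assoc)
        then show ?thesis using elim by (simp only: nonzero_mult_div_cancel_right power_not_zero less_imp_neq[THEN not_sym] simp_thms)
      qed
      ultimately show ?case by (simp add: w D_def)
    qed
    have "((\<lambda>\<epsilon>. 2 * ?c * \<epsilon>\<^sup>2 + ?C * \<epsilon> ^ 4) \<longlongrightarrow> 2 * ?c * 0\<^sup>2 + ?C * 0 ^ 4) (at_right 0)"
      by (intro tendsto_intros)
    then show "((\<lambda>\<epsilon>. 2 * ?c * \<epsilon>\<^sup>2 + ?C * \<epsilon> ^ 4) \<longlongrightarrow> 0) (at_right 0)" by simp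
  qed
  show "?c > 0" using assms by simp
qed (simp_all add: diameter_rectangle corners_in_closure dist_diagonal min_width_rectangle)

end
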